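(* Let $m$ be a positive integer. The Gauss-Bargmann transform $G$, determined by $G h_\beta = e_\beta$ for all multi-indices $\beta$ (and extended from the linear span of $\{h_\beta\}$ by linearity and continuity), is an isometry from the Gauss-Sobolev space $W^{2,m}(\gamma)$ to the Fock-Sobolev space $F^{2,m}$.
   Context: Let $d\lambda(z)=\pi^{-n}e^{-|z|^2}dv(z)$ on $\mathbb{C}^n$ ($dv$ is Lebesgue volume measure). The Fock space $F^2$ is the space of entire functions $f$ on $\mathbb{C}^n$ with $\|f\|_{F^2}=(\int_{\mathbb{C}^n}|f|^2d\lambda)^{1/2}<\infty$. The Fock-Sobolev space $F^{2,m}$ is the space of entire functions $f$ on $\mathbb{C}^n$ with $\|f\|_{F^{2,m}}=\sum_{|\alpha|\le m}\|\partial^\alpha f\|_{F^2}<\infty$. Let $d\gamma(x)=(2\pi)^{-n/2}e^{-|x|^2/2}dx$ on $\mathbb{R}^n$. The Gauss-Sobolev space $W^{2,m}(\gamma)$ is the completion of $C_0^\infty(\mathbb{R}^n)$ (smooth compactly supported functions) with respect to the norm $\|f\|_{W^{2,m}(\gamma)}=\sum_{0\le|\alpha|\le m}\left[\int_{\mathbb{R}^n}|\partial^\alpha f|^2d\gamma\right]^{1/2}$. For a multi-index $\beta=(\beta_1,\dots,\beta_n)$ of non-negative integers, $H_\beta(x)=\prod_{i=1}^n(-1)^{\beta_i}e^{x_i^2}\frac{\partial^{\beta_i}}{\partial x_i^{\beta_i}}(e^{-x_i^2})$, the normalized Hermite function is $h_\beta(x)=(2^{|\beta|}\beta!)^{-1/2}H_\beta(x/\sqrt2)$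 (an orthonormal family in $L^2(\gamma)$ whose linear span is dense in $W^{2,m}(\gamma)$), and $e_\beta(z)=z^\beta/\sqrt{\beta!}$, $z\in\mathbb{C}^n$. *)

theory Defs
  imports "HOL-Analysis.Analysis"
begin

text \<open>
  The dimension \<open>n\<close> is \<open>CARD('n)\<close>; multi-indices are functions \<open>\<alpha> :: 'n \<Rightarrow> nat\<close>.
\<close>

definition mi_size :: "('n::finite \<Rightarrow> nat) \<Rightarrow> nat" where
  "mi_size \<alpha> = (\<Sum>j\<in>UNIV. \<alpha> j)"

definition mi_fact :: "('n::finite \<Rightarrow> nat) \<Rightarrow> nat" where
  "mi_fact \<alpha> = (\<Prod>j\<in>UNIV. fact (\<alpha> j))"

text \<open>
  The index type carries no order, so \<open>\<partial>\<^sup>\<alpha>\<close> applies the first-order operators \<open>D j\<close> along some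
  list in which every \<open>j\<close> occurs \<open>\<alpha> j\<close> times. It is used only for smooth functions on
  \<open>\<real>\<^sup>n\<close> and entire functions on \<open>\<complex>\<^sup>n\<close>, where the order of differentiation is irrelevant.
\<close>

definition mi_deriv :: "('n::finite \<Rightarrow> 'f \<Rightarrow> 'f) \<Rightarrow> ('n \<Rightarrow> nat) \<Rightarrow> 'f \<Rightarrow> 'f" where
  "mi_deriv D \<alpha> f = foldr D (SOME js. \<forall>j. count_list js j = \<alpha> j) f"

definition rpartial :: "'n::finite \<Rightarrow> (real^'n \<Rightarrow> complex) \<Rightarrow> (real^'n \<Rightarrow> complex)" where
  "rpartial j f = (\<lambda>x. vector_derivative (\<lambda>t. f (x + axis j t)) (at 0))"

definition cpartial :: "'n::finite \<Rightarrow> (complex^'n \<Rightarrow> complex) \<Rightarrow> (complex^'n \<Rightarrow> complex)" where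
  "cpartial j f = (\<lambda>z. deriv (\<lambda>w. f (z + axis j w)) 0)"

definition smooth :: "(real^'n::finite \<Rightarrow> complex) \<Rightarrow> bool" where
  "smooth f \<longleftrightarrow> (\<forall>js x. foldr rpartial js f differentiable (at x))"

definition test_functions :: "(real^'n::finite \<Rightarrow> complex) set" where
  "test_functions = {f. smooth f \<and> compact (closure {x. f x \<noteq> 0})}"

definition entire :: "(complex^'n::finite \<Rightarrow> complex) \<Rightarrow> bool" where
  "entire f \<longleftrightarrow> (\<forall>z. \<exists>D. (f has_derivative D) (at z) \<and> (\<forall>c v. D (c *s v) = c * D v))"

definition square_integrable :: "'a measure \<Rightarrow> ('a \<Rightarrow> complex) \<Rightarrow> bool" where
  "square_integrable M f \<longleftrightarrow>
     f \<in> borel_measurable M \<and> integrable M (\<lambda>x. (cmod (f x))\<^sup>2)"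

definition l2norm :: "'a measure \<Rightarrow> ('a \<Rightarrow> complex) \<Rightarrow> real" where
  "l2norm M f = sqrt (\<integral>x. (cmod (f x))\<^sup>2 \<partial>M)"

definition fock_measure :: "(complex^'n::finite) measure" where
  "fock_measure = density lborel (\<lambda>z. ennreal (exp (- (norm z)\<^sup>2) / pi ^ CARD('n)))"

definition gauss_measure :: "(real^'n::finite) measure" where
  "gauss_measure = density lborel
     (\<lambda>x. ennreal ((2 * pi) powr (- real CARD('n) / 2) * exp (- (norm x)\<^sup>2 / 2)))"

definition fock_sobolev :: "nat \<Rightarrow> (complex^'n::finite \<Rightarrow> complex) set" where
  "fock_sobolev m = {f. entire f \<and>
     (\<forall>\<alpha>. mi_size \<alpha> \<le> m \<longrightarrow> square_integrable fock_measure (mi_deriv cpartial \<alpha> f))}"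

definition fock_sobolev_norm :: "nat \<Rightarrow> (complex^'n::finite \<Rightarrow> complex) \<Rightarrow> real" where
  "fock_sobolev_norm m f =
     (\<Sum>\<alpha> | mi_size \<alpha> \<le> m. l2norm fock_measure (mi_deriv cpartial \<alpha> f))"

definition test_norm :: "nat \<Rightarrow> (real^'n::finite \<Rightarrow> complex) \<Rightarrow> real" where
  "test_norm m f =
     (\<Sum>\<alpha> | mi_size \<alpha> \<le> m. l2norm gauss_measure (mi_deriv rpartial \<alpha> f))"

text \<open>
  The completion of the test functions for \<open>test_norm m\<close>, realised as a space of functions: the
  point of the completion given by a Cauchy sequence \<open>\<phi>\<close> is identified with the limit of \<open>\<phi>\<close> in
  \<open>L\<^sup>2(\<gamma>)\<close>, and its norm is \<open>lim test_norm m (\<phi> k)\<close>. The operators \<open>\<partial>\<^sup>\<alpha>\<close> are closable in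
  \<open>L\<^sup>2(\<gamma>)\<close>, so two Cauchy sequences with the same limit in \<open>L\<^sup>2(\<gamma>)\<close> give the same point; hence
  this identification is injective and the norm below does not depend on \<open>\<phi>\<close>. Elements are
  functions, not classes: functions that agree almost everywhere represent the same point and
  differ by a function of norm \<open>0\<close>.
\<close>

definition gs_approx :: "nat \<Rightarrow> (nat \<Rightarrow> real^'n::finite \<Rightarrow> complex) \<Rightarrow> (real^'n \<Rightarrow> complex) \<Rightarrow> bool"
  where
  "gs_approx m \<phi> f \<longleftrightarrow>
     (\<forall>k. \<phi> k \<in> test_functions) \<and>
     (\<forall>e>0. \<exists>N. \<forall>k\<ge>N. \<forall>l\<ge>N. test_norm m (\<lambda>x. \<phi> k x - \<phi> l x) < e) \<and>
     square_integrable gauss_measure f \<and>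
     (\<lambda>k. l2norm gauss_measure (\<lambda>x. \<phi> k x - f x)) \<longlonglongrightarrow> 0"

definition gauss_sobolev :: "nat \<Rightarrow> (real^'n::finite \<Rightarrow> complex) set" where
  "gauss_sobolev m = {f. \<exists>\<phi>. gs_approx m \<phi> f}"

definition gauss_sobolev_norm :: "nat \<Rightarrow> (real^'n::finite \<Rightarrow> complex) \<Rightarrow> real" where
  "gauss_sobolev_norm m f =
     (THE l. \<forall>\<phi>. gs_approx m \<phi> f \<longrightarrow> (\<lambda>k. test_norm m (\<phi> k)) \<longlonglongrightarrow> l)"

definition hermite_H :: "('n::finite \<Rightarrow> nat) \<Rightarrow> real^'n \<Rightarrow> real" where
  "hermite_H \<beta> x =
     (\<Prod>i\<in>UNIV. (-1) ^ \<beta> i * exp ((x $ i)\<^sup>2) * (deriv ^^ \<beta> i) (\<lambda>t. exp (- t\<^sup>2)) (x $ i))"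

definition hermite_h :: "('n::finite \<Rightarrow> nat) \<Rightarrow> real^'n \<Rightarrow> complex" where
  "hermite_h \<beta> x =
     of_real (hermite_H \<beta> ((1 / sqrt 2) *\<^sub>R x) / sqrt (2 ^ mi_size \<beta> * real (mi_fact \<beta>)))"

definition fock_e :: "('n::finite \<Rightarrow> nat) \<Rightarrow> complex^'n \<Rightarrow> complex" where
  "fock_e \<beta> z = (\<Prod>i\<in>UNIV. (z $ i) ^ \<beta> i) / of_real (sqrt (real (mi_fact \<beta>)))"

text \<open>
  Only the values of \<open>G\<close> on \<open>gauss_sobolev m\<close> matter. Linearity and continuity force \<open>G\<close> to take
  the same value on functions that agree almost everywhere, so \<open>G\<close> is a map on the completion.
\<close>

definition gauss_bargmann ::
  "nat \<Rightarrow> ((real^'n::finite \<Rightarrow> complex) \<Rightarrow> (complex^'n \<Rightarrow> complex)) \<Rightarrow> bool" where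
  "gauss_bargmann m G \<longleftrightarrow>
     (\<forall>f\<in>gauss_sobolev m. G f \<in> fock_sobolev m) \<and>
     (\<forall>f\<in>gauss_sobolev m. \<forall>g\<in>gauss_sobolev m. \<forall>a b.
        G (\<lambda>x. a * f x + b * g x) = (\<lambda>z. a * G f z + b * G g z)) \<and>
     (\<forall>f\<in>gauss_sobolev m. \<forall>u. (\<forall>k. u k \<in> gauss_sobolev m) \<longrightarrow>
        (\<lambda>k. gauss_sobolev_norm m (\<lambda>x. u k x - f x)) \<longlonglongrightarrow> 0 \<longrightarrow>
        (\<lambda>k. fock_sobolev_norm m (\<lambda>z. G (u k) z - G f z)) \<longlonglongrightarrow> 0) \<and>
     (\<forall>\<beta>. G (hermite_h \<beta>) = fock_e \<beta>)"

end

theory Submission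
  imports Defs "HOL-Probability.Probability" "HOL-Complex_Analysis.Complex_Analysis"
begin

text \<open>
  The transform is the integral operator \<open>G f(z) = \<integral> f(x) E(x,z) d\<gamma>(x)\<close> whose kernel
  \<open>E(x,z) = exp (x \<cdot> z - z \<cdot> z / 2)\<close> is the generating function of the Hermite functions, so that
  \<open>G h\<^sub>\<beta> = e\<^sub>\<beta>\<close>. Three properties of this operator carry the proof.

  It commutes with differentiation. Since \<open>E(x,z) exp (- x \<cdot> x / 2)\<close> is a function of \<open>x - z\<close>,
  integration by parts turns \<open>\<partial>/\<partial>z\<^sub>j\<close> of \<open>G u\<close> into \<open>G\<close> of \<open>\<partial>u/\<partial>x\<^sub>j\<close>, for every smooth \<open>u\<close> whose
  derivatives grow at most exponentially. The identity is iterated along a list of first-order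
  operators, with the same list on both sides (\<open>foldr_cpartial_bargmann\<close>).

  It is isometric from \<open>L\<^sup>2(\<gamma>)\<close> to the Fock space on test functions (\<open>bargmann_test_function\<close>).
  For fixed real part of \<open>z\<close>, the function \<open>G \<phi>\<close> is up to Gaussian factors a Fourier transform in
  the imaginary part, so this is a form of Plancherel's theorem and is proved like it: with an extra Gaussian factor \<open>exp (- \<epsilon> |z|\<^sup>2)\<close> the norm of \<open>G \<phi>\<close>
  becomes a double integral against an explicit Gaussian kernel concentrating on the diagonal, and
  \<open>\<epsilon>\<close> tends to \<open>0\<close>. Together with the first property this makes \<open>G\<close> isometric for each seminorm
  \<open>\<parallel>\<partial>\<^sup>\<alpha> f\<parallel>\<close>, hence for the Sobolev norms of test functions. To pass to the completion, an
  \<open>L\<^sup>2(\<gamma>)\<close>-limit becomes, under \<open>G\<close>, a locally uniform limit of entire functions; Cauchy's estimate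
  makes all their derivatives converge, and Fatou's lemma converts this into convergence of the
  Fock norms (\<open>gs_approx_derivative\<close>). The limit of the Sobolev norms of an approximating sequence of
  \<open>f\<close> is thereby the Fock-Sobolev norm of \<open>G f\<close>, whatever the sequence; this shows both that the norm
  of the completion is well defined and that \<open>G\<close> preserves it.

  It is the only continuous linear extension, because the Hermite functions span a dense subspace
  for the Sobolev norm. Write \<open>S\<^sub>N\<close> for the orthogonal projection of \<open>L\<^sup>2(\<gamma>)\<close> onto the span of the
  \<open>h\<^sub>\<beta>\<close> with \<open>|\<beta>| \<le> N\<close>. Integration by parts gives \<open>\<partial>\<^sub>j S\<^sub>N\<^sub>+\<^sub>1 = S\<^sub>N \<partial>\<^sub>j\<close>, which reduces density in the
  Sobolev norm to convergence \<open>S\<^sub>N g \<rightarrow> g\<close> in \<open>L\<^sup>2(\<gamma>)\<close> (\<open>hermite_sum_dense\<close>). For the latter,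
  \<open>\<parallel>E(\<cdot>,z) - S\<^sub>N E(\<cdot>,z)\<parallel>\<^sup>2 = exp |z|\<^sup>2 - \<Sum> |e\<^sub>\<beta>(z)|\<^sup>2\<close> tends to \<open>0\<close>, so \<open>G (S\<^sub>N g)\<close> tends to \<open>G g\<close>
  pointwise; Bessel's inequality makes \<open>S\<^sub>N g\<close> a Cauchy sequence, and Fatou's lemma combines the two
  into convergence in the Fock norm (\<open>bargmann_hermite_sum_l2_tendsto\<close>).

  That the Hermite functions belong to the Gauss-Sobolev space at all is shown by cutting them off
  with \<open>\<rho>(1 - s\<^sup>2 |x|\<^sup>2)\<close>, where \<open>\<rho>(t) = exp (-1/t)\<close>, and letting \<open>s\<close> tend to \<open>0\<close>
  (\<open>cutoff_family_gauss_sobolev\<close>).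
\<close>

notation gauss_measure ("\<gamma>")

section \<open>Gaussian integrals over coordinates\<close>

text \<open>
  Lebesgue measure on a Euclidean space is by definition the image of the product measure on the
  coordinates with respect to \<open>Basis\<close>, so Fubini's theorem for finite products applies. The two
  corollaries below index the coordinates of \<open>\<real>\<^sup>n\<close> and the real and imaginary parts in \<open>\<complex>\<^sup>n\<close>.
\<close>

lemma integral_prod_lborel:
  fixes f :: "'a::euclidean_space \<Rightarrow> real \<Rightarrow> complex"
  assumes "\<And>b. b \<in> Basis \<Longrightarrow> integrable lborel (f b)"
  shows "integrable lborel (\<lambda>x. \<Prod>b\<in>Basis. f b (x \<bullet> b))"
    and "(\<integral>x. (\<Prod>b\<in>Basis. f b (x \<bullet> b)) \<partial>lborel) = (\<Prod>b\<in>Basis. \<integral>t. f b t \<partial>lborel)"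
proof -
  interpret product_sigma_finite "\<lambda>_::'a. lborel :: real measure" by standard
  have [measurable]: "f b \<in> borel_measurable borel" if "b \<in> Basis" for b
    using assms[OF that] by (auto dest: borel_measurable_integrable)
  have m: "(\<lambda>x. \<Prod>b\<in>Basis. f b (x \<bullet> b)) \<in> borel_measurable borel"
    by (intro borel_measurable_prod) measurable
  have T: "(\<lambda>g. \<Sum>b\<in>Basis. g b *\<^sub>R b) \<in> measurable (Pi\<^sub>M Basis (\<lambda>_::'a. lborel::real measure)) borel"
    by measurable
  have eq: "(\<Prod>b\<in>Basis. f b ((\<Sum>c\<in>Basis. g c *\<^sub>R c) \<bullet> b)) = (\<Prod>b\<in>Basis. f b (g b))" for g
    by (intro prod.cong refl) (simp add: inner_sum_left inner_Basis if_distrib cong: if_cong)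
  show "integrable lborel (\<lambda>x. \<Prod>b\<in>Basis. f b (x \<bullet> b))"
    by (subst lborel_eq, subst integrable_distr_eq[OF T m], unfold eq,
        rule product_integrable_prod) (use assms in auto)
  show "(\<integral>x. (\<Prod>b\<in>Basis. f b (x \<bullet> b)) \<partial>lborel) = (\<Prod>b\<in>Basis. \<integral>t. f b t \<partial>lborel)"
    by (subst lborel_eq, subst integral_distr[OF T m], unfold eq,
        rule product_integral_prod) (use assms in auto)
qed

lemma prod_Basis_vec:
  fixes h :: "'a::euclidean_space^'n \<Rightarrow> 'b::comm_monoid_mult"
  shows "(\<Prod>b\<in>Basis. h b) = (\<Prod>i\<in>UNIV. \<Prod>u\<in>Basis. h (axis i u))"
proof -
  have eq: "(Basis :: ('a^'n) set) = (\<lambda>(i,u). axis i u) ` (UNIV \<times> Basis)"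
    by (auto simp: Basis_vec_def)
  have inj: "inj_on (\<lambda>(i,u). axis i u :: 'a^'n) (UNIV \<times> Basis)"
    by (auto simp: inj_on_def axis_eq_axis)
  show ?thesis
    unfolding eq by (subst prod.reindex[OF inj]) (simp add: prod.cartesian_product case_prod_beta')
qed

lemma integral_prod_real_vec:
  fixes f :: "'n::finite \<Rightarrow> real \<Rightarrow> complex"
  assumes "\<And>i. integrable lborel (f i)"
  shows "integrable lborel (\<lambda>x::real^'n. \<Prod>i\<in>UNIV. f i (x $ i))"
    and "(\<integral>x. (\<Prod>i\<in>UNIV. f i ((x::real^'n) $ i)) \<partial>lborel) = (\<Prod>i\<in>UNIV. \<integral>t. f i t \<partial>lborel)"
proof -
  define F where "F = (\<lambda>b::real^'n. f (SOME i. b = axis i 1))"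
  have F: "F (axis i 1) = f i" for i
    unfolding F_def by (simp add: axis_eq_axis)
  have P: "(\<Prod>b\<in>Basis. F b (x \<bullet> b)) = (\<Prod>i\<in>UNIV. f i (x $ i))" for x
    by (simp add: prod_Basis_vec F inner_axis)
  have I: "integrable lborel (F b)" for b
    using assms by (simp add: F_def)
  show "integrable lborel (\<lambda>x::real^'n. \<Prod>i\<in>UNIV. f i (x $ i))"
    using integral_prod_lborel(1)[of F] I by (simp add: P)
  show "(\<integral>x. (\<Prod>i\<in>UNIV. f i ((x::real^'n) $ i)) \<partial>lborel) = (\<Prod>i\<in>UNIV. \<integral>t. f i t \<partial>lborel)"
    using integral_prod_lborel(2)[of F] I by (simp add: P) (simp add: prod_Basis_vec F)
qed

lemma integral_prod_complex_vec:
  fixes f g :: "'n::finite \<Rightarrow> real \<Rightarrow> complex"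
  assumes "\<And>i. integrable lborel (f i)" "\<And>i. integrable lborel (g i)"
  shows "integrable lborel (\<lambda>z::complex^'n. \<Prod>i\<in>UNIV. f i (Re (z $ i)) * g i (Im (z $ i)))"
    and "(\<integral>z. (\<Prod>i\<in>UNIV. f i (Re ((z::complex^'n) $ i)) * g i (Im (z $ i))) \<partial>lborel) =
      (\<Prod>i\<in>UNIV. (\<integral>t. f i t \<partial>lborel) * (\<integral>t. g i t \<partial>lborel))"
proof -
  define F where "F = (\<lambda>b::complex^'n. if \<exists>i. b = axis i 1 then f (SOME i. b = axis i 1)
     else g (SOME i. b = axis i \<i>))"
  have F: "F (axis i 1) = f i" "F (axis i \<i>) = g i" for i
    unfolding F_def by (auto simp add: axis_eq_axis complex_eq_iff)
  have P: "(\<Prod>b\<in>Basis. F b (x \<bullet> b)) = (\<Prod>i\<in>UNIV. f i (Re (x $ i)) * g i (Im (x $ i)))" for x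
    by (simp add: prod_Basis_vec F inner_axis Basis_complex_def)
  have I: "integrable lborel (F b)" for b
    using assms by (simp add: F_def)
  show "integrable lborel (\<lambda>z::complex^'n. \<Prod>i\<in>UNIV. f i (Re (z $ i)) * g i (Im (z $ i)))"
    using integral_prod_lborel(1)[of F] I by (simp add: P)
  show "(\<integral>z. (\<Prod>i\<in>UNIV. f i (Re ((z::complex^'n) $ i)) * g i (Im (z $ i))) \<partial>lborel) =
      (\<Prod>i\<in>UNIV. (\<integral>t. f i t \<partial>lborel) * (\<integral>t. g i t \<partial>lborel))"
    using integral_prod_lborel(2)[of F] I
    by (simp add: P) (simp add: prod_Basis_vec F Basis_complex_def)
qed

text \<open>
  Completing the square with respect to the real part of \<open>p\<close> leaves an oscillating factor, whose
  integral is the characteristic function of the standard normal distribution.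
\<close>

lemma gaussian_integral:
  fixes p :: complex and q :: real
  assumes q: "0 < q"
  shows "has_bochner_integral lborel (\<lambda>t. exp (p * of_real t - of_real (q * t\<^sup>2)))
           (of_real (sqrt (pi / q)) * exp (p\<^sup>2 / of_real (4 * q)))"
proof -
  define s where "s = sqrt (2 * q)"
  \<comment> \<open>The substitution \<open>t = a + u / s\<close> centres the Gaussian and normalises its variance.\<close>
  define a where "a = Re p / (2 * q)"
  have s: "s > 0" "s\<^sup>2 = 2 * q" using q by (auto simp: s_def)
  define g where "g = (\<lambda>t. exp (p * of_real t - of_real (q * t\<^sup>2)))"
  define C where "C = of_real (sqrt (2 * pi)) * exp (of_real ((Re p)\<^sup>2 / (4 * q)) + \<i> * of_real (Im p * a))"
  have gs: "g (a + t / s) = C * (of_real (std_normal_density t) * exp (\<i> * of_real ((Im p / s) * t)))" for t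
  proof -
    have "p * of_real (a + t / s) - of_real (q * (a + t / s)\<^sup>2)
      = of_real ((Re p)\<^sup>2 / (4 * q)) + \<i> * of_real (Im p * a) + of_real (- t\<^sup>2 / 2)
        + \<i> * of_real ((Im p / s) * t)"
    proof (rule complex_eqI)
      define u where "u = t / s"
      have u: "q * u\<^sup>2 = t\<^sup>2 / 2"
        using s q by (simp add: u_def power_divide field_simps)
      have a: "Re p = 2 * q * a" using q by (simp add: a_def)
      have a2: "(Re p)\<^sup>2 / (4 * q) = q * a\<^sup>2"
        using q unfolding a by (simp add: power2_eq_square)
      have "Re p * (a + u) - q * (a + u)\<^sup>2 = (Re p)\<^sup>2 / (4 * q) - t\<^sup>2 / 2"
        unfolding a2 u[symmetric] unfolding a by (simp add: power2_eq_square algebra_simps)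
      then show "Re (p * of_real (a + t / s) - of_real (q * (a + t / s)\<^sup>2)) =
         Re (of_real ((Re p)\<^sup>2 / (4 * q)) + \<i> * of_real (Im p * a) + of_real (- t\<^sup>2 / 2)
        + \<i> * of_real ((Im p / s) * t))"
        by (simp add: u_def)
    qed (simp add: algebra_simps)
    then have E: "g (a + t / s) = exp (of_real ((Re p)\<^sup>2 / (4 * q)) + \<i> * of_real (Im p * a))
        * of_real (exp (- t\<^sup>2 / 2)) * exp (\<i> * of_real ((Im p / s) * t))"
      unfolding g_def by (simp only: exp_add exp_of_real[symmetric])
    have D: "(of_real (exp (- t\<^sup>2 / 2)) :: complex) = of_real (sqrt (2 * pi)) * of_real (std_normal_density t)"
      unfolding of_real_mult[symmetric] std_normal_density_def by simp
    show ?thesis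
      unfolding E C_def D by (simp only: mult_ac)
  qed
  have N: "has_bochner_integral lborel (\<lambda>t. of_real (std_normal_density t) * exp (\<i> * of_real ((Im p / s) * t)))
     (of_real (exp (- ((Im p / s)\<^sup>2) / 2)))"
  proof -
    interpret prob_space std_normal_distribution
      by (intro prob_space_normal_density) simp
    have I: "integrable std_normal_distribution (\<lambda>t. exp (\<i> * of_real ((Im p / s) * t)))"
      by (rule integrable_const_bound[of _ 1]) (auto simp: norm_exp_eq_Re)
    have "integrable lborel (\<lambda>t. of_real (std_normal_density t) * exp (\<i> * of_real ((Im p / s) * t)))"
      using I by (subst (asm) integrable_density) (auto simp: scaleR_conv_of_real)
    moreover have "(\<integral>t. of_real (std_normal_density t) * exp (\<i> * of_real ((Im p / s) * t)) \<partial>lborel)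
      = char std_normal_distribution (Im p / s)"
      unfolding char_def by (subst integral_density) (auto simp: scaleR_conv_of_real)
    ultimately show ?thesis
      by (simp add: has_bochner_integral_iff char_std_normal_distribution)
  qed
  have "has_bochner_integral lborel (\<lambda>t. g (a + (1 / s) * t)) (C * of_real (exp (- ((Im p / s)\<^sup>2) / 2)))"
    using has_bochner_integral_mult_right[OF N, of C] by (simp add: gs del: of_real_divide of_real_mult)
  then have "has_bochner_integral lborel g ((1 / s) *\<^sub>R (C * of_real (exp (- ((Im p / s)\<^sup>2) / 2))))"
    using s by (subst lborel_has_bochner_integral_real_affine_iff[where c="1/s" and t=a]) auto
  moreover have "(1 / s) *\<^sub>R (C * of_real (exp (- ((Im p / s)\<^sup>2) / 2)))
     = of_real (sqrt (pi / q)) * exp (p\<^sup>2 / of_real (4 * q))"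
  proof -
    have 1: "sqrt (2 * pi) / s = sqrt (pi / q)"
      unfolding s_def by (simp add: real_sqrt_divide real_sqrt_mult)
    have 2: "p\<^sup>2 / of_real (4 * q) = of_real ((Re p)\<^sup>2 / (4 * q)) + \<i> * of_real (Im p * a)
       + of_real (- ((Im p / s)\<^sup>2) / 2)"
      using q s by (intro complex_eqI)
        (simp_all add: a_def power_divide power2_eq_square Re_divide_of_real Im_divide_of_real field_simps)
    show ?thesis
      unfolding 2 1[symmetric] C_def exp_of_real[symmetric]
      by (simp add: exp_add scaleR_conv_of_real mult_ac del: of_real_power of_real_minus)
  qed
  ultimately show ?thesis by (simp add: g_def)
qed

text \<open>
  The linear exponent is absorbed by half of the quadratic one; the remaining Gaussian factors over
  the coordinates. Functions of this form are the dominating functions of the convergence and Fubini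
  arguments on \<open>\<real>\<^sup>n\<close> and \<open>\<complex>\<^sup>n\<close> below.
\<close>

lemma integrable_exp_norm_gaussian:
  assumes q: "0 < q"
  shows "integrable lborel (\<lambda>x::'a::euclidean_space. exp (c * norm x - q * (norm x)\<^sup>2))"
proof -
  have "integrable lborel (\<lambda>x::'a. \<Prod>b\<in>Basis. exp (0 * of_real (x \<bullet> b) - of_real ((q/2) * (x \<bullet> b)\<^sup>2)) :: complex)"
    by (rule integral_prod_lborel(1)) (rule has_bochner_integral_iff[THEN iffD1, THEN conjunct1, OF gaussian_integral], use q in auto)
  moreover have "(\<Prod>b\<in>Basis. exp (0 * of_real (x \<bullet> b) - of_real ((q/2) * (x \<bullet> b)\<^sup>2)) :: complex)
    = of_real (exp (- (q/2) * (norm x)\<^sup>2))" for x :: 'a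
    unfolding power2_norm_eq_inner euclidean_inner[of x x]
    by (simp add: exp_sum[symmetric] exp_of_real[symmetric] sum_distrib_left sum_negf power2_eq_square algebra_simps del: exp_of_real)
  ultimately have "integrable lborel (\<lambda>x::'a. of_real (exp (- (q/2) * (norm x)\<^sup>2)) :: complex)" by simp
  then have I: "integrable lborel (\<lambda>x::'a. exp (- (q/2) * (norm x)\<^sup>2))"
    using integrable_norm by fastforce
  have B: "exp (c * norm x - q * (norm x)\<^sup>2) \<le> exp (c\<^sup>2 / (2*q)) * exp (- (q/2) * (norm x)\<^sup>2)" for x :: 'a
  proof -
    have "0 \<le> (c - q * norm x)\<^sup>2 / (2 * q)" using q by simp
    also have "\<dots> = c\<^sup>2 / (2*q) - c * norm x + (q/2) * (norm x)\<^sup>2"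
      using q by (simp add: power2_eq_square field_simps)
    finally show ?thesis by (simp add: exp_add[symmetric])
  qed
  show ?thesis
    by (rule Bochner_Integration.integrable_bound[OF integrable_mult_right[OF I, of "exp (c\<^sup>2 / (2*q))"]])
      (use B in auto)
qed

section \<open>Square-integrable functions\<close>

lemma square_integrable_measurable: "square_integrable M f \<Longrightarrow> f \<in> borel_measurable M"
  by (simp add: square_integrable_def)

lemma square_integrable_sq: "square_integrable M f \<Longrightarrow> integrable M (\<lambda>x. (cmod (f x))\<^sup>2)"
  by (simp add: square_integrable_def)

lemma square_integrable_bound:
  assumes "f \<in> borel_measurable M" "integrable M g" "\<And>x. x \<in> space M \<Longrightarrow> (cmod (f x))\<^sup>2 \<le> g x"
  shows "square_integrable M f"
  unfolding square_integrable_def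
proof
  show "integrable M (\<lambda>x. (cmod (f x))\<^sup>2)"
    by (rule Bochner_Integration.integrable_bound[OF assms(2)])
      (use assms(1) in \<open>auto intro!: AE_I2 order_trans[OF assms(3)]\<close>)
qed (rule assms)

lemma square_integrable_cmult: "square_integrable M f \<Longrightarrow> square_integrable M (\<lambda>x. c * f x)"
  by (auto simp: square_integrable_def norm_mult power_mult_distrib)

lemma square_integrable_add:
  assumes "square_integrable M f" "square_integrable M g"
  shows "square_integrable M (\<lambda>x. f x + g x)"
proof (rule square_integrable_bound)
  show "integrable M (\<lambda>x. 2 * (cmod (f x))\<^sup>2 + 2 * (cmod (g x))\<^sup>2)"
    using assms by (auto simp: square_integrable_def)
  show "(cmod (f x + g x))\<^sup>2 \<le> 2 * (cmod (f x))\<^sup>2 + 2 * (cmod (g x))\<^sup>2" for x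
  proof -
    have "(cmod (f x + g x))\<^sup>2 \<le> (cmod (f x) + cmod (g x))\<^sup>2"
      by (intro power_mono norm_triangle_ineq) auto
    also have "\<dots> \<le> 2 * (cmod (f x))\<^sup>2 + 2 * (cmod (g x))\<^sup>2"
      using sum_squares_bound[of "cmod (f x)" "cmod (g x)"] by (simp add: power2_sum)
    finally show ?thesis .
  qed
qed (use assms in \<open>auto simp: square_integrable_def\<close>)

lemma square_integrable_diff:
  assumes "square_integrable M f" "square_integrable M g"
  shows "square_integrable M (\<lambda>x. f x - g x)"
  using square_integrable_add[OF assms(1) square_integrable_cmult[OF assms(2), of "-1"]] by simp

lemma square_integrable_zero: "square_integrable M (\<lambda>x. 0)"
  by (simp add: square_integrable_def)

lemma square_integrable_cnj: "square_integrable M f \<Longrightarrow> square_integrable M (\<lambda>x. cnj (f x))"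
  unfolding square_integrable_def
  by (auto intro: borel_measurable_continuous_on[of cnj] continuous_intros)

lemma integrable_product:
  assumes "square_integrable M f" "square_integrable M g"
  shows "integrable M (\<lambda>x. f x * g x)"
proof (rule Bochner_Integration.integrable_bound)
  show "integrable M (\<lambda>x. (cmod (f x))\<^sup>2 + (cmod (g x))\<^sup>2)"
    using assms by (auto simp: square_integrable_def)
  show "(\<lambda>x. f x * g x) \<in> borel_measurable M"
    using assms by (auto simp: square_integrable_def)
  have "cmod (f x) * cmod (g x) \<le> (cmod (f x))\<^sup>2 + (cmod (g x))\<^sup>2" for x
    using sum_squares_bound[of "cmod (f x)" "cmod (g x)"]
      mult_nonneg_nonneg[OF norm_ge_zero norm_ge_zero, of "f x" "g x"] unfolding mult.assoc by linarith
  then show "AE x in M. norm (f x * g x) \<le> norm ((cmod (f x))\<^sup>2 + (cmod (g x))\<^sup>2)"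
    by (auto simp: norm_mult)
qed

lemma l2norm_nonneg: "0 \<le> l2norm M f"
  by (simp add: l2norm_def)

lemma l2norm_sq: "(l2norm M f)\<^sup>2 = (\<integral>x. (cmod (f x))\<^sup>2 \<partial>M)"
  by (simp add: l2norm_def)

lemma l2norm_cmult: "l2norm M (\<lambda>x. c * f x) = cmod c * l2norm M f"
  by (simp add: l2norm_def norm_mult power_mult_distrib real_sqrt_mult)

lemma l2norm_minus_commute: "l2norm M (\<lambda>x. f x - g x) = l2norm M (\<lambda>x. g x - f x)"
  by (simp add: l2norm_def norm_minus_commute)

lemma Cauchy_Schwarz_abs:
  assumes f: "square_integrable M f" and g: "square_integrable M g"
  shows "(\<integral>x. cmod (f x) * cmod (g x) \<partial>M) \<le> l2norm M f * l2norm M g"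
proof -
  define A where "A = (\<integral>x. (cmod (f x))\<^sup>2 \<partial>M)"
  define B where "B = (\<integral>x. (cmod (g x))\<^sup>2 \<partial>M)"
  define P where "P = (\<integral>x. cmod (f x) * cmod (g x) \<partial>M)"
  note [simp] = square_integrable_sq[OF f] square_integrable_sq[OF g]
  have [simp]: "integrable M (\<lambda>x. cmod (f x) * cmod (g x))"
    using integrable_norm[OF integrable_product[OF f g]] by (simp add: norm_mult)
  have nn: "0 \<le> A" "0 \<le> B" "0 \<le> P" by (simp_all add: A_def B_def P_def)
  \<comment> \<open>The usual discriminant argument; the values \<open>s = P\<close>, \<open>t = A\<close> below need \<open>A \<noteq> 0\<close>, and for \<open>A = 0\<close>
    a large \<open>s\<close> refutes \<open>P \<noteq> 0\<close>.\<close>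
  have q: "0 \<le> s\<^sup>2 * A - 2 * s * t * P + t\<^sup>2 * B" for s t
  proof -
    have "0 \<le> (\<integral>x. (s * cmod (f x) - t * cmod (g x))\<^sup>2 \<partial>M)" by simp
    also have "(\<lambda>x. (s * cmod (f x) - t * cmod (g x))\<^sup>2)
       = (\<lambda>x. s\<^sup>2 * (cmod (f x))\<^sup>2 - (2 * s * t) * (cmod (f x) * cmod (g x)) + t\<^sup>2 * (cmod (g x))\<^sup>2)"
      by (simp add: power2_eq_square algebra_simps)
    also have "(\<integral>x. s\<^sup>2 * (cmod (f x))\<^sup>2 - (2 * s * t) * (cmod (f x) * cmod (g x)) + t\<^sup>2 * (cmod (g x))\<^sup>2 \<partial>M)
       = s\<^sup>2 * A - (2 * s * t) * P + t\<^sup>2 * B"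
      unfolding A_def B_def P_def by simp
    finally show ?thesis .
  qed
  have "P\<^sup>2 \<le> A * B"
  proof (cases "A = 0")
    case True
    have "P = 0"
    proof (rule ccontr)
      assume "P \<noteq> 0"
      with q[of "(B + 1) / (2 * P)" 1] True show False by simp
    qed
    with True show ?thesis by simp
  next
    case False
    have "0 \<le> A * (A * B - P\<^sup>2)"
      using q[of P A] by (simp add: power2_eq_square algebra_simps)
    with False nn show ?thesis by (simp add: zero_le_mult_iff)
  qed
  then have "P \<le> sqrt (A * B)" by (simp add: real_le_rsqrt)
  then show ?thesis by (simp add: l2norm_def A_def B_def P_def real_sqrt_mult)
qed

lemma Cauchy_Schwarz_integral:
  assumes f: "square_integrable M f" and g: "square_integrable M g"
  shows "cmod (\<integral>x. f x * g x \<partial>M) \<le> l2norm M f * l2norm M g"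
  using integral_norm_bound[of M "\<lambda>x. f x * g x"] Cauchy_Schwarz_abs[OF f g] by (simp add: norm_mult)

lemma l2norm_triangle:
  assumes f: "square_integrable M f" and g: "square_integrable M g"
  shows "l2norm M (\<lambda>x. f x + g x) \<le> l2norm M f + l2norm M g"
proof (rule power2_le_imp_le)
  have [simp]: "integrable M (\<lambda>x. cmod (f x) * cmod (g x))"
    using integrable_norm[OF integrable_product[OF f g]] by (simp add: norm_mult)
  note [simp] = square_integrable_sq[OF f] square_integrable_sq[OF g]
  have "(l2norm M (\<lambda>x. f x + g x))\<^sup>2
     \<le> (\<integral>x. (cmod (f x))\<^sup>2 + 2 * (cmod (f x) * cmod (g x)) + (cmod (g x))\<^sup>2 \<partial>M)"
    unfolding l2norm_sq
  proof (rule integral_mono)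
    show "integrable M (\<lambda>x. (cmod (f x + g x))\<^sup>2)"
      using square_integrable_sq[OF square_integrable_add[OF f g]] .
    show "(cmod (f x + g x))\<^sup>2 \<le> (cmod (f x))\<^sup>2 + 2 * (cmod (f x) * cmod (g x)) + (cmod (g x))\<^sup>2" for x
      using power_mono[OF norm_triangle_ineq[of "f x" "g x"], of 2] by (simp add: power2_sum algebra_simps)
  qed auto
  also have "\<dots> = (l2norm M f)\<^sup>2 + 2 * (\<integral>x. cmod (f x) * cmod (g x) \<partial>M) + (l2norm M g)\<^sup>2"
    unfolding l2norm_sq by simp
  also have "\<dots> \<le> (l2norm M f + l2norm M g)\<^sup>2"
    using Cauchy_Schwarz_abs[OF f g] by (simp add: power2_sum)
  finally show "(l2norm M (\<lambda>x. f x + g x))\<^sup>2 \<le> (l2norm M f + l2norm M g)\<^sup>2" .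
qed (simp add: l2norm_nonneg)

lemma l2norm_triangle_diff:
  assumes "square_integrable M f" "square_integrable M g" "square_integrable M h"
  shows "l2norm M (\<lambda>x. f x - h x) \<le> l2norm M (\<lambda>x. f x - g x) + l2norm M (\<lambda>x. g x - h x)"
  using l2norm_triangle[OF square_integrable_diff[OF assms(1,2)] square_integrable_diff[OF assms(2,3)]]
  by simp

lemma l2norm_reverse_triangle:
  assumes "square_integrable M f" "square_integrable M g"
  shows "\<bar>l2norm M f - l2norm M g\<bar> \<le> l2norm M (\<lambda>x. f x - g x)"
  using l2norm_triangle_diff[OF assms square_integrable_zero]
    l2norm_triangle_diff[OF assms(2,1) square_integrable_zero] l2norm_minus_commute[of M f g]
  by simp

lemma l2norm_tendsto:
  assumes "\<And>k. square_integrable M (f k)" "square_integrable M g"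
    and "(\<lambda>k. l2norm M (\<lambda>x. f k x - g x)) \<longlonglongrightarrow> 0"
  shows "(\<lambda>k. l2norm M (f k)) \<longlonglongrightarrow> l2norm M g"
proof (rule metric_tendsto_imp_tendsto[OF assms(3)])
  show "\<forall>\<^sub>F k in sequentially. dist (l2norm M (f k)) (l2norm M g) \<le> dist (l2norm M (\<lambda>x. f k x - g x)) 0"
    using l2norm_reverse_triangle[OF assms(1,2)]
    by (auto simp: dist_real_def l2norm_nonneg)
qed

text \<open>
  The limits met below are known explicitly as pointwise limits; this lemma turns bounds on the norms
  along the sequence into a bound on the norm of the limit.
\<close>

lemma l2norm_Fatou:
  assumes f: "\<And>k. square_integrable M (f k)" and g: "g \<in> borel_measurable M"
    and lim: "\<And>x. x \<in> space M \<Longrightarrow> (\<lambda>k. f k x) \<longlonglongrightarrow> g x"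
    and B: "\<forall>\<^sub>F k in sequentially. l2norm M (f k) \<le> B"
  shows "square_integrable M g" "l2norm M g \<le> B"
proof -
  have "0 \<le> B" using B l2norm_nonneg[of M] order_trans eventually_sequentially
    by (metis (no_types, lifting) order_refl)
  have m[measurable]: "f k \<in> borel_measurable M" for k using f by (rule square_integrable_measurable)
  note [measurable] = g
  have nn: "(\<integral>\<^sup>+x. ennreal ((cmod (f k x))\<^sup>2) \<partial>M) = ennreal ((l2norm M (f k))\<^sup>2)" for k
    unfolding l2norm_sq by (rule nn_integral_eq_integral[OF square_integrable_sq[OF f]]) simp
  have "(\<integral>\<^sup>+x. ennreal ((cmod (g x))\<^sup>2) \<partial>M) = (\<integral>\<^sup>+x. liminf (\<lambda>k. ennreal ((cmod (f k x))\<^sup>2)) \<partial>M)"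
  proof (rule nn_integral_cong)
    fix x assume "x \<in> space M"
    then have "(\<lambda>k. ennreal ((cmod (f k x))\<^sup>2)) \<longlonglongrightarrow> ennreal ((cmod (g x))\<^sup>2)"
      by (intro tendsto_ennrealI tendsto_intros lim)
    from lim_imp_Liminf[OF _ this] show "ennreal ((cmod (g x))\<^sup>2) = liminf (\<lambda>k. ennreal ((cmod (f k x))\<^sup>2))"
      by simp
  qed
  also have "\<dots> \<le> liminf (\<lambda>k. \<integral>\<^sup>+x. ennreal ((cmod (f k x))\<^sup>2) \<partial>M)"
    by (rule nn_integral_liminf) measurable
  also have "\<dots> \<le> liminf (\<lambda>k. ennreal (B\<^sup>2))"
    unfolding nn using B by (intro Liminf_mono) (auto elim!: eventually_mono intro!: ennreal_leI power_mono l2norm_nonneg)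
  also have "\<dots> = ennreal (B\<^sup>2)" by (simp add: Liminf_const)
  finally have le: "(\<integral>\<^sup>+x. ennreal ((cmod (g x))\<^sup>2) \<partial>M) \<le> ennreal (B\<^sup>2)" .
  then have "integrable M (\<lambda>x. (cmod (g x))\<^sup>2)"
    by (intro integrableI_nonneg) (auto simp: le_less_trans ennreal_less_top)
  then show sq: "square_integrable M g" by (simp add: square_integrable_def g)
  have "ennreal ((l2norm M g)\<^sup>2) \<le> ennreal (B\<^sup>2)"
    using le nn_integral_eq_integral[OF square_integrable_sq[OF sq]] by (simp add: l2norm_sq)
  then have "(l2norm M g)\<^sup>2 \<le> B\<^sup>2" by (simp add: ennreal_le_iff)
  then show "l2norm M g \<le> B" using \<open>0 \<le> B\<close> by (rule power2_le_imp_le)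
qed

section \<open>The Gauss measure\<close>

lemma sets_gauss[measurable_cong, simp]: "sets (\<gamma> :: (real^'n::finite) measure) = sets borel"
  by (simp add: gauss_measure_def)

lemma space_gauss[simp]: "space (\<gamma> :: (real^'n::finite) measure) = UNIV"
  by (simp add: gauss_measure_def)

lemma sets_fock[measurable_cong, simp]: "sets (fock_measure :: (complex^'n::finite) measure) = sets borel"
  by (simp add: fock_measure_def)

lemma space_fock[simp]: "space (fock_measure :: (complex^'n::finite) measure) = UNIV"
  by (simp add: fock_measure_def)

definition gauss_density :: "real^'n::finite \<Rightarrow> real" where
  "gauss_density x = (2 * pi) powr (- real CARD('n) / 2) * exp (- (norm x)\<^sup>2 / 2)"

lemma gauss_density_pos: "0 < gauss_density x"
  by (simp add: gauss_density_def)

lemma borel_measurable_gauss_density[measurable]: "gauss_density \<in> borel_measurable borel"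
  unfolding gauss_density_def[abs_def] by measurable

lemma gauss_measure_density: "\<gamma> = density lborel (\<lambda>x. ennreal (gauss_density x))"
  by (simp add: gauss_measure_def gauss_density_def)

lemma gauss_density_prod:
  "gauss_density (x::real^'n::finite) = (\<Prod>i\<in>UNIV. (1 / sqrt (2 * pi)) * exp (- (x $ i)\<^sup>2 / 2))"
proof -
  have "(2 * pi) powr (- real CARD('n) / 2) = (1 / sqrt (2 * pi)) ^ CARD('n)"
  proof -
    have "(2 * pi) powr (- real CARD('n) / 2) = ((2 * pi) powr (- (1/2))) powr real CARD('n)"
      by (simp add: powr_powr)
    also have "\<dots> = ((2 * pi) powr (- (1/2))) ^ CARD('n)" by (simp add: powr_realpow)
    also have "(2 * pi) powr (- (1/2)) = 1 / sqrt (2 * pi)"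
      by (simp add: powr_minus_divide powr_half_sqrt)
    finally show ?thesis .
  qed
  moreover have "exp (- (norm x)\<^sup>2 / 2) = (\<Prod>i\<in>UNIV. exp (- (x $ i)\<^sup>2 / 2))"
    by (simp add: norm_vec_def L2_set_def sum_nonneg exp_sum[symmetric] sum_negf sum_divide_distrib[symmetric])
  ultimately show ?thesis
    unfolding gauss_density_def prod.distrib by simp
qed

lemma integrable_gauss_iff:
  fixes f :: "real^'n::finite \<Rightarrow> 'b::{banach, second_countable_topology}"
  assumes "f \<in> borel_measurable borel"
  shows "integrable \<gamma> f \<longleftrightarrow> integrable lborel (\<lambda>x. gauss_density x *\<^sub>R f x)"
  unfolding gauss_measure_density
  by (subst integrable_density) (use assms in \<open>auto simp: less_imp_le[OF gauss_density_pos]\<close>)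

lemma integral_gauss:
  fixes f :: "real^'n::finite \<Rightarrow> 'b::{banach, second_countable_topology}"
  assumes "f \<in> borel_measurable borel"
  shows "integral\<^sup>L \<gamma> f = (\<integral>x. gauss_density x *\<^sub>R f x \<partial>lborel)"
  unfolding gauss_measure_density
  by (subst integral_density) (use assms in \<open>auto simp: less_imp_le[OF gauss_density_pos]\<close>)

text \<open>
  The moment generating function of \<open>\<gamma>\<close> at a complex vector; it yields both the total mass of \<open>\<gamma>\<close>
  and the norm of the Bargmann kernel.
\<close>

lemma gauss_exp:
  fixes w :: "complex^'n::finite"
  shows "has_bochner_integral \<gamma> (\<lambda>x. exp (\<Sum>j\<in>UNIV. of_real (x $ j) * w $ j))
           (exp ((\<Sum>j\<in>UNIV. (w $ j)\<^sup>2) / 2))"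
proof -
  define f where "f = (\<lambda>i t. of_real (1 / sqrt (2 * pi)) * exp (w $ i * of_real t - of_real ((1/2) * t\<^sup>2)))"
  have f: "has_bochner_integral lborel (f i) (exp ((w $ i)\<^sup>2 / 2))" for i
    using has_bochner_integral_mult_right[OF gaussian_integral[of "1/2" "w $ i"], of "of_real (1 / sqrt (2 * pi))"]
    by (simp add: f_def mult.commute)
  have fi: "integrable lborel (f i)" and fv: "integral\<^sup>L lborel (f i) = exp ((w $ i)\<^sup>2 / 2)" for i
    using f by (auto simp: has_bochner_integral_iff)
  have eq: "gauss_density x *\<^sub>R exp (\<Sum>j\<in>UNIV. of_real (x $ j) * w $ j) = (\<Prod>i\<in>UNIV. f i (x $ i))" for x :: "real^'n"
  proof -
    have "f i (x $ i) = of_real ((1 / sqrt (2 * pi)) * exp (- (x $ i)\<^sup>2 / 2)) * exp (of_real (x $ i) * w $ i)" for i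
    proof -
      have "exp (w $ i * of_real (x $ i) - of_real ((1/2) * (x $ i)\<^sup>2))
        = exp (of_real (- (x $ i)\<^sup>2 / 2)) * exp (of_real (x $ i) * w $ i)"
        by (simp add: exp_add[symmetric] algebra_simps)
      then show ?thesis unfolding f_def exp_of_real by simp
    qed
    then show ?thesis
      unfolding gauss_density_prod
      by (simp add: scaleR_conv_of_real exp_sum prod.distrib[symmetric])
  qed
  show ?thesis
    unfolding has_bochner_integral_iff
    by (subst integrable_gauss_iff integral_gauss, measurable)+
      (simp add: eq integral_prod_real_vec[OF fi] fv exp_sum[symmetric] sum_divide_distrib)
qed

lemma prob_space_gauss: "prob_space (\<gamma> :: (real^'n::finite) measure)"
proof -
  have "has_bochner_integral (\<gamma> :: (real^'n::finite) measure) (\<lambda>x. 1::complex) 1"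
    using gauss_exp[of 0] by simp
  then have *: "integrable (\<gamma> :: (real^'n::finite) measure) (\<lambda>x. 1::complex)"
      "(\<integral>x. (1::complex) \<partial>(\<gamma> :: (real^'n::finite) measure)) = 1"
    by (auto simp: has_bochner_integral_iff)
  have "emeasure (\<gamma> :: (real^'n::finite) measure) UNIV < \<infinity>"
    using *(1) by (simp add: integrable_iff_bounded)
  moreover have "measure (\<gamma> :: (real^'n::finite) measure) UNIV = 1"
    using *(2) by (simp add: scaleR_conv_of_real)
  ultimately have "emeasure (\<gamma> :: (real^'n::finite) measure) UNIV = 1"
    by (simp add: emeasure_eq_ennreal_measure)
  then show ?thesis by (intro prob_spaceI) simp
qed

interpretation gauss: prob_space "\<gamma> :: (real^'n::finite) measure"
  by (rule prob_space_gauss)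

lemma integrable_gauss_exp_norm: "integrable (\<gamma> :: (real^'n::finite) measure) (\<lambda>x. exp (c * norm x))"
proof (subst integrable_gauss_iff)
  have "integrable lborel (\<lambda>x::real^'n. (2 * pi) powr (- real CARD('n) / 2) * exp (c * norm x - (1/2) * (norm x)\<^sup>2))"
    by (intro integrable_mult_right integrable_exp_norm_gaussian) simp
  moreover have "(2 * pi) powr (- real CARD('n) / 2) * exp (c * norm x - (1/2) * (norm x)\<^sup>2)
      = gauss_density x *\<^sub>R exp (c * norm x)" for x :: "real^'n"
  proof -
    have "exp (c * norm x - (1/2) * (norm x)\<^sup>2) = exp (- (norm x)\<^sup>2 / 2) * exp (c * norm x)"
      by (simp add: exp_add[symmetric])
    then show ?thesis by (simp only: gauss_density_def real_scaleR_def mult.assoc)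
  qed
  ultimately show "integrable lborel (\<lambda>x::real^'n. gauss_density x *\<^sub>R exp (c * norm x))"
    by (simp only:)
qed simp

section \<open>The Bargmann integral is entire\<close>

definition cdot :: "real^'n::finite \<Rightarrow> complex^'n \<Rightarrow> complex" where
  "cdot x z = (\<Sum>j\<in>UNIV. of_real (x $ j) * z $ j)"

definition csq :: "complex^'n::finite \<Rightarrow> complex" where
  "csq z = (\<Sum>j\<in>UNIV. (z $ j)\<^sup>2)"

definition bargmann_kernel :: "real^'n::finite \<Rightarrow> complex^'n \<Rightarrow> complex" where
  "bargmann_kernel x z = exp (cdot x z - csq z / 2)"

definition bargmann :: "(real^'n::finite \<Rightarrow> complex) \<Rightarrow> complex^'n \<Rightarrow> complex" where
  "bargmann f z = (\<integral>x. f x * bargmann_kernel x z \<partial>\<gamma>)"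

text \<open>
  Growth \<open>O(exp (c |x|))\<close> is stable under products and satisfied by polynomials and by the kernel,
  while \<open>\<gamma>\<close> integrates all such functions.
\<close>

definition exp_bounded :: "(real^'n::finite \<Rightarrow> complex) \<Rightarrow> bool" where
  "exp_bounded u \<longleftrightarrow> (\<exists>C\<ge>0. \<exists>c\<ge>0. \<forall>x. cmod (u x) \<le> C * exp (c * norm x))"

lemma sum_norm_mult_le: "(\<Sum>j\<in>UNIV. norm (x $ j) * norm (y $ j)) \<le> norm x * norm y"
  for x :: "'a::real_normed_vector^'n" and y :: "'b::real_normed_vector^'n"
  using L2_set_mult_ineq[of "\<lambda>j. norm (x $ j)" "\<lambda>j. norm (y $ j)" UNIV] by (simp add: norm_vec_def)

lemma sum_norm_sq: "(\<Sum>j\<in>UNIV. (norm (x $ j))\<^sup>2) = (norm x)\<^sup>2"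
  for x :: "'a::real_normed_vector^'n"
  by (simp add: norm_vec_def L2_set_def sum_nonneg)

lemma norm_cdot_le: "cmod (cdot x z) \<le> norm x * norm z"
proof -
  have "cmod (cdot x z) \<le> (\<Sum>j\<in>UNIV. norm (x $ j) * norm (z $ j))"
    unfolding cdot_def by (rule order_trans[OF norm_sum]) (simp add: norm_mult)
  with sum_norm_mult_le[of x z] show ?thesis by simp
qed

lemma norm_csq_le: "cmod (csq z) \<le> (norm z)\<^sup>2"
  unfolding csq_def sum_norm_sq[symmetric] by (rule order_trans[OF norm_sum]) (simp add: norm_power)

lemma norm_kernel_le: "cmod (bargmann_kernel x z) \<le> exp ((norm z)\<^sup>2 / 2) * exp (norm z * norm x)"
proof -
  have "Re (cdot x z - csq z / 2) \<le> cmod (cdot x z) + cmod (csq z) / 2"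
    using complex_Re_le_cmod[of "cdot x z - csq z / 2"] norm_triangle_ineq4[of "cdot x z" "csq z / 2"]
    by (simp add: norm_divide)
  also have "\<dots> \<le> (norm z)\<^sup>2 / 2 + norm z * norm x"
    using norm_cdot_le[of x z] norm_csq_le[of z] by (simp add: mult.commute)
  finally show ?thesis
    by (simp add: bargmann_kernel_def norm_exp_eq_Re exp_add[symmetric])
qed

lemma continuous_kernel[continuous_intros]:
  assumes "continuous_on A f" "continuous_on A g"
  shows "continuous_on A (\<lambda>t. bargmann_kernel (f t) (g t))"
  unfolding bargmann_kernel_def cdot_def csq_def by (intro continuous_intros assms) simp

lemma kernel_measurable[measurable (raw)]:
  assumes "f \<in> borel_measurable M" "g \<in> borel_measurable M"
  shows "(\<lambda>x. bargmann_kernel (f x) (g x)) \<in> borel_measurable M"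
  using assms by (rule borel_measurable_continuous_Pair) (intro continuous_intros)

lemma cnj_measurable[measurable (raw)]:
  "f \<in> borel_measurable M \<Longrightarrow> (\<lambda>x. cnj (f x)) \<in> borel_measurable M"
  by (rule borel_measurable_continuous_on[of cnj]) (auto intro: continuous_intros)

lemma exp_boundedI:
  assumes "\<And>x. cmod (u x) \<le> C * exp (c * norm x)"
  shows "exp_bounded u"
  unfolding exp_bounded_def
proof (rule exI[of _ "\<bar>C\<bar>"], rule conjI, simp, rule exI[of _ "\<bar>c\<bar>"], rule conjI, simp, rule allI)
  show "cmod (u x) \<le> \<bar>C\<bar> * exp (\<bar>c\<bar> * norm x)" for x
    by (rule order_trans[OF assms]) (intro mult_mono, auto intro!: mult_right_mono)
qed

lemma exp_bounded_mult:
  assumes "exp_bounded u" "exp_bounded v"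
  shows "exp_bounded (\<lambda>x. u x * v x)"
proof -
  obtain C c D d where C: "C \<ge> 0" "\<And>x. cmod (u x) \<le> C * exp (c * norm x)"
    and D: "D \<ge> 0" "\<And>x. cmod (v x) \<le> D * exp (d * norm x)"
    using assms unfolding exp_bounded_def by blast
  have "cmod (u x * v x) \<le> (C * exp (c * norm x)) * (D * exp (d * norm x))" for x
    unfolding norm_mult by (intro mult_mono C D mult_nonneg_nonneg) auto
  then have "cmod (u x * v x) \<le> (C * D) * exp ((c + d) * norm x)" for x
    by (simp add: exp_add algebra_simps)
  then show ?thesis by (rule exp_boundedI)
qed

lemma exp_bounded_add:
  assumes "exp_bounded u" "exp_bounded v"
  shows "exp_bounded (\<lambda>x. u x + v x)"
proof -
  obtain C c D d where C: "C \<ge> 0" "c \<ge> 0" "\<And>x. cmod (u x) \<le> C * exp (c * norm x)"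
    and D: "D \<ge> 0" "d \<ge> 0" "\<And>x. cmod (v x) \<le> D * exp (d * norm x)"
    using assms unfolding exp_bounded_def by blast
  have "cmod (u x + v x) \<le> (C + D) * exp ((c + d) * norm x)" for x
  proof -
    have "cmod (u x) \<le> C * exp ((c + d) * norm x)"
      by (rule order_trans[OF C(3)]) (use C D in \<open>auto intro!: mult_left_mono mult_right_mono\<close>)
    moreover have "cmod (v x) \<le> D * exp ((c + d) * norm x)"
      by (rule order_trans[OF D(3)]) (use C D in \<open>auto intro!: mult_left_mono mult_right_mono\<close>)
    ultimately show ?thesis
      using norm_triangle_ineq[of "u x" "v x"] by (simp add: distrib_right)
  qed
  then show ?thesis by (rule exp_boundedI)
qed

lemma exp_bounded_const: "exp_bounded (\<lambda>x. c)"
  by (rule exp_boundedI[of _ "cmod c" 0]) simp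

lemma exp_bounded_coord: "exp_bounded (\<lambda>x. of_real (x $ j))"
proof (rule exp_boundedI[of _ 1 1])
  fix x :: "real^'a"
  have "\<bar>x $ j\<bar> \<le> norm x" using component_le_norm_cart .
  also have "\<dots> \<le> exp (norm x)" using exp_ge_add_one_self[of "norm x"] by linarith
  finally show "cmod (of_real (x $ j)) \<le> 1 * exp (1 * norm x)" by simp
qed

lemma exp_bounded_kernel: "exp_bounded (\<lambda>x. bargmann_kernel x z)"
  by (rule exp_boundedI[OF norm_kernel_le])

lemma exp_bounded_cmult: "exp_bounded u \<Longrightarrow> exp_bounded (\<lambda>x. c * u x)"
  by (intro exp_bounded_mult exp_bounded_const)

lemma exp_bounded_diff: "exp_bounded u \<Longrightarrow> exp_bounded v \<Longrightarrow> exp_bounded (\<lambda>x. u x - v x)"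
  using exp_bounded_add[OF _ exp_bounded_cmult[of v "-1"], of u] by simp

lemma exp_bounded_square_integrable:
  assumes u: "exp_bounded u" and [measurable]: "u \<in> borel_measurable borel"
  shows "square_integrable \<gamma> u"
proof -
  obtain C c where C: "C \<ge> 0" "\<And>x. cmod (u x) \<le> C * exp (c * norm x)"
    using assms unfolding exp_bounded_def by blast
  show ?thesis
  proof (rule square_integrable_bound)
    show "integrable \<gamma> (\<lambda>x::real^'a. C\<^sup>2 * exp ((2 * c) * norm x))"
      by (intro integrable_mult_right integrable_gauss_exp_norm)
    show "(cmod (u x))\<^sup>2 \<le> C\<^sup>2 * exp ((2 * c) * norm x)" for x
      using power_mono[OF C(2) norm_ge_zero, of x 2]
      by (simp add: power_mult_distrib exp_double[symmetric] mult.assoc)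
  qed simp
qed

lemma square_integrable_kernel: "square_integrable \<gamma> (\<lambda>x. bargmann_kernel x z)"
  by (rule exp_bounded_square_integrable[OF exp_bounded_kernel]) measurable

lemma integrable_bargmann:
  assumes "square_integrable \<gamma> f"
  shows "integrable \<gamma> (\<lambda>x. f x * bargmann_kernel x z)"
  by (rule integrable_product[OF assms square_integrable_kernel])

lemma bargmann_linear:
  assumes "square_integrable \<gamma> f" "square_integrable \<gamma> g"
  shows "bargmann (\<lambda>x. a * f x + b * g x) z = a * bargmann f z + b * bargmann g z"
proof -
  have "bargmann (\<lambda>x. a * f x + b * g x) z
     = (\<integral>x. a * (f x * bargmann_kernel x z) + b * (g x * bargmann_kernel x z) \<partial>\<gamma>)"
    unfolding bargmann_def by (simp add: algebra_simps)
  then show ?thesis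
    using integrable_bargmann[OF assms(1)] integrable_bargmann[OF assms(2)] by (simp add: bargmann_def)
qed

lemma bargmann_diff:
  assumes "square_integrable \<gamma> f" "square_integrable \<gamma> g"
  shows "bargmann (\<lambda>x. f x - g x) z = bargmann f z - bargmann g z"
  using bargmann_linear[OF assms, of 1 "-1"] by simp

lemma norm_bargmann_le:
  assumes "square_integrable \<gamma> f"
  shows "cmod (bargmann f z) \<le> l2norm \<gamma> f * l2norm \<gamma> (\<lambda>x. bargmann_kernel x z)"
  unfolding bargmann_def by (rule Cauchy_Schwarz_integral[OF assms square_integrable_kernel])

text \<open>
  The integral of \<open>f\<close> against \<open>\<partial>E/\<partial>z\<^sub>j\<close>; it turns out to be the partial derivative of \<open>bargmann f\<close>.
\<close>

definition bargmann_partial :: "(real^'n::finite \<Rightarrow> complex) \<Rightarrow> 'n \<Rightarrow> complex^'n \<Rightarrow> complex" where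
  "bargmann_partial f j z = (\<integral>x. f x * ((of_real (x $ j) - z $ j) * bargmann_kernel x z) \<partial>\<gamma>)"

lemma integrable_bargmann_partial:
  assumes "square_integrable \<gamma> f"
  shows "integrable \<gamma> (\<lambda>x. f x * ((of_real (x $ j) - z $ j) * bargmann_kernel x z))"
  by (intro integrable_product[OF assms] exp_bounded_square_integrable exp_bounded_mult
      exp_bounded_diff exp_bounded_const exp_bounded_coord exp_bounded_kernel) measurable

lemma bounded_linear_vec_functional:
  "bounded_linear (\<lambda>v::complex^'n. \<Sum>j\<in>UNIV. v $ j * d j)"
  by (intro bounded_linear_sum bounded_linear_compose[OF bounded_linear_mult_left bounded_linear_vec_nth])

text \<open>
  The increment \<open>h\<close> multiplies the kernel by \<open>exp Q\<close>, where \<open>Q\<close> has linear part \<open>(x - z) \<cdot> h\<close>; the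
  remainder of the exponential series at order two is quadratic in \<open>h\<close> with an exponentially
  bounded constant, which a square-integrable \<open>f\<close> integrates.
\<close>

lemma kernel_remainder:
  assumes h: "norm h \<le> 1"
  shows "cmod (bargmann_kernel x (z + h) - bargmann_kernel x z
       - (\<Sum>j\<in>UNIV. h $ j * ((of_real (x $ j) - z $ j) * bargmann_kernel x z)))
     \<le> cmod (bargmann_kernel x z) * (3 * exp (2 * (norm x + norm z + 1))) * (norm h)\<^sup>2"
proof -
  define L where "L = (\<Sum>j\<in>UNIV. h $ j * (of_real (x $ j) - z $ j))"
  define Q where "Q = L - csq h / 2"
  \<comment> \<open>For \<open>|h| \<le> 1\<close> both \<open>|Q| \<le> a |h|\<close> and \<open>|Q| \<le> a\<close> hold.\<close>
  define a where "a = norm x + norm z + 1"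
  have a0: "0 \<le> a" by (simp add: a_def)
  have "cdot x (z + h) - csq (z + h) / 2 = (cdot x z - csq z / 2) + Q"
    unfolding Q_def L_def cdot_def csq_def
    by (simp add: sum.distrib sum_subtractf sum_distrib_left sum_distrib_right sum_divide_distrib
        power2_sum algebra_simps add_divide_distrib)
  then have k: "bargmann_kernel x (z + h) = bargmann_kernel x z * exp Q"
    by (simp add: bargmann_kernel_def exp_add)
  have "cmod L \<le> (\<Sum>j\<in>UNIV. norm (h $ j) * norm (x $ j)) + (\<Sum>j\<in>UNIV. norm (h $ j) * norm (z $ j))"
    unfolding L_def sum.distrib[symmetric]
  proof (rule order_trans[OF norm_sum sum_mono])
    fix j
    show "cmod (h $ j * (of_real (x $ j) - z $ j)) \<le> norm (h $ j) * norm (x $ j) + norm (h $ j) * norm (z $ j)"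
      unfolding norm_mult distrib_left[symmetric]
      by (rule mult_left_mono[OF order_trans[OF norm_triangle_ineq4]]) auto
  qed
  also have "\<dots> \<le> norm h * norm x + norm h * norm z"
    by (intro add_mono sum_norm_mult_le)
  finally have L: "cmod L \<le> (norm x + norm z) * norm h" by (simp add: algebra_simps)
  have h2: "(norm h)\<^sup>2 \<le> norm h" using h by (simp add: power2_eq_square mult_left_le)
  have cs: "cmod (csq h / 2) \<le> (norm h)\<^sup>2 / 2" using norm_csq_le[of h] by (simp add: norm_divide)
  have "cmod Q \<le> cmod L + cmod (csq h / 2)"
    unfolding Q_def by (rule norm_triangle_ineq4)
  also have "\<dots> \<le> (norm x + norm z) * norm h + norm h / 2"
    using L cs h2 by linarith
  also have "\<dots> \<le> a * norm h" by (simp add: a_def algebra_simps)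
  finally have Q: "cmod Q \<le> a * norm h" .
  also have "\<dots> \<le> a" using h a0 by (simp add: mult_left_le)
  finally have Qa: "cmod Q \<le> a" .
  have "cmod (exp Q - (\<Sum>k\<le>1. Q ^ k / fact k)) \<le> exp \<bar>Re Q\<bar> * cmod Q ^ (Suc 1) / fact 1"
    by (rule Taylor_exp)
  also have "\<dots> \<le> exp a * (a * norm h)\<^sup>2"
    using Qa Q abs_Re_le_cmod[of Q] by (auto intro!: mult_mono power_mono simp: numeral_2_eq_2[symmetric])
  finally have T: "cmod (exp Q - 1 - Q) \<le> exp a * a\<^sup>2 * (norm h)\<^sup>2"
    by (simp add: power_mult_distrib algebra_simps)
  have "exp Q - 1 - L = (exp Q - 1 - Q) - csq h / 2" by (simp add: Q_def)
  then have "cmod (exp Q - 1 - L) \<le> cmod (exp Q - 1 - Q) + cmod (csq h / 2)"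
    using norm_triangle_ineq4[of "exp Q - 1 - Q" "csq h / 2"] by (simp only:)
  also have "\<dots> \<le> (exp a * a\<^sup>2 + 1) * (norm h)\<^sup>2"
    using T cs zero_le_power2[of "norm h"] unfolding distrib_right by linarith
  also have "\<dots> \<le> (3 * exp (2 * a)) * (norm h)\<^sup>2"
  proof (rule mult_right_mono)
    have "a\<^sup>2 / 2 \<le> exp a" using exp_lower_Taylor_quadratic[OF a0] a0 by simp
    then have "exp a * a\<^sup>2 \<le> exp a * (2 * exp a)" by (intro mult_left_mono) auto
    also have "\<dots> = 2 * exp (2 * a)" by (simp add: exp_double power2_eq_square)
    finally show "exp a * a\<^sup>2 + 1 \<le> 3 * exp (2 * a)"
      using one_le_exp_iff[of "2 * a"] a0 by linarith
  qed simp
  finally have R: "cmod (exp Q - 1 - L) \<le> (3 * exp (2 * a)) * (norm h)\<^sup>2" .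
  have "bargmann_kernel x (z + h) - bargmann_kernel x z
       - (\<Sum>j\<in>UNIV. h $ j * ((of_real (x $ j) - z $ j) * bargmann_kernel x z))
     = bargmann_kernel x z * (exp Q - 1 - L)"
    unfolding k L_def by (simp add: sum_distrib_left algebra_simps)
  then show ?thesis
    using mult_left_mono[OF R norm_ge_zero[of "bargmann_kernel x z"]]
    by (simp add: norm_mult a_def mult.assoc)
qed

lemma bargmann_has_derivative:
  assumes f: "square_integrable \<gamma> f"
  shows "(bargmann f has_derivative (\<lambda>v. \<Sum>j\<in>UNIV. v $ j * bargmann_partial f j z)) (at z)"
proof -
  define D where "D = (\<lambda>v::complex^'a. \<Sum>j\<in>UNIV. v $ j * bargmann_partial f j z)"
  define R where "R = (\<lambda>x. cmod (bargmann_kernel x z) * (3 * exp (2 * (norm x + norm z + 1))))"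
  define K where "K = (\<integral>x. cmod (f x) * R x \<partial>\<gamma>)"
  have sqR: "square_integrable \<gamma> (\<lambda>x. of_real (R x))"
  proof (rule exp_bounded_square_integrable)
    have "exp_bounded (\<lambda>x::real^'a. of_real (3 * exp (2 * (norm x + norm z + 1))))"
      by (rule exp_boundedI[of _ "3 * exp (2 * (norm z + 1))" 2]) (simp add: exp_add[symmetric] algebra_simps)
    moreover have "exp_bounded (\<lambda>x::real^'a. of_real (cmod (bargmann_kernel x z)))"
      by (rule exp_boundedI[of _ "exp ((norm z)\<^sup>2 / 2)" "norm z"]) (simp add: norm_kernel_le)
    ultimately show "exp_bounded (\<lambda>x. of_real (R x))"
      unfolding R_def of_real_mult[of "cmod _"] by (rule exp_bounded_mult[rotated])
  qed (simp add: R_def)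
  have KI: "integrable \<gamma> (\<lambda>x. cmod (f x) * R x)"
  proof -
    have "integrable \<gamma> (\<lambda>x. cmod (f x * of_real (R x)))"
      by (intro integrable_norm integrable_product[OF f sqR])
    moreover have "R x \<ge> 0" for x by (simp add: R_def)
    ultimately show ?thesis by (simp add: norm_mult)
  qed
  have bnd: "cmod (bargmann f (z + h) - bargmann f z - D h) \<le> K * (norm h)\<^sup>2" if h: "norm h \<le> 1" for h
  proof -
    let ?r = "\<lambda>x. bargmann_kernel x (z + h) - bargmann_kernel x z
       - (\<Sum>j\<in>UNIV. h $ j * ((of_real (x $ j) - z $ j) * bargmann_kernel x z))"
    note [simp] = integrable_bargmann[OF f] integrable_bargmann_partial[OF f]
    have e: "f x * ?r x = f x * bargmann_kernel x (z + h) - f x * bargmann_kernel x z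
         - (\<Sum>j\<in>UNIV. h $ j * (f x * ((of_real (x $ j) - z $ j) * bargmann_kernel x z)))" for x
      by (simp add: sum_distrib_left algebra_simps)
    have I: "integrable \<gamma> (\<lambda>x. f x * ?r x)"
      unfolding e by simp
    have "bargmann f (z + h) - bargmann f z - D h = (\<integral>x. f x * ?r x \<partial>\<gamma>)"
      unfolding e D_def bargmann_def bargmann_partial_def by simp
    also have "cmod \<dots> \<le> (\<integral>x. cmod (f x * ?r x) \<partial>\<gamma>)"
      by (rule integral_norm_bound)
    also have "\<dots> \<le> (\<integral>x. (cmod (f x) * R x) * (norm h)\<^sup>2 \<partial>\<gamma>)"
    proof (rule integral_mono[OF integrable_norm[OF I]])
      show "integrable \<gamma> (\<lambda>x. (cmod (f x) * R x) * (norm h)\<^sup>2)" using KI by simp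
      show "cmod (f x * ?r x) \<le> (cmod (f x) * R x) * (norm h)\<^sup>2" for x
        unfolding norm_mult mult.assoc
        by (rule mult_left_mono[OF _ norm_ge_zero])
          (use kernel_remainder[OF h, of x z] in \<open>simp add: R_def mult.assoc\<close>)
    qed
    also have "\<dots> = K * (norm h)\<^sup>2" by (simp add: K_def)
    finally show ?thesis .
  qed
  have "(\<lambda>h. norm (bargmann f (z + h) - bargmann f z - D h) / norm h) \<midarrow>0\<rightarrow> 0"
  proof (rule Lim_null_comparison)
    show "\<forall>\<^sub>F h in at 0. norm (norm (bargmann f (z + h) - bargmann f z - D h) / norm h) \<le> K * norm h"
      unfolding eventually_at
    proof (intro exI[of _ 1] conjI ballI impI)
      fix h :: "complex^'a" assume "h \<noteq> 0 \<and> dist h 0 < 1"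
      then show "norm (norm (bargmann f (z + h) - bargmann f z - D h) / norm h) \<le> K * norm h"
        using bnd[of h] by (simp add: divide_le_eq power2_eq_square mult.assoc)
    qed simp
    show "(\<lambda>h. K * norm h) \<midarrow>0\<rightarrow> 0" by (intro tendsto_eq_intros | simp)+
  qed
  then show ?thesis
    unfolding D_def[symmetric] has_derivative_at
    by (simp add: bounded_linear_vec_functional D_def)
qed

lemma entire_bargmann:
  assumes f: "square_integrable \<gamma> f"
  shows "entire (bargmann f)"
  unfolding entire_def
proof
  fix z
  show "\<exists>D. (bargmann f has_derivative D) (at z) \<and> (\<forall>c v. D (c *s v) = c * D v)"
    by (rule exI[of _ "\<lambda>v. \<Sum>j\<in>UNIV. v $ j * bargmann_partial f j z"])
      (simp add: bargmann_has_derivative[OF f] sum_distrib_left mult.assoc)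
qed

lemma axis_scale: "axis j w = w *s axis j (1::'a::semiring_1)"
  by (simp add: vec_eq_iff axis_def)

text \<open>
  Complex homogeneity of the real derivative \<open>D\<close> makes the restriction to a complex coordinate line
  holomorphic.
\<close>

lemma has_derivative_line:
  fixes F :: "complex^'n::finite \<Rightarrow> complex"
  assumes D: "(F has_derivative D) (at (z + axis j w))" and lin: "\<And>c v. D (c *s v) = c * D v"
  shows "((\<lambda>w. F (z + axis j w)) has_field_derivative D (axis j 1)) (at w)"
proof -
  have ax: "bounded_linear (\<lambda>w::complex. axis j w :: complex^'n)"
    unfolding linear_conv_bounded_linear[symmetric]
    by (rule linearI) (auto simp: vec_eq_iff axis_def)
  have "((\<lambda>w. F (z + axis j w)) has_derivative (\<lambda>h. D (axis j h))) (at w)"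
  proof (rule has_derivative_compose[where g = F and g' = D])
    show "((\<lambda>w. z + axis j w) has_derivative (\<lambda>h. axis j h)) (at w)"
      using has_derivative_add[OF has_derivative_const bounded_linear_imp_has_derivative[OF ax]] by simp
  qed (rule D)
  moreover have "(\<lambda>h. D (axis j h)) = (*) (D (axis j 1))"
    by (subst axis_scale) (auto simp: lin mult.commute)
  ultimately show ?thesis by (simp add: has_field_derivative_def)
qed

lemma cpartial_bargmann:
  assumes f: "square_integrable \<gamma> f"
  shows "cpartial j (bargmann f) z = bargmann_partial f j z"
proof -
  have "((\<lambda>w. bargmann f (z + axis j w)) has_field_derivative
      (\<Sum>i\<in>UNIV. axis j (1::complex) $ i * bargmann_partial f i z)) (at 0)"
    by (rule has_derivative_line) (use bargmann_has_derivative[OF f, of z] in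
        \<open>auto simp: sum_distrib_left mult.assoc axis_eq_0_iff[THEN iffD2]\<close>)
  also have "(\<Sum>i\<in>UNIV. axis j (1::complex) $ i * bargmann_partial f i z) = bargmann_partial f j z"
    by (simp add: axis_def if_distrib[of "\<lambda>u. u * _"] cong: if_cong)
  finally show ?thesis
    unfolding cpartial_def by (rule DERIV_imp_deriv)
qed

section \<open>Gaussian integration by parts\<close>

lemma has_vector_derivative_quotient:
  fixes f :: "real \<Rightarrow> 'a::real_normed_vector"
  assumes "(f has_vector_derivative D) (at 0)"
  shows "((\<lambda>h. (f h - f 0) /\<^sub>R h) \<longlongrightarrow> D) (at 0)"
proof -
  have 1: "((\<lambda>h. norm (f (0 + h) - f 0 - h *\<^sub>R D) / norm h) \<longlongrightarrow> 0) (at 0)"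
    using assms unfolding has_vector_derivative_def has_derivative_at by blast
  have 2: "norm (f (0 + h) - f 0 - h *\<^sub>R D) / norm h = norm ((f h - f 0) /\<^sub>R h - D)" if "h \<noteq> 0" for h
  proof -
    have "(f h - f 0) /\<^sub>R h - D = (f (0 + h) - f 0 - h *\<^sub>R D) /\<^sub>R h"
      using that by (simp add: scaleR_right_diff_distrib)
    then show ?thesis by (simp add: divide_inverse_commute)
  qed
  have "((\<lambda>h. norm ((f h - f 0) /\<^sub>R h - D)) \<longlongrightarrow> 0) (at 0)"
    by (rule Lim_transform_eventually[OF 1]) (use 2 in \<open>auto simp: eventually_at_filter\<close>)
  then show ?thesis by (simp add: tendsto_norm_zero_iff Lim_null[symmetric])
qed

text \<open>
  The integral of \<open>v\<close> is translation invariant, so difference quotients integrate to \<open>0\<close>; the mean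
  value theorem and dominated convergence pass to the derivative.
\<close>

lemma integral_directional_derivative_eq_0:
  fixes v v' :: "'a::euclidean_space \<Rightarrow> complex"
  assumes v: "integrable lborel v"
    and d: "\<And>x t. ((\<lambda>t. v (x + t *\<^sub>R e)) has_vector_derivative v' (x + t *\<^sub>R e)) (at t)"
    and [measurable]: "v' \<in> borel_measurable borel"
    and W: "integrable lborel W" "\<And>x t. 0 \<le> t \<Longrightarrow> t \<le> 1 \<Longrightarrow> cmod (v' (x + t *\<^sub>R e)) \<le> W x"
  shows "(\<integral>x. v' x \<partial>lborel) = 0"
proof -
  define h where "h = (\<lambda>k::nat. 1 / real (Suc k))"
  define q where "q = (\<lambda>k x. (v (x + h k *\<^sub>R e) - v x) /\<^sub>R h k)"
  have [measurable]: "v \<in> borel_measurable borel" using v by (auto dest: borel_measurable_integrable)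
  have h: "0 < h k" "h k \<le> 1" for k by (simp_all add: h_def)
  have "(\<lambda>k. \<integral>x. q k x \<partial>lborel) \<longlonglongrightarrow> (\<integral>x. v' x \<partial>lborel)"
  proof (rule integral_dominated_convergence[OF _ _ W(1)])
    show "v' \<in> borel_measurable lborel" "\<And>k. q k \<in> borel_measurable lborel"
      unfolding q_def by measurable
    show "AE x in lborel. (\<lambda>k. q k x) \<longlonglongrightarrow> v' x"
    proof (rule AE_I2)
      fix x
      have "((\<lambda>t. (v (x + t *\<^sub>R e) - v x) /\<^sub>R t) \<longlongrightarrow> v' x) (at 0)"
        using has_vector_derivative_quotient[of "\<lambda>t. v (x + t *\<^sub>R e)" "v' x"] d[of x 0] by simp
      moreover have "filterlim h (at 0) sequentially"
        unfolding filterlim_at using h LIMSEQ_inverse_real_of_nat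
        by (auto simp: h_def inverse_eq_divide)
      ultimately show "(\<lambda>k. q k x) \<longlonglongrightarrow> v' x"
        unfolding q_def by (rule filterlim_compose)
    qed
    show "AE x in lborel. norm (q k x) \<le> W x" for k
    proof (rule AE_I2)
      fix x
      have "\<exists>t\<in>{0<..<h k}. norm (v (x + h k *\<^sub>R e) - v (x + 0 *\<^sub>R e)) \<le> norm ((h k - 0) *\<^sub>R v' (x + t *\<^sub>R e))"
      proof (rule mvt_general[where f = "\<lambda>t. v (x + t *\<^sub>R e)"])
        show "continuous_on {0..h k} (\<lambda>t. v (x + t *\<^sub>R e))"
          using d by (intro continuous_at_imp_continuous_on ballI) (rule has_vector_derivative_continuous)
        show "((\<lambda>t. v (x + t *\<^sub>R e)) has_derivative (\<lambda>s. s *\<^sub>R v' (x + t *\<^sub>R e))) (at t)" for t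
          using d[of x t] by (simp add: has_vector_derivative_def)
      qed (rule h)
      then obtain t where t: "0 < t" "t < h k" "norm (v (x + h k *\<^sub>R e) - v x) \<le> h k * norm (v' (x + t *\<^sub>R e))"
        using h[of k] by auto
      have "norm (v (x + h k *\<^sub>R e) - v x) \<le> h k * W x"
        by (rule order_trans[OF t(3)]) (use t h[of k] W(2)[of t x] in auto)
      then show "norm (q k x) \<le> W x"
        using h(1)[of k] unfolding q_def norm_scaleR
        by (simp add: divide_inverse_commute[symmetric] divide_le_eq mult.commute)
    qed
  qed
  moreover have "(\<integral>x. q k x \<partial>lborel) = 0" for k
  proof -
    have T: "(\<lambda>x::'a. x + h k *\<^sub>R e) \<in> measurable lborel borel" by measurable
    have D: "distr lborel borel (\<lambda>x::'a. x + h k *\<^sub>R e) = lborel"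
      using lborel_distr_plus[of "h k *\<^sub>R e"] by (simp add: add.commute[of _ "h k *\<^sub>R e"])
    have 1: "integrable lborel (\<lambda>x. v (x + h k *\<^sub>R e))"
      using v integrable_distr_eq[OF T, of v] by (simp add: D)
    have 2: "(\<integral>x. v (x + h k *\<^sub>R e) \<partial>lborel) = (\<integral>x. v x \<partial>lborel)"
      using integral_distr[OF T, of v] by (simp add: D)
    show ?thesis unfolding q_def using 1 2 v by simp
  qed
  ultimately show ?thesis by (simp add: LIMSEQ_const_iff)
qed

lemma axis_scaleR: "axis j t = t *\<^sub>R axis j (1::real)"
  by (simp add: vec_eq_iff axis_def)

lemma gauss_density_has_vector_derivative:
  "((\<lambda>t. gauss_density (x + axis j t)) has_vector_derivative - (x $ j) * gauss_density x) (at 0)"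
proof -
  define c where "c = (2 * pi) powr (- real CARD('a) / 2)"
  have n: "(norm (x + axis j t))\<^sup>2 = (norm x)\<^sup>2 + 2 * t * x $ j + t\<^sup>2" for t
    by (subst axis_scaleR, unfold power2_norm_eq_inner)
      (simp add: inner_add inner_axis inner_axis' inner_axis_axis power2_eq_square algebra_simps)
  have "((\<lambda>t. c * exp (- ((norm x)\<^sup>2 + 2 * t * x $ j + t\<^sup>2) / 2)) has_real_derivative - (x $ j) * (c * exp (- (norm x)\<^sup>2 / 2))) (at 0)"
    by (auto intro!: derivative_eq_intros)
  then show ?thesis
    unfolding gauss_density_def n c_def[symmetric] has_real_derivative_iff_has_vector_derivative .
qed

text \<open>
  Supplies the dominating function that \<open>integral_directional_derivative_eq_0\<close> asks for: moving by at
  most \<open>1\<close> costs only a factor \<open>exp |x|\<close>.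
\<close>

lemma gauss_density_shift:
  assumes "norm h \<le> 1"
  shows "gauss_density (x + h) \<le> gauss_density x * exp (norm x)"
proof -
  have "\<bar>norm x - norm (x + h)\<bar> \<le> 1" using norm_triangle_ineq3[of x "x + h"] assms by simp
  then have "norm x - 1 \<le> norm (x + h)" by linarith
  have "(norm x)\<^sup>2 - 2 * norm x \<le> (norm (x + h))\<^sup>2"
  proof (cases "norm x \<ge> 1")
    case True
    then have "(norm x - 1)\<^sup>2 \<le> (norm (x + h))\<^sup>2" using \<open>norm x - 1 \<le> norm (x + h)\<close> by (intro power_mono) auto
    then show ?thesis by (simp add: power2_diff)
  next
    case False
    then have "(norm x)\<^sup>2 \<le> 2 * norm x" by (simp add: power2_eq_square mult_right_mono)
    then show ?thesis using zero_le_power2[of "norm (x + h)"] by linarith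
  qed
  then have "exp (- (norm (x + h))\<^sup>2 / 2) \<le> exp (- (norm x)\<^sup>2 / 2) * exp (norm x)"
    by (simp add: exp_add[symmetric])
  then show ?thesis unfolding gauss_density_def mult.assoc by (rule mult_left_mono) simp
qed

text \<open>
  The derivative of \<open>u\<close> times the Gauss density is the density times \<open>\<partial>\<^sub>j u - x\<^sub>j u\<close>, and it integrates
  to \<open>0\<close>.
\<close>

lemma gauss_ibp:
  fixes u u' :: "real^'n::finite \<Rightarrow> complex"
  assumes d: "\<And>x. ((\<lambda>t. u (x + axis j t)) has_vector_derivative u' x) (at 0)"
    and [measurable]: "u \<in> borel_measurable borel" "u' \<in> borel_measurable borel"
    and u: "exp_bounded u" and u': "exp_bounded u'"
  shows "(\<integral>x. u' x \<partial>\<gamma>) = (\<integral>x. of_real (x $ j) * u x \<partial>\<gamma>)"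
proof -
  define w where "w = (\<lambda>x. u' x - of_real (x $ j) * u x)"
  define v where "v = (\<lambda>x. of_real (gauss_density x) * u x)"
  define v' where "v' = (\<lambda>x. of_real (gauss_density x) * w x)"
  have wb: "exp_bounded w"
    unfolding w_def by (intro exp_bounded_diff exp_bounded_mult exp_bounded_coord u u')
  have [measurable]: "w \<in> borel_measurable borel" unfolding w_def by measurable
  obtain C c where C: "C \<ge> 0" "c \<ge> 0" "\<And>x. cmod (w x) \<le> C * exp (c * norm x)"
    using wb unfolding exp_bounded_def by blast
  have vd: "((\<lambda>s. v (x + axis j s)) has_vector_derivative v' x) (at 0)" for x
  proof -
    have "((\<lambda>s. gauss_density (x + axis j s) *\<^sub>R u (x + axis j s)) has_vector_derivative
        gauss_density (x + axis j 0) *\<^sub>R u' x + (- (x $ j) * gauss_density x) *\<^sub>R u (x + axis j 0)) (at 0)"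
      by (rule has_vector_derivative_scaleR)
        (use gauss_density_has_vector_derivative[of x j] d[of x] in
          \<open>simp_all add: has_real_derivative_iff_has_vector_derivative\<close>)
    then show ?thesis
      by (simp add: v_def v'_def w_def scaleR_conv_of_real axis_eq_0_iff[THEN iffD2] algebra_simps)
  qed
  have "(\<integral>x. v' x \<partial>lborel) = 0"
  proof (rule integral_directional_derivative_eq_0[where e = "axis j 1"])
    have "integrable \<gamma> u"
      using integrable_product[OF exp_bounded_square_integrable[OF u] exp_bounded_square_integrable[OF exp_bounded_const[of 1]]]
      by simp
    then show "integrable lborel v"
      by (simp add: integrable_gauss_iff v_def scaleR_conv_of_real)
    show "((\<lambda>t. v (x + t *\<^sub>R axis j 1)) has_vector_derivative v' (x + t *\<^sub>R axis j 1)) (at t)" for x t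
    proof -
      have "(((\<lambda>s. v ((x + t *\<^sub>R axis j 1) + axis j s)) \<circ> (\<lambda>r. r - t)) has_vector_derivative
          1 *\<^sub>R v' (x + t *\<^sub>R axis j 1)) (at t)"
        by (rule vector_diff_chain_at)
          (use vd[of "x + t *\<^sub>R axis j 1"] in \<open>auto intro!: derivative_eq_intros\<close>)
      moreover have "(\<lambda>s. v ((x + t *\<^sub>R axis j 1) + axis j s)) \<circ> (\<lambda>r. r - t) = (\<lambda>t. v (x + t *\<^sub>R axis j 1))"
        by (subst axis_scaleR) (auto simp: fun_eq_iff algebra_simps)
      ultimately show ?thesis by simp
    qed
    show "v' \<in> borel_measurable borel" unfolding v'_def by measurable
    \<comment> \<open>One unit of the exponent \<open>1 + c\<close> comes from shifting the density, the rest from the growth of \<open>w\<close>.\<close>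
    define W where "W = (\<lambda>x::real^'n. (C * exp c) * (gauss_density x *\<^sub>R exp ((1 + c) * norm x)))"
    show "integrable lborel W"
      unfolding W_def
      by (intro integrable_mult_right integrable_gauss_iff[THEN iffD1] integrable_gauss_exp_norm) simp
    show "cmod (v' (x + t *\<^sub>R axis j 1)) \<le> W x" if t: "0 \<le> t" "t \<le> 1" for x t
    proof -
      let ?h = "t *\<^sub>R axis j (1::real) :: real^'n"
      have nh: "norm ?h \<le> 1" using t by simp
      have "cmod (w (x + ?h)) \<le> C * exp (c * norm (x + ?h))" by (rule C)
      also have "\<dots> \<le> C * exp (c * (norm x + 1))"
        using norm_triangle_ineq[of x ?h] nh C by (intro mult_left_mono) (auto intro!: mult_left_mono)
      finally have "gauss_density (x + ?h) * cmod (w (x + ?h))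
          \<le> (gauss_density x * exp (norm x)) * (C * exp (c * (norm x + 1)))"
        by (intro mult_mono gauss_density_shift nh) (auto simp: less_imp_le[OF gauss_density_pos])
      also have "\<dots> = W x"
        by (simp add: W_def exp_add distrib_left distrib_right mult_ac)
      finally show ?thesis
        by (simp add: v'_def norm_mult less_imp_le[OF gauss_density_pos])
    qed
  qed
  then have "(\<integral>x. w x \<partial>\<gamma>) = 0"
    by (simp add: integral_gauss v'_def scaleR_conv_of_real)
  moreover have "integrable \<gamma> u'"
    using integrable_product[OF exp_bounded_square_integrable[OF u'] exp_bounded_square_integrable[OF exp_bounded_const[of 1]]]
    by simp
  moreover have "integrable \<gamma> (\<lambda>x. of_real (x $ j) * u x)"
    by (intro integrable_product exp_bounded_square_integrable exp_bounded_coord u) measurable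
  ultimately show ?thesis by (simp add: w_def)
qed

section \<open>Smooth functions of exponential growth\<close>

text \<open>
  The class on which integration by parts can be iterated. It contains the test functions and the
  Hermite functions, and with them every function to which the transform is applied explicitly.
\<close>

definition tame :: "(real^'n::finite \<Rightarrow> complex) \<Rightarrow> bool" where
  "tame u \<longleftrightarrow> smooth u \<and> (\<forall>js. exp_bounded (foldr rpartial js u))"

lemma foldr_rpartial_snoc: "foldr rpartial js (rpartial j u) = foldr rpartial (js @ [j]) u"
  by simp

lemma smooth_rpartial: "smooth u \<Longrightarrow> smooth (rpartial j u)"
  unfolding smooth_def foldr_rpartial_snoc by blast

lemma smooth_foldr: "smooth u \<Longrightarrow> smooth (foldr rpartial js u)"
  by (induction js) (auto intro: smooth_rpartial)

lemma tame_rpartial: "tame u \<Longrightarrow> tame (rpartial j u)"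
  unfolding tame_def foldr_rpartial_snoc by (blast intro: smooth_rpartial)

lemma tame_foldr: "tame u \<Longrightarrow> tame (foldr rpartial js u)"
  by (induction js) (auto intro: tame_rpartial)

lemma smooth_differentiable: "smooth u \<Longrightarrow> u differentiable (at x)"
  unfolding smooth_def by (drule spec[of _ "[]"]) simp

lemma tame_smooth: "tame u \<Longrightarrow> smooth u" by (simp add: tame_def)

lemma tame_exp_bounded: "tame u \<Longrightarrow> exp_bounded u"
  unfolding tame_def by (drule conjunct2, drule spec[of _ "[]"]) simp

lemma smooth_continuous: "smooth u \<Longrightarrow> continuous_on A u"
  by (intro continuous_at_imp_continuous_on ballI differentiable_imp_continuous_within smooth_differentiable)

lemma smooth_measurable: "smooth u \<Longrightarrow> u \<in> borel_measurable borel"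
  by (intro borel_measurable_continuous_onI smooth_continuous)

lemma tame_square_integrable: "tame u \<Longrightarrow> square_integrable \<gamma> u"
  by (intro exp_bounded_square_integrable tame_exp_bounded smooth_measurable tame_smooth)

lemma has_vector_derivative_rpartial:
  assumes "u differentiable (at x)"
  shows "((\<lambda>t. u (x + axis j t)) has_vector_derivative rpartial j u x) (at 0)"
proof -
  have "(\<lambda>t. u (x + axis j t)) differentiable (at 0)"
  proof (rule differentiable_compose[where f = u])
    show "u differentiable at (x + axis j 0)" using assms by (simp add: axis_eq_0_iff[THEN iffD2])
    show "(\<lambda>t. x + axis j t) differentiable at 0"
      by (subst axis_scaleR) simp
  qed
  then show ?thesis unfolding rpartial_def by (rule vector_derivative_works[THEN iffD1])
qed

lemma rpartial_eqI:
  assumes "((\<lambda>t. u (x + axis j t)) has_vector_derivative d) (at 0)"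
  shows "rpartial j u x = d"
  unfolding rpartial_def using assms by (rule vector_derivative_at)

lemma foldr_rpartial_linear:
  assumes "smooth f" "smooth g"
  shows "foldr rpartial js (\<lambda>x. a * f x + b * g x) = (\<lambda>x. a * foldr rpartial js f x + b * foldr rpartial js g x)"
proof (induction js)
  case (Cons j js)
  show ?case
  proof
    fix x
    show "foldr rpartial (j # js) (\<lambda>x. a * f x + b * g x) x = a * foldr rpartial (j # js) f x + b * foldr rpartial (j # js) g x"
      unfolding foldr.simps o_apply Cons
      by (rule rpartial_eqI, intro has_vector_derivative_add has_vector_derivative_mult_right
          has_vector_derivative_rpartial smooth_differentiable smooth_foldr assms)
  qed
qed simp

lemma smooth_linear:
  assumes "smooth f" "smooth g"
  shows "smooth (\<lambda>x. a * f x + b * g x)"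
  unfolding smooth_def foldr_rpartial_linear[OF assms]
  using assms unfolding smooth_def by simp

lemma tame_linear:
  assumes "tame f" "tame g"
  shows "tame (\<lambda>x. a * f x + b * g x)"
  using assms unfolding tame_def
  by (simp add: smooth_linear foldr_rpartial_linear exp_bounded_add exp_bounded_cmult)

lemma foldr_rpartial_zero: "foldr rpartial js (\<lambda>x. 0) = (\<lambda>x. 0)"
  by (induction js) (auto intro!: rpartial_eqI)

lemma tame_zero: "tame (\<lambda>x. 0)"
  by (simp add: tame_def smooth_def foldr_rpartial_zero exp_bounded_const)

lemma tame_sum: "(\<And>i. i \<in> I \<Longrightarrow> tame (f i)) \<Longrightarrow> tame (\<lambda>x. \<Sum>i\<in>I. c i * f i x)"
proof (induction I rule: infinite_finite_induct)
  case (insert i I)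
  then show ?case using tame_linear[of "f i" "\<lambda>x. \<Sum>i\<in>I. c i * f i x" "c i" 1] by simp
qed (simp_all add: tame_zero)

lemma foldr_rpartial_outside_support:
  "x \<notin> closure {x. f x \<noteq> 0} \<Longrightarrow> foldr rpartial js f x = 0"
proof (induction js arbitrary: x)
  case Nil
  then show ?case using closure_subset[of "{x. f x \<noteq> 0}"] by auto
next
  case (Cons j js)
  have o: "open ((\<lambda>t. x + axis j t) -` (- closure {x. f x \<noteq> 0}))"
  proof (rule open_vimage)
    show "continuous_on UNIV (\<lambda>t. x + axis j t)"
      by (subst axis_scaleR) (intro continuous_intros)
  qed (rule open_Compl[OF closed_closure])
  have "((\<lambda>t. foldr rpartial js f (x + axis j t)) has_vector_derivative 0) (at 0)"
    by (rule has_vector_derivative_transform_within_open[OF has_vector_derivative_const o])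
      (use Cons in \<open>auto simp: axis_eq_0_iff[THEN iffD2]\<close>)
  then show ?case by (simp add: rpartial_eqI)
qed

lemma foldr_rpartial_test_function:
  assumes "f \<in> test_functions"
  shows "foldr rpartial js f \<in> test_functions"
proof -
  have "{x. foldr rpartial js f x \<noteq> 0} \<subseteq> closure {x. f x \<noteq> 0}"
    using foldr_rpartial_outside_support[of _ f js] by blast
  then have "closure {x. foldr rpartial js f x \<noteq> 0} \<subseteq> closure {x. f x \<noteq> 0}"
    by (simp add: closure_minimal)
  then show ?thesis
    using assms compact_Int_closed[of "closure {x. f x \<noteq> 0}" "closure {x. foldr rpartial js f x \<noteq> 0}"]
    by (simp add: test_functions_def smooth_foldr Int_absorb1)
qed

lemma test_function_tame:
  assumes "f \<in> test_functions"
  shows "tame f"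
proof -
  let ?K = "closure {x. f x \<noteq> 0}"
  have f: "smooth f" "compact ?K" using assms by (auto simp: test_functions_def)
  note z = foldr_rpartial_outside_support[of _ f]
  have "exp_bounded (foldr rpartial js f)" for js
  proof -
    have "bounded (foldr rpartial js f ` ?K)"
      by (intro compact_imp_bounded compact_continuous_image smooth_continuous smooth_foldr f)
    then obtain B where B: "\<And>x. x \<in> ?K \<Longrightarrow> cmod (foldr rpartial js f x) \<le> B"
      unfolding bounded_iff by auto
    show ?thesis
    proof (rule exp_boundedI[of _ "\<bar>B\<bar>" 0])
      show "cmod (foldr rpartial js f x) \<le> \<bar>B\<bar> * exp (0 * norm x)" for x
        using B[of x] z[of x js] by (cases "x \<in> ?K") auto
    qed
  qed
  then show ?thesis using f by (simp add: tame_def)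
qed

lemma test_functions_linear:
  assumes "f \<in> test_functions" "g \<in> test_functions"
  shows "(\<lambda>x. a * f x + b * g x) \<in> test_functions"
proof -
  have "bounded {x. f x \<noteq> 0}" "bounded {x. g x \<noteq> 0}"
    using assms by (auto simp: test_functions_def compact_imp_bounded intro: bounded_subset[OF _ closure_subset])
  then have "bounded ({x. f x \<noteq> 0} \<union> {x. g x \<noteq> 0})" by simp
  then have "bounded {x. a * f x + b * g x \<noteq> 0}" by (rule bounded_subset) auto
  then show ?thesis using assms by (auto simp: test_functions_def smooth_linear)
qed

text \<open>
  Apply integration by parts to \<open>u E(\<cdot>,z)\<close>: since \<open>\<partial>E/\<partial>x\<^sub>j = z\<^sub>j E\<close>, the identity reads
  \<open>G (\<partial>\<^sub>j u) = G (x\<^sub>j u) - z\<^sub>j G u\<close>, and the right-hand side is the integral against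
  \<open>\<partial>E/\<partial>z\<^sub>j = (x\<^sub>j - z\<^sub>j) E\<close>.
\<close>

lemma bargmann_partial_tame:
  assumes u: "tame u"
  shows "bargmann_partial u j z = bargmann (rpartial j u) z"
proof -
  define U where "U = (\<lambda>x. u x * bargmann_kernel x z)"
  define U' where "U' = (\<lambda>x. rpartial j u x * bargmann_kernel x z + u x * (z $ j * bargmann_kernel x z))"
  note sm = smooth_measurable[OF tame_smooth[OF u], measurable]
    smooth_measurable[OF tame_smooth[OF tame_rpartial[OF u]], measurable]
  have kd: "((\<lambda>t. bargmann_kernel (x + axis j t) z) has_vector_derivative z $ j * bargmann_kernel x z) (at 0)" for x
  proof -
    have "cdot (x + axis j t) z = cdot x z + of_real t * z $ j" for t
      unfolding cdot_def by (simp add: sum.distrib axis_def distrib_right if_distrib[of "\<lambda>u. u * _"] if_distrib[of of_real] cong: if_cong)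
    then have "(\<lambda>t. bargmann_kernel (x + axis j t) z) = (\<lambda>t. bargmann_kernel x z * exp (t *\<^sub>R z $ j))"
      by (simp add: bargmann_kernel_def scaleR_conv_of_real exp_add[symmetric] algebra_simps)
    moreover have "((\<lambda>t. bargmann_kernel x z * exp (t *\<^sub>R z $ j)) has_vector_derivative
        bargmann_kernel x z * (exp (0 *\<^sub>R z $ j) * z $ j)) (at 0)"
      by (intro has_vector_derivative_mult_right exp_scaleR_has_vector_derivative_right)
    ultimately show ?thesis by (simp add: mult.commute)
  qed
  have "(\<integral>x. U' x \<partial>\<gamma>) = (\<integral>x. of_real (x $ j) * U x \<partial>\<gamma>)"
  proof (rule gauss_ibp)
    show "((\<lambda>t. U (x + axis j t)) has_vector_derivative U' x) (at 0)" for x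
      using has_vector_derivative_mult[OF has_vector_derivative_rpartial[OF smooth_differentiable[OF tame_smooth[OF u]], of x j] kd[of x]]
      unfolding U_def U'_def by (simp add: axis_eq_0_iff[THEN iffD2] add.commute)
    show "U \<in> borel_measurable borel" "U' \<in> borel_measurable borel"
      unfolding U_def U'_def using sm by measurable
    show "exp_bounded U" "exp_bounded U'"
      unfolding U_def U'_def
      by (intro exp_bounded_mult exp_bounded_add exp_bounded_kernel exp_bounded_const
          tame_exp_bounded u tame_rpartial)+
  qed
  moreover have "(\<integral>x. U' x \<partial>\<gamma>) = bargmann (rpartial j u) z + z $ j * bargmann u z"
  proof -
    have "(\<integral>x. U' x \<partial>\<gamma>) = (\<integral>x. rpartial j u x * bargmann_kernel x z + z $ j * (u x * bargmann_kernel x z) \<partial>\<gamma>)"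
      unfolding U'_def by (simp add: mult_ac)
    then show ?thesis
      using integrable_bargmann[OF tame_square_integrable[OF u]]
        integrable_bargmann[OF tame_square_integrable[OF tame_rpartial[OF u]]] by (simp add: bargmann_def)
  qed
  moreover have "bargmann_partial u j z = (\<integral>x. of_real (x $ j) * U x \<partial>\<gamma>) - z $ j * bargmann u z"
  proof -
    have "bargmann_partial u j z = (\<integral>x. of_real (x $ j) * U x - z $ j * (u x * bargmann_kernel x z) \<partial>\<gamma>)"
      unfolding bargmann_partial_def U_def by (simp add: algebra_simps)
    moreover have "integrable \<gamma> (\<lambda>x. of_real (x $ j) * U x)"
      unfolding U_def using sm
      by (intro integrable_product exp_bounded_square_integrable exp_bounded_coord exp_bounded_mult
          tame_exp_bounded u exp_bounded_kernel) measurable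
    ultimately show ?thesis
      using integrable_bargmann[OF tame_square_integrable[OF u]] by (simp add: bargmann_def)
  qed
  ultimately show ?thesis by (metis add_diff_cancel_right')
qed

lemma foldr_cpartial_bargmann:
  assumes "tame u"
  shows "foldr cpartial js (bargmann u) = bargmann (foldr rpartial js u)"
proof (induction js)
  case (Cons j js)
  show ?case
    unfolding foldr.simps o_apply Cons
    by (simp add: fun_eq_iff cpartial_bargmann tame_square_integrable tame_foldr assms bargmann_partial_tame)
qed simp

lemma mi_deriv_bargmann: "tame u \<Longrightarrow> mi_deriv cpartial \<alpha> (bargmann u) = bargmann (mi_deriv rpartial \<alpha> u)"
  unfolding mi_deriv_def by (rule foldr_cpartial_bargmann)

section \<open>The isometry on test functions\<close>

text \<open>
  A dominating function of \<open>z\<close> alone is integrable on the product because the measure in \<open>x\<close> is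
  finite.
\<close>

lemma integral_swap_dominated:
  fixes F :: "'a \<Rightarrow> 'b \<Rightarrow> complex"
  assumes "finite_measure M" "sigma_finite_measure N"
    and F: "case_prod F \<in> borel_measurable (M \<Otimes>\<^sub>M N)"
    and g: "integrable N g" "\<And>x z. cmod (F x z) \<le> g z"
  shows "(\<integral>z. (\<integral>x. F x z \<partial>M) \<partial>N) = (\<integral>x. (\<integral>z. F x z \<partial>N) \<partial>M)"
proof -
  interpret M: finite_measure M by fact
  interpret N: sigma_finite_measure N by fact
  interpret pair_sigma_finite M N ..
  have [measurable]: "g \<in> borel_measurable N" using g by auto
  have "integrable (M \<Otimes>\<^sub>M N) (\<lambda>p. g (snd p))"
    by (rule Fubini_integrable) (use g in auto)
  then have "integrable (M \<Otimes>\<^sub>M N) (case_prod F)"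
    by (rule Bochner_Integration.integrable_bound[OF _ F])
      (auto intro!: AE_I2 order_trans[OF g(2)])
  then show ?thesis by (rule Fubini_integral)
qed

lemma exp_norm_mult_weight:
  fixes z :: "complex^'n::finite"
  shows "exp ((norm z)\<^sup>2 / 2) * exp (norm z * a) * (exp ((norm z)\<^sup>2 / 2) * exp (norm z * b)) * exp (- (1 + \<epsilon>) * (norm z)\<^sup>2)
    = exp ((a + b) * norm z - \<epsilon> * (norm z)\<^sup>2)"
  unfolding exp_add[symmetric] by (simp add: algebra_simps)

text \<open>
  With \<open>z = a + i b\<close> the exponent has no mixed term \<open>a\<^sub>j b\<^sub>j\<close>, so the integral over \<open>\<complex>\<^sup>n\<close> is a product of
  one-dimensional Gaussian integrals: in \<open>a\<^sub>j\<close> with the real parameter \<open>x\<^sub>j + y\<^sub>j\<close>, in \<open>b\<^sub>j\<close> with the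
  imaginary parameter \<open>i (x\<^sub>j - y\<^sub>j)\<close>.
\<close>

lemma kernel_product_integral:
  fixes x y :: "real^'n::finite"
  assumes e: "0 < \<epsilon>"
  shows "(\<integral>z. bargmann_kernel x z * cnj (bargmann_kernel y z) * of_real (exp (- (1 + \<epsilon>) * (norm z)\<^sup>2)) \<partial>lborel)
    = of_real ((pi / sqrt ((2 + \<epsilon>) * \<epsilon>)) ^ CARD('n) *
        exp ((norm (x + y))\<^sup>2 / (4 * (2 + \<epsilon>)) - (norm (x - y))\<^sup>2 / (4 * \<epsilon>)))"
proof -
  define p q where "p = (\<lambda>i. complex_of_real (x $ i + y $ i))" and "q = (\<lambda>i. \<i> * complex_of_real (x $ i - y $ i))"
  define f where "f = (\<lambda>i t. exp (p i * of_real t - of_real ((2 + \<epsilon>) * t\<^sup>2)))"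
  define g where "g = (\<lambda>i t. exp (q i * of_real t - of_real (\<epsilon> * t\<^sup>2)))"
  have f: "integrable lborel (f i)" "integral\<^sup>L lborel (f i) = of_real (sqrt (pi / (2 + \<epsilon>))) * exp ((p i)\<^sup>2 / of_real (4 * (2 + \<epsilon>)))" for i
    using gaussian_integral[of "2 + \<epsilon>" "p i"] e by (auto simp: f_def has_bochner_integral_iff)
  have g: "integrable lborel (g i)" "integral\<^sup>L lborel (g i) = of_real (sqrt (pi / \<epsilon>)) * exp ((q i)\<^sup>2 / of_real (4 * \<epsilon>))" for i
    using gaussian_integral[of "\<epsilon>" "q i"] e by (auto simp: g_def has_bochner_integral_iff)
  have "bargmann_kernel x z * cnj (bargmann_kernel y z) * of_real (exp (- (1 + \<epsilon>) * (norm z)\<^sup>2))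
      = (\<Prod>i\<in>UNIV. f i (Re (z $ i)) * g i (Im (z $ i)))" for z
  proof -
    have c: "of_real (x $ i) * w - w\<^sup>2 / 2 + (of_real (y $ i) * cnj w - (cnj w)\<^sup>2 / 2) + of_real (- (1 + \<epsilon>) * (cmod w)\<^sup>2)
      = p i * of_real (Re w) - of_real ((2 + \<epsilon>) * (Re w)\<^sup>2) + (q i * of_real (Im w) - of_real (\<epsilon> * (Im w)\<^sup>2))" for i w
      by (rule complex_eqI) (simp_all add: p_def q_def cmod_power2, simp_all add: power2_eq_square algebra_simps)
    have "cdot x z - csq z / 2 + cnj (cdot y z - csq z / 2) + of_real (- (1 + \<epsilon>) * (norm z)\<^sup>2)
      = (\<Sum>i\<in>UNIV. of_real (x $ i) * z $ i - (z $ i)\<^sup>2 / 2 + (of_real (y $ i) * cnj (z $ i) - (cnj (z $ i))\<^sup>2 / 2) + of_real (- (1 + \<epsilon>) * (cmod (z $ i))\<^sup>2))"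
      unfolding sum_norm_sq[symmetric] cdot_def csq_def
      by (simp add: sum.distrib sum_subtractf sum_divide_distrib sum_distrib_left sum_negf)
    also have "\<dots> = (\<Sum>i\<in>UNIV. p i * of_real (Re (z $ i)) - of_real ((2 + \<epsilon>) * (Re (z $ i))\<^sup>2) + (q i * of_real (Im (z $ i)) - of_real (\<epsilon> * (Im (z $ i))\<^sup>2)))"
      by (simp only: c)
    finally have "exp (cdot x z - csq z / 2 + cnj (cdot y z - csq z / 2) + of_real (- (1 + \<epsilon>) * (norm z)\<^sup>2))
      = (\<Prod>i\<in>UNIV. f i (Re (z $ i)) * g i (Im (z $ i)))"
      unfolding f_def g_def exp_add[symmetric] exp_sum[OF finite, symmetric] by (rule arg_cong)
    then show ?thesis
      unfolding bargmann_kernel_def exp_cnj[symmetric] exp_of_real[symmetric] exp_add .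
  qed
  then have "(\<integral>z. bargmann_kernel x z * cnj (bargmann_kernel y z) * of_real (exp (- (1 + \<epsilon>) * (norm z)\<^sup>2)) \<partial>lborel)
     = (\<Prod>i\<in>UNIV. (\<integral>t. f i t \<partial>lborel) * (\<integral>t. g i t \<partial>lborel))"
    by (simp only: integral_prod_complex_vec(2)[OF f(1) g(1)])
  also have "\<dots> = (\<Prod>i\<in>UNIV. of_real (pi / sqrt ((2 + \<epsilon>) * \<epsilon>)) *
      of_real (exp ((x $ i + y $ i)\<^sup>2 / (4 * (2 + \<epsilon>)) - (x $ i - y $ i)\<^sup>2 / (4 * \<epsilon>))))"
  proof (rule prod.cong[OF refl])
    fix i
    have 1: "sqrt (pi / (2 + \<epsilon>)) * sqrt (pi / \<epsilon>) = pi / sqrt ((2 + \<epsilon>) * \<epsilon>)"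
      using e by (simp add: real_sqrt_divide real_sqrt_mult)
    have 2: "exp ((p i)\<^sup>2 / of_real (4 * (2 + \<epsilon>))) = of_real (exp ((x $ i + y $ i)\<^sup>2 / (4 * (2 + \<epsilon>))))"
      by (simp add: p_def exp_of_real[symmetric])
    have 3: "exp ((q i)\<^sup>2 / of_real (4 * \<epsilon>)) = of_real (exp (- (x $ i - y $ i)\<^sup>2 / (4 * \<epsilon>)))"
      by (simp add: q_def exp_of_real[symmetric] power_mult_distrib)
    have "(\<integral>t. f i t \<partial>lborel) * (\<integral>t. g i t \<partial>lborel) = of_real (sqrt (pi / (2 + \<epsilon>)) * sqrt (pi / \<epsilon>)) *
       of_real (exp ((x $ i + y $ i)\<^sup>2 / (4 * (2 + \<epsilon>))) * exp (- (x $ i - y $ i)\<^sup>2 / (4 * \<epsilon>)))"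
      unfolding f(2) g(2) 2 3 by (simp only: of_real_mult mult_ac)
    then show "(\<integral>t. f i t \<partial>lborel) * (\<integral>t. g i t \<partial>lborel) = of_real (pi / sqrt ((2 + \<epsilon>) * \<epsilon>)) *
      of_real (exp ((x $ i + y $ i)\<^sup>2 / (4 * (2 + \<epsilon>)) - (x $ i - y $ i)\<^sup>2 / (4 * \<epsilon>)))"
      unfolding 1 exp_add[symmetric] by simp
  qed
  also have "\<dots> = of_real ((pi / sqrt ((2 + \<epsilon>) * \<epsilon>)) ^ CARD('n) *
        exp ((norm (x + y))\<^sup>2 / (4 * (2 + \<epsilon>)) - (norm (x - y))\<^sup>2 / (4 * \<epsilon>)))"
    unfolding prod.distrib of_real_mult of_real_prod[symmetric] sum_norm_sq[symmetric]
    by (simp add: exp_sum[symmetric] sum_subtractf sum_divide_distrib)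
  finally show ?thesis .
qed

lemma integral_lborel_affine:
  fixes f :: "'a::euclidean_space \<Rightarrow> complex"
  assumes [measurable]: "f \<in> borel_measurable borel" and c: "0 < c"
  shows "(\<integral>y. f y \<partial>lborel) = of_real (c ^ DIM('a)) * (\<integral>u. f (t + c *\<^sub>R u) \<partial>lborel)"
proof -
  have T: "(\<lambda>x. t + c *\<^sub>R x) \<in> measurable lborel borel" by measurable
  have "(\<integral>y. f y \<partial>lborel) = (\<integral>y. f y \<partial>(density (distr lborel borel (\<lambda>x. t + c *\<^sub>R x)) (\<lambda>_. ennreal (\<bar>c\<bar> ^ DIM('a)))))"
    using lborel_affine[of c t] c by simp
  also have "\<dots> = (\<integral>y. \<bar>c\<bar> ^ DIM('a) *\<^sub>R f y \<partial>(distr lborel borel (\<lambda>x. t + c *\<^sub>R x)))"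
    by (rule integral_density) (use c in auto)
  also have "\<dots> = (\<integral>u. \<bar>c\<bar> ^ DIM('a) *\<^sub>R f (t + c *\<^sub>R u) \<partial>lborel)"
    by (rule integral_distr[OF T]) measurable
  finally show ?thesis using c by (simp add: scaleR_conv_of_real)
qed

lemma entire_continuous: "entire F \<Longrightarrow> continuous_on A F"
  unfolding entire_def
  by (intro continuous_at_imp_continuous_on ballI) (blast intro: has_derivative_continuous)

lemma bargmann_measurable: "square_integrable \<gamma> f \<Longrightarrow> bargmann f \<in> borel_measurable borel"
  by (intro borel_measurable_continuous_onI entire_continuous entire_bargmann)

text \<open>
  The regularised norm \<open>\<integral> |G \<phi>|\<^sup>2 exp (- (1 + \<epsilon>) |z|\<^sup>2) dz\<close> is rewritten as a double integral over
  \<open>\<real>\<^sup>n \<times> \<real>\<^sup>n\<close> by two applications of Fubini's theorem. After the substitution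
  \<open>y = x + sqrt (2 \<epsilon>) u\<close> the factor of the kernel in \<open>x - y\<close> becomes the Gauss density in \<open>u\<close>, and the limit \<open>\<epsilon> \<rightarrow> 0\<close> is
  governed by dominated convergence on the one side and monotone convergence on the other. Compact
  support is used to dominate the kernel uniformly in \<open>x\<close>.
\<close>

lemma bargmann_test_function_norm:
  fixes \<phi> :: "real^'n::finite \<Rightarrow> complex"
  assumes cont: "continuous_on UNIV \<phi>" and R: "0 \<le> R" "\<And>x. \<phi> x \<noteq> 0 \<Longrightarrow> norm x \<le> R"
    and C: "\<And>x. cmod (\<phi> x) \<le> C"
  shows "has_bochner_integral lborel (\<lambda>z. (cmod (bargmann \<phi> z))\<^sup>2 * exp (- (norm z)\<^sup>2))
    (pi ^ CARD('n) * (l2norm \<gamma> \<phi>)\<^sup>2)"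
proof -
  have C0: "0 \<le> C" using C[of 0] norm_ge_zero order_trans by blast
  have [measurable]: "\<phi> \<in> borel_measurable borel" using cont by (rule borel_measurable_continuous_onI)
  have sq: "square_integrable \<gamma> \<phi>"
    by (intro exp_bounded_square_integrable exp_boundedI[of _ C 0]) (auto simp: C)
  note [measurable] = bargmann_measurable[OF sq]
  define w where "w = (\<lambda>\<epsilon> (z::complex^'n). exp (- (1 + \<epsilon>) * (norm z)\<^sup>2))"
  have w0: "0 \<le> w \<epsilon> z" for \<epsilon> z by (simp add: w_def)
  have [measurable]: "w \<epsilon> \<in> borel_measurable borel" for \<epsilon> unfolding w_def by measurable
  \<comment> \<open>\<open>B a\<close> bounds the kernel for \<open>|x| \<le> a\<close>. Two such factors use up the weight \<open>exp (- |z|\<^sup>2)\<close>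
    exactly; the regularising factor \<open>exp (- \<epsilon> |z|\<^sup>2)\<close> makes the product integrable.\<close>
  define B where "B = (\<lambda>a (z::complex^'n). exp ((norm z)\<^sup>2 / 2) * exp (norm z * a))"
  have B0: "0 \<le> B a z" for a z by (simp add: B_def)
  have Bw: "B a z * B b z * w \<epsilon> z = exp ((a + b) * norm z - \<epsilon> * (norm z)\<^sup>2)" for a b z \<epsilon>
    unfolding B_def w_def by (rule exp_norm_mult_weight)
  have kb: "cmod (bargmann_kernel x z) \<le> B (norm x) z" for x :: "real^'n" and z
    unfolding B_def by (rule norm_kernel_le)
  have fk: "cmod (\<phi> x * bargmann_kernel x z) \<le> C * B R z" for x z
  proof (cases "\<phi> x = 0")
    case False
    have "B (norm x) z \<le> B R z" unfolding B_def using R(2)[OF False] by (auto intro!: mult_left_mono)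
    with kb[of x z] show ?thesis unfolding norm_mult by (intro mult_mono C C0) auto
  qed (simp add: C0 B0)
  have gb: "cmod (bargmann \<phi> z) \<le> C * B R z" for z
  proof -
    have "cmod (bargmann \<phi> z) \<le> (\<integral>x. cmod (\<phi> x * bargmann_kernel x z) \<partial>\<gamma>)"
      unfolding bargmann_def by (rule integral_norm_bound)
    also have "\<dots> \<le> (\<integral>x. C * B R z \<partial>(\<gamma> :: (real^'n) measure))"
      by (rule integral_mono[OF integrable_norm[OF integrable_bargmann[OF sq]]]) (auto simp: fk)
    also have "\<dots> = C * B R z" by (simp add: gauss.prob_space[simplified])
    finally show ?thesis .
  qed
  define K where "K = (\<lambda>\<epsilon> x y. \<integral>z. bargmann_kernel x z * cnj (bargmann_kernel y z) * of_real (w \<epsilon> z) \<partial>lborel)"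
  define A where "A = (\<lambda>\<epsilon> x. \<integral>y. cnj (\<phi> y) * K \<epsilon> x y \<partial>\<gamma>)"
  have step1: "(\<integral>z. of_real ((cmod (bargmann \<phi> z))\<^sup>2 * w \<epsilon> z) \<partial>lborel) = (\<integral>x. \<phi> x * A \<epsilon> x \<partial>\<gamma>)"
    if e: "0 < \<epsilon>" for \<epsilon>
  proof -
    have "(\<integral>z. of_real ((cmod (bargmann \<phi> z))\<^sup>2 * w \<epsilon> z) \<partial>lborel)
       = (\<integral>z. (\<integral>x. \<phi> x * bargmann_kernel x z * (cnj (bargmann \<phi> z) * of_real (w \<epsilon> z)) \<partial>\<gamma>) \<partial>lborel)"
    proof (rule Bochner_Integration.integral_cong[OF refl])
      fix z
      have "of_real ((cmod (bargmann \<phi> z))\<^sup>2 * w \<epsilon> z) = bargmann \<phi> z * (cnj (bargmann \<phi> z) * of_real (w \<epsilon> z))"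
        by (simp add: complex_norm_square[symmetric] mult.assoc[symmetric])
      also have "\<dots> = (\<integral>x. \<phi> x * bargmann_kernel x z * (cnj (bargmann \<phi> z) * of_real (w \<epsilon> z)) \<partial>\<gamma>)"
        using integrable_bargmann[OF sq] by (simp add: bargmann_def)
      finally show "of_real ((cmod (bargmann \<phi> z))\<^sup>2 * w \<epsilon> z) =
        (\<integral>x. \<phi> x * bargmann_kernel x z * (cnj (bargmann \<phi> z) * of_real (w \<epsilon> z)) \<partial>\<gamma>)" .
    qed
    also have "\<dots> = (\<integral>x. (\<integral>z. \<phi> x * bargmann_kernel x z * (cnj (bargmann \<phi> z) * of_real (w \<epsilon> z)) \<partial>lborel) \<partial>\<gamma>)"
    proof (rule integral_swap_dominated)
      show "finite_measure (\<gamma> :: (real^'n) measure)" "sigma_finite_measure (lborel :: (complex^'n) measure)"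
        by unfold_locales
      show "(\<lambda>(x, z). \<phi> x * bargmann_kernel x z * (cnj (bargmann \<phi> z) * of_real (w \<epsilon> z))) \<in> borel_measurable (\<gamma> \<Otimes>\<^sub>M lborel)"
        by measurable
      show "integrable lborel (\<lambda>z::complex^'n. C\<^sup>2 * exp ((R + R) * norm z - \<epsilon> * (norm z)\<^sup>2))"
        by (intro integrable_mult_right integrable_exp_norm_gaussian e)
      show "cmod (\<phi> x * bargmann_kernel x z * (cnj (bargmann \<phi> z) * of_real (w \<epsilon> z)))
         \<le> C\<^sup>2 * exp ((R + R) * norm z - \<epsilon> * (norm z)\<^sup>2)" for x z
      proof -
        have "cmod (\<phi> x * bargmann_kernel x z * (cnj (bargmann \<phi> z) * of_real (w \<epsilon> z)))
           = cmod (\<phi> x * bargmann_kernel x z) * (cmod (bargmann \<phi> z) * w \<epsilon> z)"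
          using w0 by (simp add: norm_mult)
        also have "\<dots> \<le> (C * B R z) * ((C * B R z) * w \<epsilon> z)"
          by (intro mult_mono fk gb w0 mult_nonneg_nonneg C0 B0 order_refl norm_ge_zero)
        also have "\<dots> = C\<^sup>2 * (B R z * B R z * w \<epsilon> z)" by (simp add: power2_eq_square)
        finally show ?thesis unfolding Bw .
      qed
    qed
    also have "\<dots> = (\<integral>x. \<phi> x * A \<epsilon> x \<partial>\<gamma>)"
    proof (rule Bochner_Integration.integral_cong[OF refl])
      fix x
      have "(\<integral>z. \<phi> x * bargmann_kernel x z * (cnj (bargmann \<phi> z) * of_real (w \<epsilon> z)) \<partial>lborel)
        = \<phi> x * (\<integral>z. bargmann_kernel x z * (cnj (bargmann \<phi> z) * of_real (w \<epsilon> z)) \<partial>lborel)"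
        by (simp add: mult.assoc)
      also have "(\<integral>z. bargmann_kernel x z * (cnj (bargmann \<phi> z) * of_real (w \<epsilon> z)) \<partial>lborel)
        = (\<integral>z. (\<integral>y. cnj (\<phi> y) * (bargmann_kernel x z * cnj (bargmann_kernel y z) * of_real (w \<epsilon> z)) \<partial>\<gamma>) \<partial>lborel)"
      proof (rule Bochner_Integration.integral_cong[OF refl])
        fix z
        have "cnj (bargmann \<phi> z) = (\<integral>y. cnj (\<phi> y * bargmann_kernel y z) \<partial>\<gamma>)"
          unfolding bargmann_def by (rule Bochner_Integration.integral_cnj[symmetric])
        moreover have "integrable \<gamma> (\<lambda>y. cnj (\<phi> y * bargmann_kernel y z))"
          using integrable_bargmann[OF sq] by (simp del: complex_cnj_mult)
        ultimately show "bargmann_kernel x z * (cnj (bargmann \<phi> z) * of_real (w \<epsilon> z)) =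
          (\<integral>y. cnj (\<phi> y) * (bargmann_kernel x z * cnj (bargmann_kernel y z) * of_real (w \<epsilon> z)) \<partial>\<gamma>)"
          by (simp add: mult_ac flip: integral_mult_right_zero integral_mult_left_zero)
      qed
      also have "\<dots> = (\<integral>y. (\<integral>z. cnj (\<phi> y) * (bargmann_kernel x z * cnj (bargmann_kernel y z) * of_real (w \<epsilon> z)) \<partial>lborel) \<partial>\<gamma>)"
      proof (rule integral_swap_dominated)
        show "finite_measure (\<gamma> :: (real^'n) measure)" "sigma_finite_measure (lborel :: (complex^'n) measure)"
          by unfold_locales
        show "(\<lambda>(y, z). cnj (\<phi> y) * (bargmann_kernel x z * cnj (bargmann_kernel y z) * of_real (w \<epsilon> z))) \<in> borel_measurable (\<gamma> \<Otimes>\<^sub>M lborel)"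
          by measurable
        show "integrable lborel (\<lambda>z::complex^'n. C * exp ((R + norm x) * norm z - \<epsilon> * (norm z)\<^sup>2))"
          by (intro integrable_mult_right integrable_exp_norm_gaussian e)
        show "cmod (cnj (\<phi> y) * (bargmann_kernel x z * cnj (bargmann_kernel y z) * of_real (w \<epsilon> z)))
           \<le> C * exp ((R + norm x) * norm z - \<epsilon> * (norm z)\<^sup>2)" for y z
        proof -
          have "cmod (cnj (\<phi> y) * (bargmann_kernel x z * cnj (bargmann_kernel y z) * of_real (w \<epsilon> z)))
             = cmod (\<phi> y * bargmann_kernel y z) * (cmod (bargmann_kernel x z) * w \<epsilon> z)"
            using w0 by (simp add: norm_mult)
          also have "\<dots> \<le> (C * B R z) * (B (norm x) z * w \<epsilon> z)"
            by (intro mult_mono fk kb w0 mult_nonneg_nonneg C0 B0 order_refl norm_ge_zero)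
          also have "\<dots> = C * (B R z * B (norm x) z * w \<epsilon> z)" by simp
          finally show ?thesis unfolding Bw .
        qed
      qed
      also have "\<dots> = A \<epsilon> x" by (simp add: A_def K_def)
      finally show "(\<integral>z. \<phi> x * bargmann_kernel x z * (cnj (bargmann \<phi> z) * of_real (w \<epsilon> z)) \<partial>lborel) = \<phi> x * A \<epsilon> x" .
    qed
    finally show ?thesis .
  qed
  \<comment> \<open>\<open>m \<epsilon>\<close> is the constant of the kernel times the Jacobian of \<open>y = x + sqrt (2 \<epsilon>) u\<close>. The factor
    \<open>exp (- |x - y|\<^sup>2 / (4 \<epsilon>))\<close> has become \<open>exp (- |u|\<^sup>2 / 2)\<close> and is part of \<open>d\<gamma>(u)\<close>; what remains
    of the kernel and of the density at \<open>y\<close> is \<open>E\<close>.\<close>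
  define m where "m = (\<lambda>\<epsilon>. (pi * sqrt (2 / (2 + \<epsilon>))) ^ CARD('n))"
  define E where "E = (\<lambda>\<epsilon> (x::real^'n) y. exp ((norm (x + y))\<^sup>2 / (4 * (2 + \<epsilon>)) - (norm y)\<^sup>2 / 2))"
  have A_eq: "A \<epsilon> x = of_real (m \<epsilon>) * (\<integral>u. cnj (\<phi> (x + sqrt (2 * \<epsilon>) *\<^sub>R u)) * of_real (E \<epsilon> x (x + sqrt (2 * \<epsilon>) *\<^sub>R u)) \<partial>\<gamma>)"
    if e: "0 < \<epsilon>" for \<epsilon> x
  proof -
    define s where "s = sqrt (2 * \<epsilon>)"
    have s: "0 < s" "s\<^sup>2 = 2 * \<epsilon>" using e by (auto simp: s_def)
    define M where "M = (pi / sqrt ((2 + \<epsilon>) * \<epsilon>)) ^ CARD('n)"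
    define k where "k = (\<lambda>y. M * exp ((norm (x + y))\<^sup>2 / (4 * (2 + \<epsilon>)) - (norm (x - y))\<^sup>2 / (4 * \<epsilon>)))"
    have K: "K \<epsilon> x y = of_real (k y)" for y
      unfolding K_def w_def k_def M_def by (rule kernel_product_integral[OF e])
    have sM: "s ^ CARD('n) * M = m \<epsilon>"
      using e by (simp add: s_def M_def m_def power_mult_distrib[symmetric] real_sqrt_mult real_sqrt_divide mult.commute[of pi])
    have "A \<epsilon> x = (\<integral>y. gauss_density y *\<^sub>R (cnj (\<phi> y) * of_real (k y)) \<partial>lborel)"
      unfolding A_def K k_def by (rule integral_gauss) measurable
    also have "\<dots> = of_real (s ^ DIM(real^'n)) * (\<integral>u. gauss_density (x + s *\<^sub>R u) *\<^sub>R (cnj (\<phi> (x + s *\<^sub>R u)) * of_real (k (x + s *\<^sub>R u))) \<partial>lborel)"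
      unfolding k_def by (rule integral_lborel_affine[OF _ s(1)]) measurable
    also have "(\<lambda>u. gauss_density (x + s *\<^sub>R u) *\<^sub>R (cnj (\<phi> (x + s *\<^sub>R u)) * of_real (k (x + s *\<^sub>R u))))
        = (\<lambda>u. of_real M * (gauss_density u *\<^sub>R (cnj (\<phi> (x + s *\<^sub>R u)) * of_real (E \<epsilon> x (x + s *\<^sub>R u)))))"
    proof
      fix u
      have "(norm (x - (x + s *\<^sub>R u)))\<^sup>2 / (4 * \<epsilon>) = (norm u)\<^sup>2 / 2"
        using s e by (simp add: power_mult_distrib)
      then have "gauss_density (x + s *\<^sub>R u) * k (x + s *\<^sub>R u) = M * (gauss_density u * E \<epsilon> x (x + s *\<^sub>R u))"
        unfolding k_def E_def gauss_density_def by (simp add: mult_exp_exp algebra_simps)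
      then show "gauss_density (x + s *\<^sub>R u) *\<^sub>R (cnj (\<phi> (x + s *\<^sub>R u)) * of_real (k (x + s *\<^sub>R u)))
        = of_real M * (gauss_density u *\<^sub>R (cnj (\<phi> (x + s *\<^sub>R u)) * of_real (E \<epsilon> x (x + s *\<^sub>R u))))"
        unfolding scaleR_conv_of_real by (metis (no_types, lifting) of_real_mult mult.assoc mult.left_commute)
    qed
    also have "(\<integral>u. of_real M * (gauss_density u *\<^sub>R (cnj (\<phi> (x + s *\<^sub>R u)) * of_real (E \<epsilon> x (x + s *\<^sub>R u)))) \<partial>lborel)
        = of_real M * (\<integral>u. cnj (\<phi> (x + s *\<^sub>R u)) * of_real (E \<epsilon> x (x + s *\<^sub>R u)) \<partial>\<gamma>)"
    proof -
      have q: "(\<lambda>u. cnj (\<phi> (x + s *\<^sub>R u)) * of_real (E \<epsilon> x (x + s *\<^sub>R u))) \<in> borel_measurable borel"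
        unfolding E_def by measurable
      show ?thesis unfolding integral_gauss[OF q] by (rule integral_mult_right_zero)
    qed
    finally show ?thesis
      unfolding sM[symmetric] s_def[symmetric] by (simp add: mult.assoc)
  qed
  \<comment> \<open>A bound independent of \<open>\<epsilon>\<close> and \<open>y\<close>, hence of \<open>u\<close>.\<close>
  have Eb: "cmod (cnj (\<phi> y) * of_real (E \<epsilon> x y)) \<le> C * exp ((norm x)\<^sup>2 / 4)" if e: "0 < \<epsilon>" for \<epsilon> x y
  proof -
    have "(norm (x + y))\<^sup>2 \<le> (norm x + norm y)\<^sup>2" by (intro power_mono norm_triangle_ineq) simp
    also have "\<dots> \<le> 2 * (norm x)\<^sup>2 + 2 * (norm y)\<^sup>2"
      using sum_squares_bound[of "norm x" "norm y"] by (simp add: power2_sum)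
    finally have "(norm (x + y))\<^sup>2 / 8 \<le> (norm x)\<^sup>2 / 4 + (norm y)\<^sup>2 / 4" by simp
    moreover have "(norm (x + y))\<^sup>2 / (4 * (2 + \<epsilon>)) \<le> (norm (x + y))\<^sup>2 / 8"
      using e by (intro divide_left_mono) auto
    ultimately have "(norm (x + y))\<^sup>2 / (4 * (2 + \<epsilon>)) - (norm y)\<^sup>2 / 2 \<le> (norm x)\<^sup>2 / 4"
      using zero_le_power2[of "norm y"] by linarith
    then have "E \<epsilon> x y \<le> exp ((norm x)\<^sup>2 / 4)"
      unfolding E_def exp_le_cancel_iff .
    then show ?thesis
      unfolding norm_mult using C0 C[of y] by (intro mult_mono) (auto simp: E_def)
  qed
  define \<epsilon> where "\<epsilon> = (\<lambda>k::nat. 1 / real (Suc k))"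
  have e: "0 < \<epsilon> k" for k by (simp add: \<epsilon>_def)
  have e0: "\<epsilon> \<longlonglongrightarrow> 0" using LIMSEQ_inverse_real_of_nat by (simp add: \<epsilon>_def inverse_eq_divide)
  have m0: "0 \<le> m (\<epsilon> k)" "m (\<epsilon> k) \<le> pi ^ CARD('n)" for k
  proof -
    have "sqrt (2 / (2 + \<epsilon> k)) \<le> 1" using e[of k] by simp
    then show "m (\<epsilon> k) \<le> pi ^ CARD('n)" unfolding m_def using e[of k] by (intro power_mono) (auto simp: mult_left_le)
  qed (use e[of k] in \<open>simp add: m_def\<close>)
  have m_lim: "(\<lambda>k. m (\<epsilon> k)) \<longlonglongrightarrow> pi ^ CARD('n)"
  proof -
    have "(\<lambda>k. m (\<epsilon> k)) \<longlonglongrightarrow> (pi * sqrt (2 / (2 + 0))) ^ CARD('n)"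
      unfolding m_def by (intro tendsto_intros e0) auto
    then show ?thesis by simp
  qed
  have A_lim: "(\<lambda>k. A (\<epsilon> k) x) \<longlonglongrightarrow> of_real (pi ^ CARD('n)) * cnj (\<phi> x)" for x
  proof -
    let ?y = "\<lambda>k u. x + sqrt (2 * \<epsilon> k) *\<^sub>R u"
    have "(\<lambda>k. \<integral>u. cnj (\<phi> (?y k u)) * of_real (E (\<epsilon> k) x (?y k u)) \<partial>\<gamma>)
        \<longlonglongrightarrow> (\<integral>u. cnj (\<phi> x) \<partial>(\<gamma> :: (real^'n) measure))"
    proof (rule integral_dominated_convergence[where w = "\<lambda>_. C * exp ((norm x)\<^sup>2 / 4)"])
      show "AE u in \<gamma>. (\<lambda>k. cnj (\<phi> (?y k u)) * of_real (E (\<epsilon> k) x (?y k u))) \<longlonglongrightarrow> cnj (\<phi> x)"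
      proof (rule AE_I2)
        fix u :: "real^'n"
        have y: "(\<lambda>k. ?y k u) \<longlonglongrightarrow> x + sqrt (2 * 0) *\<^sub>R u" by (intro tendsto_intros e0)
        then have "(\<lambda>k. \<phi> (?y k u)) \<longlonglongrightarrow> \<phi> x"
          using continuous_on_tendsto_compose[OF cont, of "\<lambda>k. ?y k u" x] by simp
        moreover have "(\<lambda>k. E (\<epsilon> k) x (?y k u)) \<longlonglongrightarrow> exp ((norm (x + (x + sqrt (2 * 0) *\<^sub>R u)))\<^sup>2 / (4 * (2 + 0)) - (norm (x + sqrt (2 * 0) *\<^sub>R u))\<^sup>2 / 2)"
          unfolding E_def by (intro tendsto_intros e0) auto
        moreover have "exp ((norm (x + (x + sqrt (2 * 0) *\<^sub>R u)))\<^sup>2 / (4 * (2 + 0)) - (norm (x + sqrt (2 * 0) *\<^sub>R u))\<^sup>2 / 2) = 1"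
          by (simp add: scaleR_2[symmetric] power_mult_distrib)
        ultimately have "(\<lambda>k. cnj (\<phi> (?y k u)) * of_real (E (\<epsilon> k) x (?y k u))) \<longlonglongrightarrow> cnj (\<phi> x) * of_real 1"
          by (intro tendsto_intros) auto
        then show "(\<lambda>k. cnj (\<phi> (?y k u)) * of_real (E (\<epsilon> k) x (?y k u))) \<longlonglongrightarrow> cnj (\<phi> x)" by simp
      qed
      show "AE u in \<gamma>. norm (cnj (\<phi> (?y k u)) * of_real (E (\<epsilon> k) x (?y k u))) \<le> C * exp ((norm x)\<^sup>2 / 4)" for k
        by (intro AE_I2 Eb e)
      show "(\<lambda>u. cnj (\<phi> (?y k u)) * of_real (E (\<epsilon> k) x (?y k u))) \<in> borel_measurable \<gamma>" for k
        unfolding E_def by measurable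
    qed auto
    then have "(\<lambda>k. A (\<epsilon> k) x) \<longlonglongrightarrow> of_real (pi ^ CARD('n)) * (\<integral>u. cnj (\<phi> x) \<partial>(\<gamma> :: (real^'n) measure))"
      unfolding A_eq[OF e] by (intro tendsto_intros m_lim)
    then show ?thesis by (simp add: gauss.prob_space[simplified])
  qed
  have A_b: "cmod (\<phi> x * A (\<epsilon> k) x) \<le> C * (pi ^ CARD('n) * (C * exp (R\<^sup>2 / 4)))" for k x
  proof (cases "\<phi> x = 0")
    case False
    let ?y = "\<lambda>u. x + sqrt (2 * \<epsilon> k) *\<^sub>R u"
    have "cmod (\<integral>u. cnj (\<phi> (?y u)) * of_real (E (\<epsilon> k) x (?y u)) \<partial>\<gamma>) \<le> (\<integral>u. C * exp ((norm x)\<^sup>2 / 4) \<partial>(\<gamma> :: (real^'n) measure))"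
      by (rule order_trans[OF integral_norm_bound integral_mono'])
        (simp_all only: integrable_const Eb[OF e], simp_all add: C0)
    also have "\<dots> = C * exp ((norm x)\<^sup>2 / 4)" by (simp add: gauss.prob_space[simplified])
    also have "\<dots> \<le> C * exp (R\<^sup>2 / 4)"
      using R(2)[OF False] C0 by (intro mult_left_mono) (auto intro!: power_mono)
    finally have "cmod (A (\<epsilon> k) x) \<le> pi ^ CARD('n) * (C * exp (R\<^sup>2 / 4))"
      unfolding A_eq[OF e] norm_mult using m0[of k] by (intro mult_mono) auto
    then show ?thesis unfolding norm_mult using C[of x] C0 by (intro mult_mono) auto
  qed (use C0 in simp)
  have Am: "(\<lambda>x. \<phi> x * A (\<epsilon> k) x) \<in> borel_measurable \<gamma>" for k
    unfolding A_eq[OF e] E_def by measurable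
  have "(\<lambda>k. \<integral>x. \<phi> x * A (\<epsilon> k) x \<partial>\<gamma>) \<longlonglongrightarrow> (\<integral>x. \<phi> x * (of_real (pi ^ CARD('n)) * cnj (\<phi> x)) \<partial>\<gamma>)"
  proof (rule integral_dominated_convergence[where w = "\<lambda>_. C * (pi ^ CARD('n) * (C * exp (R\<^sup>2 / 4)))"])
    show "AE x in \<gamma>. (\<lambda>k. \<phi> x * A (\<epsilon> k) x) \<longlonglongrightarrow> \<phi> x * (of_real (pi ^ CARD('n)) * cnj (\<phi> x))"
      by (intro AE_I2 tendsto_mult tendsto_const A_lim)
    show "AE x in \<gamma>. norm (\<phi> x * A (\<epsilon> k) x) \<le> C * (pi ^ CARD('n) * (C * exp (R\<^sup>2 / 4)))" for k
      by (intro AE_I2 A_b)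
  qed (use Am in auto)
  also have "(\<integral>x. \<phi> x * (of_real (pi ^ CARD('n)) * cnj (\<phi> x)) \<partial>\<gamma>)
      = (\<integral>x. of_real (pi ^ CARD('n) * (cmod (\<phi> x))\<^sup>2) \<partial>\<gamma>)"
    by (rule Bochner_Integration.integral_cong[OF refl]) (simp only: of_real_mult complex_norm_square mult_ac)
  also have "\<dots> = of_real (pi ^ CARD('n) * (l2norm \<gamma> \<phi>)\<^sup>2)"
    by (simp only: integral_complex_of_real l2norm_sq integral_mult_right_zero)
  finally have lim1: "(\<lambda>k. \<integral>z. complex_of_real ((cmod (bargmann \<phi> z))\<^sup>2 * w (\<epsilon> k) z) \<partial>lborel) \<longlonglongrightarrow> of_real (pi ^ CARD('n) * (l2norm \<gamma> \<phi>)\<^sup>2)"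
    unfolding step1[OF e] .
  then have lim: "(\<lambda>k. \<integral>z. (cmod (bargmann \<phi> z))\<^sup>2 * w (\<epsilon> k) z \<partial>lborel) \<longlonglongrightarrow> pi ^ CARD('n) * (l2norm \<gamma> \<phi>)\<^sup>2"
    unfolding integral_complex_of_real tendsto_of_real_iff .
  have "has_bochner_integral lborel (\<lambda>z. (cmod (bargmann \<phi> z))\<^sup>2 * w 0 z) (pi ^ CARD('n) * (l2norm \<gamma> \<phi>)\<^sup>2)"
  proof (rule has_bochner_integral_monotone_convergence[OF _ _ _ lim])
    show "integrable lborel (\<lambda>z. (cmod (bargmann \<phi> z))\<^sup>2 * w (\<epsilon> k) z)" for k
    proof (rule Bochner_Integration.integrable_bound)
      show "integrable lborel (\<lambda>z::complex^'n. C\<^sup>2 * exp ((R + R) * norm z - \<epsilon> k * (norm z)\<^sup>2))"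
        by (intro integrable_mult_right integrable_exp_norm_gaussian e)
      have "(cmod (bargmann \<phi> z))\<^sup>2 * w (\<epsilon> k) z \<le> C\<^sup>2 * exp ((R + R) * norm z - \<epsilon> k * (norm z)\<^sup>2)" for z
      proof -
        have "(cmod (bargmann \<phi> z))\<^sup>2 * w (\<epsilon> k) z \<le> (C * B R z)\<^sup>2 * w (\<epsilon> k) z"
          by (intro mult_right_mono power_mono gb w0) simp
        also have "\<dots> = C\<^sup>2 * (B R z * B R z * w (\<epsilon> k) z)" by (simp add: power2_eq_square)
        finally show ?thesis unfolding Bw .
      qed
      then show "AE z in lborel. norm ((cmod (bargmann \<phi> z))\<^sup>2 * w (\<epsilon> k) z) \<le> norm (C\<^sup>2 * exp ((R + R) * norm z - \<epsilon> k * (norm z)\<^sup>2))"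
        using w0 by (intro AE_I2) simp
    qed measurable
    show "AE z in lborel. mono (\<lambda>k. (cmod (bargmann \<phi> z))\<^sup>2 * w (\<epsilon> k) z)"
    proof (intro AE_I2 monoI mult_left_mono)
      fix z :: "complex^'n" and i j :: nat assume "i \<le> j"
      then have "\<epsilon> j \<le> \<epsilon> i" by (auto simp: \<epsilon>_def intro!: divide_left_mono)
      then show "w (\<epsilon> i) z \<le> w (\<epsilon> j) z" by (auto simp: w_def intro!: mult_right_mono)
    qed simp
    show "AE z in lborel. (\<lambda>k. (cmod (bargmann \<phi> z))\<^sup>2 * w (\<epsilon> k) z) \<longlonglongrightarrow> (cmod (bargmann \<phi> z))\<^sup>2 * w 0 z"
      unfolding w_def by (intro AE_I2 tendsto_intros e0)
  qed measurable
  then show ?thesis by (simp add: w_def)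
qed

lemma has_bochner_integral_fock_iff:
  fixes f :: "complex^'n::finite \<Rightarrow> real"
  assumes "f \<in> borel_measurable borel"
  shows "has_bochner_integral fock_measure f I \<longleftrightarrow>
    has_bochner_integral lborel (\<lambda>z. f z * exp (- (norm z)\<^sup>2)) (pi ^ CARD('n) * I)"
proof -
  have "has_bochner_integral fock_measure f I \<longleftrightarrow>
     has_bochner_integral lborel (\<lambda>z. (exp (- (norm z)\<^sup>2) / pi ^ CARD('n)) *\<^sub>R f z) I"
    unfolding fock_measure_def has_bochner_integral_iff using assms
    by (subst integrable_density integral_density; simp)+
  also have "\<dots> \<longleftrightarrow> has_bochner_integral lborel (\<lambda>z. f z * exp (- (norm z)\<^sup>2)) (pi ^ CARD('n) * I)"
    (is "?l \<longleftrightarrow> ?r")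
  proof
    assume ?l
    from has_bochner_integral_mult_right[OF this, of "pi ^ CARD('n)"] show ?r
      by (simp add: mult.commute)
  next
    assume ?r
    from has_bochner_integral_mult_right[OF this, of "1 / pi ^ CARD('n)"] show ?l
      by (simp add: mult.commute)
  qed
  finally show ?thesis .
qed

lemma bargmann_test_function:
  assumes "\<phi> \<in> test_functions"
  shows "square_integrable fock_measure (bargmann \<phi>)" "l2norm fock_measure (bargmann \<phi>) = l2norm \<gamma> \<phi>"
proof -
  have t: "tame \<phi>" using assms by (rule test_function_tame)
  have c: "continuous_on A \<phi>" for A using t by (intro smooth_continuous tame_smooth)
  have k: "compact (closure {x. \<phi> x \<noteq> 0})" using assms by (simp add: test_functions_def)
  obtain R where R: "\<And>x. x \<in> closure {x. \<phi> x \<noteq> 0} \<Longrightarrow> norm x \<le> R"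
    using compact_imp_bounded[OF k] unfolding bounded_iff by auto
  obtain C where C: "\<And>x. x \<in> closure {x. \<phi> x \<noteq> 0} \<Longrightarrow> cmod (\<phi> x) \<le> C"
    using compact_imp_bounded[OF compact_continuous_image[OF c k]] unfolding bounded_iff by auto
  have "has_bochner_integral lborel (\<lambda>z. (cmod (bargmann \<phi> z))\<^sup>2 * exp (- (norm z)\<^sup>2))
    (pi ^ CARD('a) * (l2norm \<gamma> \<phi>)\<^sup>2)"
  proof (rule bargmann_test_function_norm[OF c, of "\<bar>R\<bar>" "\<bar>C\<bar>"])
    show "norm x \<le> \<bar>R\<bar>" if "\<phi> x \<noteq> 0" for x
      using R[of x] closure_subset[of "{x. \<phi> x \<noteq> 0}"] that by auto
    show "cmod (\<phi> x) \<le> \<bar>C\<bar>" for x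
      using C[of x] closure_subset[of "{x. \<phi> x \<noteq> 0}"] by (cases "\<phi> x = 0") auto
  qed simp
  moreover have m: "bargmann \<phi> \<in> borel_measurable borel"
    using t by (intro bargmann_measurable tame_square_integrable)
  ultimately have "has_bochner_integral fock_measure (\<lambda>z. (cmod (bargmann \<phi> z))\<^sup>2) ((l2norm \<gamma> \<phi>)\<^sup>2)"
    by (subst has_bochner_integral_fock_iff) auto
  with m show "square_integrable fock_measure (bargmann \<phi>)" "l2norm fock_measure (bargmann \<phi>) = l2norm \<gamma> \<phi>"
    by (auto simp: square_integrable_def has_bochner_integral_iff l2norm_def[of fock_measure] l2norm_nonneg)
qed

section \<open>Locally uniform limits of separately holomorphic functions\<close>

text \<open>
  Unlike complex differentiability in all variables together, this property is inherited by partial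
  derivatives through a one-variable Cauchy integral; so every iterated partial derivative of an
  entire function has it.
\<close>

definition separately_holomorphic :: "(complex^'n::finite \<Rightarrow> complex) \<Rightarrow> bool" where
  "separately_holomorphic F \<longleftrightarrow>
     continuous_on UNIV F \<and> (\<forall>z j. (\<lambda>w. F (z + axis j w)) holomorphic_on UNIV)"

lemma continuous_axis[continuous_intros]:
  "continuous_on A f \<Longrightarrow> continuous_on A (\<lambda>x. axis j (f x) :: 'a::real_normed_vector^'n)"
  unfolding axis_def
proof (rule continuous_on_vec_lambda)
  show "continuous_on A f \<Longrightarrow> continuous_on A (\<lambda>x. if i = j then f x else 0)" for i
    by (cases "i = j") auto
qed

lemma entire_separately_holomorphic:
  assumes "entire F"
  shows "separately_holomorphic F"
  unfolding separately_holomorphic_def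
proof (intro conjI allI)
  show "continuous_on UNIV F" using assms by (rule entire_continuous)
  fix z :: "complex^'a" and j
  show "(\<lambda>w. F (z + axis j w)) holomorphic_on UNIV"
    unfolding holomorphic_on_def field_differentiable_def
  proof
    fix w
    obtain D where "(F has_derivative D) (at (z + axis j w))" "\<And>c v. D (c *s v) = c * D v"
      using assms unfolding entire_def by blast
    from has_derivative_line[OF this] show "\<exists>f'. ((\<lambda>w. F (z + axis j w)) has_field_derivative f') (at w within UNIV)"
      by auto
  qed
qed

lemma axis_add: "axis j (a + b) = axis j a + axis j (b :: 'a::monoid_add)"
  by (simp add: vec_eq_iff axis_def)

lemma cpartial_has_field_derivative:
  assumes "separately_holomorphic F"
  shows "((\<lambda>w. F (z + axis j w)) has_field_derivative cpartial j F (z + axis j w)) (at w)"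
proof -
  have "(\<lambda>w. F (z + axis j w)) field_differentiable (at w)"
    using assms unfolding separately_holomorphic_def holomorphic_on_def by auto
  then have "((\<lambda>w. F (z + axis j w)) has_field_derivative deriv (\<lambda>w. F (z + axis j w)) w) (at w)"
    by (simp add: field_differentiable_derivI)
  moreover have "deriv (\<lambda>w. F (z + axis j w)) w = cpartial j F (z + axis j w)"
    unfolding cpartial_def by (subst deriv_shift_0) (simp add: o_def axis_add add.assoc)
  ultimately show ?thesis by simp
qed

text \<open>
  Cauchy's formula on the unit circle, parametrised by \<open>t\<close>. It exhibits the partial derivative as a
  parameter integral of \<open>F\<close> itself, from which both its continuity and its holomorphy follow.
\<close>

lemma cpartial_integral:
  assumes F: "separately_holomorphic F"
  shows "cpartial j F z = integral (cbox 0 1) (\<lambda>t. F (z + axis j (exp (2 * of_real pi * \<i> * of_real t))) * exp (- (2 * of_real pi * \<i> * of_real t)))"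
proof -
  let ?g = "\<lambda>w. F (z + axis j w)"
  have h: "?g holomorphic_on UNIV" using F by (simp add: separately_holomorphic_def)
  have "(?g has_field_derivative (1 / (2 * of_real pi * \<i>) * contour_integral (circlepath 0 1) (\<lambda>u. ?g u / (u - 0)\<^sup>2))) (at 0)"
    by (rule Cauchy_derivative_integral_circlepath)
      (use h in \<open>auto intro: holomorphic_on_subset holomorphic_on_imp_continuous_on\<close>)
  then have "cpartial j F z = 1 / (2 * of_real pi * \<i>) * contour_integral (circlepath 0 1) (\<lambda>u. ?g u / (u - 0)\<^sup>2)"
    unfolding cpartial_def by (rule DERIV_imp_deriv)
  also have "\<dots> = integral {0..1} (\<lambda>t. 1 / (2 * of_real pi * \<i>) * (?g (circlepath 0 1 t) / (circlepath 0 1 t)\<^sup>2 * vector_derivative (circlepath 0 1) (at t)))"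
    by (simp only: contour_integral_integral Henstock_Kurzweil_Integration.integral_mult_right diff_zero)
  also have "\<dots> = integral {0..1} (\<lambda>t. F (z + axis j (exp (2 * of_real pi * \<i> * of_real t))) * exp (- (2 * of_real pi * \<i> * of_real t)))"
  proof (rule Henstock_Kurzweil_Integration.integral_cong)
    fix t :: real assume t: "t \<in> {0..1}"
    show "1 / (2 * of_real pi * \<i>) * (?g (circlepath 0 1 t) / (circlepath 0 1 t)\<^sup>2 * vector_derivative (circlepath 0 1) (at t))
      = F (z + axis j (exp (2 * of_real pi * \<i> * of_real t))) * exp (- (2 * of_real pi * \<i> * of_real t))"
      unfolding vector_derivative_circlepath
      by (simp add: circlepath exp_minus power2_eq_square field_simps)
  qed
  finally show ?thesis by (simp add: cbox_interval)
qed

lemma separately_holomorphic_cpartial: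
  assumes F: "separately_holomorphic F"
  shows "separately_holomorphic (cpartial j F)"
proof -
  have cF: "continuous_on A F" for A
    using F by (auto simp: separately_holomorphic_def intro: continuous_on_subset)
  have cc: "continuous_on UNIV (cpartial i F)" for i
  proof -
    have "continuous_on UNIV (\<lambda>z. integral (cbox 0 1) (\<lambda>t. F (z + axis i (exp (2 * of_real pi * \<i> * of_real t))) * exp (- (2 * of_real pi * \<i> * of_real t))))"
      by (rule integral_continuous_on_param)
        (auto simp: case_prod_beta' intro!: continuous_intros continuous_on_compose2[OF cF[of UNIV]])
    then show ?thesis by (simp add: cpartial_integral[OF F, abs_def])
  qed
  have "(\<lambda>w. cpartial j F (z + axis i w)) holomorphic_on UNIV" for z i
  proof -
    let ?e = "\<lambda>t. exp (2 * of_real pi * \<i> * of_real t)"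
    let ?e' = "\<lambda>t. exp (- (2 * of_real pi * \<i> * of_real t))"
    have "(\<lambda>w. integral (cbox 0 1) (\<lambda>t. F (z + axis i w + axis j (?e t)) * ?e' t)) holomorphic_on UNIV"
    proof (rule leibniz_rule_holomorphic[where fx = "\<lambda>w t. cpartial i F (z + axis j (?e t) + axis i w) * ?e' t"])
      fix w and t :: real
      have "((\<lambda>w. F (z + axis j (?e t) + axis i w) * ?e' t) has_field_derivative cpartial i F (z + axis j (?e t) + axis i w) * ?e' t) (at w)"
        by (intro DERIV_cmult_right cpartial_has_field_derivative F)
      then show "((\<lambda>w. F (z + axis i w + axis j (?e t)) * ?e' t) has_field_derivative cpartial i F (z + axis j (?e t) + axis i w) * ?e' t) (at w within UNIV)"
        by (simp add: ac_simps)
    next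
      fix w
      show "(\<lambda>t. F (z + axis i w + axis j (?e t)) * ?e' t) integrable_on cbox 0 1"
        by (intro integrable_continuous) (auto intro!: continuous_intros continuous_on_compose2[OF cF[of UNIV]])
    next
      show "continuous_on (UNIV \<times> cbox 0 1) (\<lambda>(w, t). cpartial i F (z + axis j (?e t) + axis i w) * ?e' t)"
        by (auto simp: case_prod_beta' intro!: continuous_intros continuous_on_compose2[OF cc])
    qed simp
    then show ?thesis by (simp add: cpartial_integral[OF F])
  qed
  with cc show ?thesis by (simp add: separately_holomorphic_def)
qed

lemma separately_holomorphic_foldr: "separately_holomorphic F \<Longrightarrow> separately_holomorphic (foldr cpartial js F)"
  by (induction js) (auto intro: separately_holomorphic_cpartial)

lemma cpartial_diff:
  assumes "separately_holomorphic F" "separately_holomorphic G"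
  shows "cpartial j (\<lambda>z. F z - G z) z = cpartial j F z - cpartial j G z"
proof -
  have "((\<lambda>w. F (z + axis j w) - G (z + axis j w)) has_field_derivative cpartial j F (z + axis j 0) - cpartial j G (z + axis j 0)) (at 0)"
    by (intro DERIV_diff cpartial_has_field_derivative assms)
  then show ?thesis
    unfolding cpartial_def[of j "\<lambda>z. F z - G z"] by (simp add: DERIV_imp_deriv axis_eq_0_iff[THEN iffD2])
qed

lemma separately_holomorphic_diff:
  "separately_holomorphic F \<Longrightarrow> separately_holomorphic G \<Longrightarrow> separately_holomorphic (\<lambda>z. F z - G z)"
  by (auto simp: separately_holomorphic_def intro!: continuous_intros holomorphic_intros)

lemma foldr_cpartial_diff:
  assumes "separately_holomorphic F" "separately_holomorphic G"
  shows "foldr cpartial js (\<lambda>z. F z - G z) = (\<lambda>z. foldr cpartial js F z - foldr cpartial js G z)"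
proof (induction js)
  case (Cons j js)
  show ?case
    unfolding foldr.simps o_apply Cons
    by (intro ext cpartial_diff separately_holomorphic_foldr assms)
qed simp

lemma norm_cpartial_le:
  assumes F: "separately_holomorphic F" and B: "\<And>u. cmod u = 1 \<Longrightarrow> cmod (F (z + axis j u)) \<le> B"
  shows "cmod (cpartial j F z) \<le> B"
proof -
  have h: "(\<lambda>w. F (z + axis j w)) holomorphic_on A" for A
    using F by (auto simp: separately_holomorphic_def intro: holomorphic_on_subset)
  have "cmod ((deriv ^^ 1) (\<lambda>w. F (z + axis j w)) 0) \<le> fact 1 * B / 1 ^ 1"
    by (rule Cauchy_inequality[OF h holomorphic_on_imp_continuous_on[OF h]]) (use B in auto)
  then show ?thesis by (simp add: cpartial_def)
qed

lemma norm_axis_eq: "norm (axis j (u::'a::real_normed_vector) :: 'a^'n) = norm u"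
  by (simp add: norm_vec_def axis_def L2_set_def if_distrib[of norm] if_distrib[of "\<lambda>x. x\<^sup>2"] cong: if_cong)

text \<open>
  Each differentiation costs one unit of radius in Cauchy's estimate; this is harmless because the
  convergence is assumed on all balls.
\<close>

lemma foldr_cpartial_uniform_limit:
  assumes F: "\<And>k. separately_holomorphic (F k)" "separately_holomorphic G"
    and lim: "\<And>R. uniform_limit (cball 0 R) F G sequentially"
  shows "uniform_limit (cball 0 R) (\<lambda>k. foldr cpartial js (F k)) (foldr cpartial js G) sequentially"
proof (induction js arbitrary: R)
  case Nil
  show ?case using lim[of R] by simp
next
  case (Cons j js)
  let ?F = "\<lambda>k. foldr cpartial js (F k)" and ?G = "foldr cpartial js G"
  have s: "separately_holomorphic (?F k)" "separately_holomorphic ?G" for k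
    by (intro separately_holomorphic_foldr F)+
  show ?case
    unfolding uniform_limit_iff
  proof (intro allI impI)
    fix e :: real assume e: "e > 0"
    have "\<forall>\<^sub>F k in sequentially. \<forall>z\<in>cball 0 (R + 1). dist (?F k z) (?G z) < e / 2"
      using Cons[of "R + 1"] e unfolding uniform_limit_iff by (auto elim!: allE[of _ "e/2"])
    then show "\<forall>\<^sub>F k in sequentially. \<forall>z\<in>cball 0 R. dist (foldr cpartial (j # js) (F k) z) (foldr cpartial (j # js) G z) < e"
    proof (rule eventually_mono, intro ballI)
      fix k and z :: "complex^'a" assume H: "\<forall>z\<in>cball 0 (R + 1). dist (?F k z) (?G z) < e / 2" and z: "z \<in> cball 0 R"
      have "cmod (cpartial j (\<lambda>z. ?F k z - ?G z) z) \<le> e / 2"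
      proof (rule norm_cpartial_le[OF separately_holomorphic_diff[OF s]])
        fix u :: complex assume u: "cmod u = 1"
        have "norm (z + axis j u) \<le> R + 1"
          using norm_triangle_ineq[of z "axis j u"] z u by (simp add: norm_axis_eq)
        then have "dist (?F k (z + axis j u)) (?G (z + axis j u)) < e / 2"
          by (intro H[rule_format]) simp
        then show "cmod (?F k (z + axis j u) - ?G (z + axis j u)) \<le> e / 2"
          unfolding dist_norm by (rule less_imp_le)
      qed
      then show "dist (foldr cpartial (j # js) (F k) z) (foldr cpartial (j # js) G z) < e"
        using e by (simp add: dist_norm cpartial_diff[OF s])
    qed
  qed
qed

lemma l2norm_kernel_bounded:
  "\<exists>B\<ge>0. \<forall>z\<in>cball (0::complex^'n::finite) R. l2norm \<gamma> (\<lambda>x. bargmann_kernel x z) \<le> B"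
proof -
  define r where "r = \<bar>R\<bar>"
  have sq: "square_integrable \<gamma> (\<lambda>x::real^'n. of_real (exp (r\<^sup>2 / 2) * exp (r * norm x)))"
    by (rule exp_bounded_square_integrable[OF exp_boundedI[of _ "exp (r\<^sup>2 / 2)" r]]) (simp_all add: norm_mult)
  show ?thesis
  proof (intro exI[of _ "l2norm \<gamma> (\<lambda>x::real^'n. of_real (exp (r\<^sup>2 / 2) * exp (r * norm x)))"] conjI ballI l2norm_nonneg)
    fix z :: "complex^'n" assume "z \<in> cball 0 R"
    then have z: "norm z \<le> r" by (simp add: r_def)
    show "l2norm \<gamma> (\<lambda>x. bargmann_kernel x z) \<le> l2norm \<gamma> (\<lambda>x::real^'n. of_real (exp (r\<^sup>2 / 2) * exp (r * norm x)))"
      unfolding l2norm_def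
    proof (intro real_sqrt_le_mono integral_mono square_integrable_sq[OF sq] square_integrable_sq[OF square_integrable_kernel] power_mono)
      fix x :: "real^'n"
      have "cmod (bargmann_kernel x z) \<le> exp ((norm z)\<^sup>2 / 2) * exp (norm z * norm x)" by (rule norm_kernel_le)
      also have "\<dots> \<le> exp (r\<^sup>2 / 2) * exp (r * norm x)"
        using z by (intro mult_mono) (auto intro!: power_mono mult_right_mono)
      finally show "cmod (bargmann_kernel x z) \<le> cmod (of_real (exp (r\<^sup>2 / 2) * exp (r * norm x)))" by (simp add: norm_mult)
    qed simp
  qed
qed

lemma bargmann_uniform_limit:
  assumes f: "\<And>k. square_integrable \<gamma> (f k)" "square_integrable \<gamma> g"
    and lim: "(\<lambda>k. l2norm \<gamma> (\<lambda>x. f k x - g x)) \<longlonglongrightarrow> 0"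
  shows "uniform_limit (cball 0 R) (\<lambda>k. bargmann (f k)) (bargmann g) sequentially"
proof -
  obtain B where B: "B \<ge> 0" "\<And>z. z \<in> cball 0 R \<Longrightarrow> l2norm \<gamma> (\<lambda>x::real^'a. bargmann_kernel x z) \<le> B"
    using l2norm_kernel_bounded[of R] by blast
  have "(\<lambda>k. l2norm \<gamma> (\<lambda>x. f k x - g x) * B) \<longlonglongrightarrow> 0"
    using tendsto_mult_right[OF lim, of B] by simp
  show ?thesis
    unfolding uniform_limit_iff
  proof (intro allI impI)
    fix e :: real assume "e > 0"
    then have "\<forall>\<^sub>F k in sequentially. l2norm \<gamma> (\<lambda>x. f k x - g x) * B < e"
      using \<open>(\<lambda>k. l2norm \<gamma> (\<lambda>x. f k x - g x) * B) \<longlonglongrightarrow> 0\<close> by (auto dest: order_tendstoD(2))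
    then show "\<forall>\<^sub>F k in sequentially. \<forall>z\<in>cball 0 R. dist (bargmann (f k) z) (bargmann g z) < e"
    proof (rule eventually_mono, intro ballI)
      fix k and z :: "complex^'a" assume H: "l2norm \<gamma> (\<lambda>x. f k x - g x) * B < e" and z: "z \<in> cball 0 R"
      have "dist (bargmann (f k) z) (bargmann g z) = cmod (bargmann (\<lambda>x. f k x - g x) z)"
        by (simp add: dist_norm bargmann_diff f)
      also have "\<dots> \<le> l2norm \<gamma> (\<lambda>x. f k x - g x) * B"
        by (rule order_trans[OF norm_bargmann_le]) (auto intro!: square_integrable_diff f mult_left_mono B z l2norm_nonneg)
      finally show "dist (bargmann (f k) z) (bargmann g z) < e" using H by linarith
    qed
  qed
qed

text \<open>
  Evaluation of \<open>G\<close> at \<open>z\<close> is bounded on \<open>L\<^sup>2(\<gamma>)\<close>, locally uniformly in \<open>z\<close>.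
\<close>

lemma foldr_cpartial_bargmann_tendsto:
  assumes "\<And>k. square_integrable \<gamma> (f k)" "square_integrable \<gamma> g"
    and "(\<lambda>k. l2norm \<gamma> (\<lambda>x. f k x - g x)) \<longlonglongrightarrow> 0"
  shows "(\<lambda>k. foldr cpartial js (bargmann (f k)) z) \<longlonglongrightarrow> foldr cpartial js (bargmann g) z"
  by (rule tendsto_uniform_limitI[OF foldr_cpartial_uniform_limit[where R = "norm z"]])
    (auto intro!: entire_separately_holomorphic entire_bargmann bargmann_uniform_limit assms)

section \<open>The isometry on the Gauss-Sobolev space\<close>

lemma finite_mi_size: "finite {\<alpha> :: 'n::finite \<Rightarrow> nat. mi_size \<alpha> \<le> m}"
proof (rule finite_subset)
  show "{\<alpha> :: 'n \<Rightarrow> nat. mi_size \<alpha> \<le> m} \<subseteq> PiE UNIV (\<lambda>_. {..m})"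
  proof
    fix \<alpha> :: "'n \<Rightarrow> nat" assume "\<alpha> \<in> {\<alpha>. mi_size \<alpha> \<le> m}"
    then have "\<alpha> j \<le> m" for j
      using member_le_sum[of j UNIV \<alpha>] by (simp add: mi_size_def)
    then show "\<alpha> \<in> PiE UNIV (\<lambda>_. {..m})" by (auto simp: PiE_iff)
  qed
qed (simp add: finite_PiE)

text \<open>
  The list chosen in the definition of \<open>mi_deriv\<close> must be empty for the multi-index \<open>0\<close>.
\<close>

lemma mi_deriv_zero: "mi_deriv D (\<lambda>_::'n::finite. 0) f = f"
proof -
  have "(SOME js. \<forall>j::'n. count_list js j = 0) = []"
    by (rule some_equality) (auto simp: count_list_0_iff)
  then show ?thesis by (simp add: mi_deriv_def)
qed

lemma gs_approx_test: "gs_approx m \<phi> f \<Longrightarrow> \<phi> k \<in> test_functions"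
  by (simp add: gs_approx_def)

lemma gs_approx_Cauchy:
  "gs_approx m \<phi> f \<Longrightarrow> e > 0 \<Longrightarrow> \<exists>N. \<forall>k\<ge>N. \<forall>l\<ge>N. test_norm m (\<lambda>x. \<phi> k x - \<phi> l x) < e"
  by (simp add: gs_approx_def)

lemma gs_approx_square_integrable: "gs_approx m \<phi> f \<Longrightarrow> square_integrable \<gamma> f"
  by (simp add: gs_approx_def)

lemma test_square_integrable: "\<phi> \<in> test_functions \<Longrightarrow> square_integrable \<gamma> \<phi>"
  by (intro tame_square_integrable test_function_tame)

lemma mi_deriv_test: "\<phi> \<in> test_functions \<Longrightarrow> mi_deriv rpartial \<alpha> \<phi> \<in> test_functions"
  unfolding mi_deriv_def by (rule foldr_rpartial_test_function)

lemma mi_deriv_linear: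
  "smooth f \<Longrightarrow> smooth g \<Longrightarrow>
    mi_deriv rpartial \<alpha> (\<lambda>x. a * f x + b * g x) = (\<lambda>x. a * mi_deriv rpartial \<alpha> f x + b * mi_deriv rpartial \<alpha> g x)"
  unfolding mi_deriv_def by (rule foldr_rpartial_linear)

lemma mi_deriv_diff:
  "smooth f \<Longrightarrow> smooth g \<Longrightarrow>
    mi_deriv rpartial \<alpha> (\<lambda>x. f x - g x) = (\<lambda>x. mi_deriv rpartial \<alpha> f x - mi_deriv rpartial \<alpha> g x)"
  using mi_deriv_linear[of f g \<alpha> 1 "-1"] by simp

lemma l2norm_le_test_norm:
  assumes "mi_size \<alpha> \<le> m"
  shows "l2norm \<gamma> (mi_deriv rpartial \<alpha> f) \<le> test_norm m f"
  unfolding test_norm_def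
  by (rule member_le_sum) (use assms finite_mi_size in \<open>auto simp: l2norm_nonneg\<close>)

text \<open>
  The sequence \<open>G (\<partial>\<^sup>\<alpha> \<phi>\<^sub>k) = \<partial>\<^sup>\<alpha> (G \<phi>\<^sub>k)\<close> is Cauchy in the Fock norm, by the isometry on test
  functions, and converges pointwise to \<open>\<partial>\<^sup>\<alpha> (G f)\<close>. Fatou's lemma identifies the limit.
\<close>

lemma gs_approx_derivative:
  assumes a: "gs_approx m \<phi> f" and \<alpha>: "mi_size \<alpha> \<le> m"
  shows "square_integrable fock_measure (mi_deriv cpartial \<alpha> (bargmann f))"
    and "(\<lambda>k. l2norm \<gamma> (mi_deriv rpartial \<alpha> (\<phi> k))) \<longlonglongrightarrow> l2norm fock_measure (mi_deriv cpartial \<alpha> (bargmann f))"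
    and "(\<lambda>k. l2norm fock_measure (\<lambda>z. mi_deriv cpartial \<alpha> (bargmann (\<phi> k)) z - mi_deriv cpartial \<alpha> (bargmann f) z)) \<longlonglongrightarrow> 0"
proof -
  note t = gs_approx_test[OF a]
  note sm = tame_smooth[OF test_function_tame[OF t]]
  define d where "d = (\<lambda>k. mi_deriv rpartial \<alpha> (\<phi> k))"
  define D where "D = mi_deriv cpartial \<alpha> (bargmann f)"
  have dt: "d k \<in> test_functions" for k unfolding d_def by (rule mi_deriv_test[OF t])
  have dd: "(\<lambda>x. d k x - d l x) \<in> test_functions" for k l
    using test_functions_linear[OF dt dt, of 1 k "-1" l] by simp
  have gd: "bargmann (\<lambda>x. d k x - d l x) = (\<lambda>z. bargmann (d k) z - bargmann (d l) z)" for k l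
    by (intro ext bargmann_diff test_square_integrable dt)
  have lim: "(\<lambda>k. bargmann (d k) z) \<longlonglongrightarrow> D z" for z
  proof -
    have "(\<lambda>k. mi_deriv cpartial \<alpha> (bargmann (\<phi> k)) z) \<longlonglongrightarrow> mi_deriv cpartial \<alpha> (bargmann f) z"
      unfolding mi_deriv_def
      by (rule foldr_cpartial_bargmann_tendsto) (use a in \<open>auto simp: gs_approx_def intro: test_square_integrable\<close>)
    then show ?thesis by (simp add: d_def D_def mi_deriv_bargmann[OF test_function_tame[OF t]])
  qed
  have Dm: "D \<in> borel_measurable borel"
    unfolding D_def mi_deriv_def
    using separately_holomorphic_foldr[OF entire_separately_holomorphic[OF entire_bargmann[OF gs_approx_square_integrable[OF a]]]]
    by (intro borel_measurable_continuous_onI) (auto simp: separately_holomorphic_def)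
  \<comment> \<open>Fatou's lemma in \<open>l\<close>, for fixed \<open>k\<close>.\<close>
  have cauchy: "\<exists>N. \<forall>k\<ge>N. square_integrable fock_measure (\<lambda>z. bargmann (d k) z - D z) \<and> l2norm fock_measure (\<lambda>z. bargmann (d k) z - D z) \<le> e"
    if "e > 0" for e
  proof -
    from a that obtain N where N: "\<And>k l. k \<ge> N \<Longrightarrow> l \<ge> N \<Longrightarrow> test_norm m (\<lambda>x. \<phi> k x - \<phi> l x) < e"
      using gs_approx_Cauchy[OF a] by metis
    show ?thesis
    proof (intro exI[of _ N] allI impI)
      fix k assume k: "k \<ge> N"
      have "l2norm fock_measure (\<lambda>z. bargmann (d k) z - bargmann (d l) z) \<le> e" if l: "l \<ge> N" for l
      proof -
        have "l2norm fock_measure (\<lambda>z. bargmann (d k) z - bargmann (d l) z) = l2norm \<gamma> (\<lambda>x. d k x - d l x)"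
          using bargmann_test_function(2)[OF dd] by (simp add: gd)
        also have "\<dots> = l2norm \<gamma> (mi_deriv rpartial \<alpha> (\<lambda>x. \<phi> k x - \<phi> l x))"
          by (simp add: d_def mi_deriv_diff sm)
        also have "\<dots> \<le> test_norm m (\<lambda>x. \<phi> k x - \<phi> l x)" by (rule l2norm_le_test_norm[OF \<alpha>])
        finally show ?thesis using N[OF k l] by simp
      qed
      then have ev: "\<forall>\<^sub>F l in sequentially. l2norm fock_measure (\<lambda>z. bargmann (d k) z - bargmann (d l) z) \<le> e"
        unfolding eventually_sequentially by blast
      have sq: "square_integrable fock_measure (\<lambda>z. bargmann (d k) z - bargmann (d l) z)" for l
        using bargmann_test_function(1)[OF dd] by (simp add: gd)
      have m: "(\<lambda>z. bargmann (d k) z - D z) \<in> borel_measurable fock_measure"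
        using Dm bargmann_measurable[OF test_square_integrable[OF dt]] by simp
      show "square_integrable fock_measure (\<lambda>z. bargmann (d k) z - D z) \<and> l2norm fock_measure (\<lambda>z. bargmann (d k) z - D z) \<le> e"
      proof -
        have "(\<lambda>l. bargmann (d k) z - bargmann (d l) z) \<longlonglongrightarrow> bargmann (d k) z - D z" for z
          by (intro tendsto_intros lim)
        from l2norm_Fatou[OF sq m this ev] show ?thesis by simp
      qed
    qed
  qed
  obtain N0 where N0: "\<And>k. k \<ge> N0 \<Longrightarrow> square_integrable fock_measure (\<lambda>z. bargmann (d k) z - D z)"
    using cauchy[of 1] by auto
  have sqD: "square_integrable fock_measure D"
    using square_integrable_diff[OF bargmann_test_function(1)[OF dt[of N0]] N0[OF order_refl]] by simp
  then show "square_integrable fock_measure (mi_deriv cpartial \<alpha> (bargmann f))" by (simp add: D_def)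
  have l0: "(\<lambda>k. l2norm fock_measure (\<lambda>z. bargmann (d k) z - D z)) \<longlonglongrightarrow> 0"
  proof (rule LIMSEQ_I)
    fix r :: real assume "r > 0"
    then obtain N where "\<forall>k\<ge>N. l2norm fock_measure (\<lambda>z. bargmann (d k) z - D z) \<le> r / 2"
      using cauchy[of "r/2"] by auto
    then show "\<exists>no. \<forall>n\<ge>no. norm (l2norm fock_measure (\<lambda>z. bargmann (d n) z - D z) - 0) < r"
      using \<open>r > 0\<close> by (intro exI[of _ N]) (auto simp: l2norm_nonneg intro: le_less_trans)
  qed
  then show "(\<lambda>k. l2norm fock_measure (\<lambda>z. mi_deriv cpartial \<alpha> (bargmann (\<phi> k)) z - mi_deriv cpartial \<alpha> (bargmann f) z)) \<longlonglongrightarrow> 0"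
    by (simp add: d_def D_def mi_deriv_bargmann[OF test_function_tame[OF t]])
  from l2norm_tendsto[OF bargmann_test_function(1)[OF dt] sqD l0]
  show "(\<lambda>k. l2norm \<gamma> (mi_deriv rpartial \<alpha> (\<phi> k))) \<longlonglongrightarrow> l2norm fock_measure (mi_deriv cpartial \<alpha> (bargmann f))"
    by (simp add: bargmann_test_function(2)[OF dt]) (simp add: d_def D_def)
qed

lemma gs_approx_norm:
  assumes "gs_approx m \<phi> f"
  shows "(\<lambda>k. test_norm m (\<phi> k)) \<longlonglongrightarrow> fock_sobolev_norm m (bargmann f)"
  unfolding test_norm_def fock_sobolev_norm_def
  by (intro tendsto_sum gs_approx_derivative(2)[OF assms]) simp

text \<open>
  The limit of the norms is the same for every approximating sequence since it is a quantity that
  depends on \<open>f\<close> only; so the definite description in the definition of the norm denotes.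
\<close>

lemma gauss_sobolev_norm_eq:
  assumes "f \<in> gauss_sobolev m"
  shows "gauss_sobolev_norm m f = fock_sobolev_norm m (bargmann f)"
  unfolding gauss_sobolev_norm_def
proof (rule the_equality)
  show "\<forall>\<phi>. gs_approx m \<phi> f \<longrightarrow> (\<lambda>k. test_norm m (\<phi> k)) \<longlonglongrightarrow> fock_sobolev_norm m (bargmann f)"
    by (intro allI impI gs_approx_norm)
  fix l assume l: "\<forall>\<phi>. gs_approx m \<phi> f \<longrightarrow> (\<lambda>k. test_norm m (\<phi> k)) \<longlonglongrightarrow> l"
  obtain \<phi> where "gs_approx m \<phi> f" using assms by (auto simp: gauss_sobolev_def)
  then show "l = fock_sobolev_norm m (bargmann f)"
    by (intro LIMSEQ_unique[OF l[rule_format] gs_approx_norm])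
qed

lemma gauss_sobolev_square_integrable: "f \<in> gauss_sobolev m \<Longrightarrow> square_integrable \<gamma> f"
  by (auto simp: gauss_sobolev_def gs_approx_def)

lemma bargmann_fock_sobolev:
  assumes "f \<in> gauss_sobolev m"
  shows "bargmann f \<in> fock_sobolev m"
  using assms gauss_sobolev_square_integrable[OF assms] gs_approx_derivative(1)
  by (auto simp: fock_sobolev_def gauss_sobolev_def intro: entire_bargmann)

text \<open>
  The case \<open>\<alpha> = 0\<close> compares the norms of \<open>f\<close> and \<open>G f\<close> themselves.
\<close>

lemma bargmann_isometry:
  assumes "f \<in> gauss_sobolev m"
  shows "square_integrable fock_measure (bargmann f)" "l2norm fock_measure (bargmann f) = l2norm \<gamma> f"
proof -
  obtain \<phi> where a: "gs_approx m \<phi> f" using assms by (auto simp: gauss_sobolev_def)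
  have z: "mi_size (\<lambda>_::'a. 0) \<le> m" by (simp add: mi_size_def)
  show "square_integrable fock_measure (bargmann f)"
    using gs_approx_derivative(1)[OF a z] by (simp add: mi_deriv_zero)
  have "(\<lambda>k. l2norm \<gamma> (\<phi> k)) \<longlonglongrightarrow> l2norm \<gamma> f"
    by (rule l2norm_tendsto) (use a in \<open>auto simp: gs_approx_def intro: test_square_integrable\<close>)
  moreover have "(\<lambda>k. l2norm \<gamma> (\<phi> k)) \<longlonglongrightarrow> l2norm fock_measure (bargmann f)"
    using gs_approx_derivative(2)[OF a z] by (simp add: mi_deriv_zero)
  ultimately show "l2norm fock_measure (bargmann f) = l2norm \<gamma> f"
    by (auto intro: LIMSEQ_unique)
qed

lemma test_norm_nonneg: "0 \<le> test_norm m f"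
  unfolding test_norm_def by (intro sum_nonneg l2norm_nonneg)

lemma test_norm_linear_le:
  assumes "f \<in> test_functions" "g \<in> test_functions"
  shows "test_norm m (\<lambda>x. a * f x + b * g x) \<le> cmod a * test_norm m f + cmod b * test_norm m g"
  unfolding test_norm_def sum_distrib_left sum.distrib[symmetric]
proof (rule sum_mono)
  fix \<alpha> :: "'a \<Rightarrow> nat"
  have sm: "smooth f" "smooth g" using assms by (auto simp: test_functions_def)
  have sq: "square_integrable \<gamma> (mi_deriv rpartial \<alpha> f)" "square_integrable \<gamma> (mi_deriv rpartial \<alpha> g)"
    by (intro test_square_integrable mi_deriv_test assms)+
  show "l2norm \<gamma> (mi_deriv rpartial \<alpha> (\<lambda>x. a * f x + b * g x))
      \<le> cmod a * l2norm \<gamma> (mi_deriv rpartial \<alpha> f) + cmod b * l2norm \<gamma> (mi_deriv rpartial \<alpha> g)"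
    unfolding mi_deriv_linear[OF sm]
    using l2norm_triangle[OF square_integrable_cmult[OF sq(1), of a] square_integrable_cmult[OF sq(2), of b]]
    by (simp add: l2norm_cmult)
qed

lemma gauss_sobolev_linear:
  assumes "f \<in> gauss_sobolev m" "g \<in> gauss_sobolev m"
  shows "(\<lambda>x. a * f x + b * g x) \<in> gauss_sobolev m"
proof -
  obtain \<phi> \<psi> where p: "gs_approx m \<phi> f" and q: "gs_approx m \<psi> g"
    using assms by (auto simp: gauss_sobolev_def)
  note tp = gs_approx_test[OF p] and tq = gs_approx_test[OF q]
  define c where "c = cmod a + cmod b + 1"
  have c: "c > 0" "cmod a \<le> c" "cmod b \<le> c" by (simp_all add: c_def add_nonneg_pos)
  define \<omega> where "\<omega> = (\<lambda>k x. a * \<phi> k x + b * \<psi> k x)"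
  have "gs_approx m \<omega> (\<lambda>x. a * f x + b * g x)"
    unfolding gs_approx_def
  proof (intro conjI allI impI)
    show "\<omega> k \<in> test_functions" for k unfolding \<omega>_def by (intro test_functions_linear tp tq)
    show "square_integrable \<gamma> (\<lambda>x. a * f x + b * g x)"
      by (intro square_integrable_add square_integrable_cmult gauss_sobolev_square_integrable[OF assms(1)] gauss_sobolev_square_integrable[OF assms(2)])
  next
    fix e :: real assume "e > 0"
    then have "e / (2 * c) > 0" using c by simp
    then obtain N1 where N1: "\<And>k l. k \<ge> N1 \<Longrightarrow> l \<ge> N1 \<Longrightarrow> test_norm m (\<lambda>x. \<phi> k x - \<phi> l x) < e / (2 * c)"
      using gs_approx_Cauchy[OF p] by metis
    from \<open>e / (2 * c) > 0\<close> obtain N2 where N2: "\<And>k l. k \<ge> N2 \<Longrightarrow> l \<ge> N2 \<Longrightarrow> test_norm m (\<lambda>x. \<psi> k x - \<psi> l x) < e / (2 * c)"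
      using gs_approx_Cauchy[OF q] by metis
    show "\<exists>N. \<forall>k\<ge>N. \<forall>l\<ge>N. test_norm m (\<lambda>x. \<omega> k x - \<omega> l x) < e"
    proof (intro exI[of _ "max N1 N2"] allI impI)
      fix k l assume kl: "max N1 N2 \<le> k" "max N1 N2 \<le> l"
      have t: "(\<lambda>x. \<phi> k x - \<phi> l x) \<in> test_functions" "(\<lambda>x. \<psi> k x - \<psi> l x) \<in> test_functions"
        using test_functions_linear[OF tp tp, of 1 k "-1" l] test_functions_linear[OF tq tq, of 1 k "-1" l] by auto
      have "(\<lambda>x. \<omega> k x - \<omega> l x) = (\<lambda>x. a * (\<phi> k x - \<phi> l x) + b * (\<psi> k x - \<psi> l x))"
        by (simp add: \<omega>_def algebra_simps)
      then have "test_norm m (\<lambda>x. \<omega> k x - \<omega> l x) \<le> cmod a * test_norm m (\<lambda>x. \<phi> k x - \<phi> l x) + cmod b * test_norm m (\<lambda>x. \<psi> k x - \<psi> l x)"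
        using test_norm_linear_le[OF t] by simp
      also have "\<dots> \<le> c * test_norm m (\<lambda>x. \<phi> k x - \<phi> l x) + c * test_norm m (\<lambda>x. \<psi> k x - \<psi> l x)"
        using c by (intro add_mono mult_right_mono test_norm_nonneg) auto
      also have "\<dots> < c * (e / (2 * c)) + c * (e / (2 * c))"
        using N1[of k l] N2[of k l] kl c by (intro add_strict_mono mult_strict_left_mono) auto
      also have "\<dots> = e" using c by simp
      finally show "test_norm m (\<lambda>x. \<omega> k x - \<omega> l x) < e" .
    qed
  next
    let ?p = "\<lambda>k. l2norm \<gamma> (\<lambda>x. \<phi> k x - f x)" and ?q = "\<lambda>k. l2norm \<gamma> (\<lambda>x. \<psi> k x - g x)"
    have lim: "?p \<longlonglongrightarrow> 0" "?q \<longlonglongrightarrow> 0" using p q by (auto simp: gs_approx_def)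
    have "(\<lambda>k. cmod a * ?p k + cmod b * ?q k) \<longlonglongrightarrow> cmod a * 0 + cmod b * 0"
      by (intro tendsto_intros lim)
    then have lim0: "(\<lambda>k. cmod a * ?p k + cmod b * ?q k) \<longlonglongrightarrow> 0" by simp
    show "(\<lambda>k. l2norm \<gamma> (\<lambda>x. \<omega> k x - (a * f x + b * g x))) \<longlonglongrightarrow> 0"
    proof (rule tendsto_sandwich[OF _ _ tendsto_const lim0]; rule always_eventually, rule allI)
      fix k
      show "0 \<le> l2norm \<gamma> (\<lambda>x. \<omega> k x - (a * f x + b * g x))" by (rule l2norm_nonneg)
      have "(\<lambda>x. \<omega> k x - (a * f x + b * g x)) = (\<lambda>x. a * (\<phi> k x - f x) + b * (\<psi> k x - g x))"
        by (simp add: \<omega>_def algebra_simps)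
      moreover have "l2norm \<gamma> (\<lambda>x. a * (\<phi> k x - f x) + b * (\<psi> k x - g x))
          \<le> l2norm \<gamma> (\<lambda>x. a * (\<phi> k x - f x)) + l2norm \<gamma> (\<lambda>x. b * (\<psi> k x - g x))"
        by (intro l2norm_triangle square_integrable_cmult square_integrable_diff test_square_integrable tp tq
            gauss_sobolev_square_integrable[OF assms(1)] gauss_sobolev_square_integrable[OF assms(2)])
      ultimately show "l2norm \<gamma> (\<lambda>x. \<omega> k x - (a * f x + b * g x)) \<le> cmod a * ?p k + cmod b * ?q k"
        unfolding l2norm_cmult by simp
    qed
  qed
  then show ?thesis unfolding gauss_sobolev_def \<omega>_def by (intro CollectI exI)
qed

lemma gauss_sobolev_diff:
  "f \<in> gauss_sobolev m \<Longrightarrow> g \<in> gauss_sobolev m \<Longrightarrow> (\<lambda>x. f x - g x) \<in> gauss_sobolev m"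
  using gauss_sobolev_linear[of f m g 1 "-1"] by simp

lemma test_functions_gauss_sobolev:
  fixes \<phi> :: "real^'n::finite \<Rightarrow> complex"
  assumes "\<phi> \<in> test_functions"
  shows "\<phi> \<in> gauss_sobolev m"
proof -
  have "test_norm m (\<lambda>x::real^'n. 0) = 0"
    by (simp add: test_norm_def mi_deriv_def foldr_rpartial_zero l2norm_def)
  then have "gs_approx m (\<lambda>_. \<phi>) \<phi>"
    using assms by (simp add: gs_approx_def test_square_integrable l2norm_def)
  then show ?thesis unfolding gauss_sobolev_def by (intro CollectI exI)
qed

lemma gauss_sobolev_sum:
  fixes f :: "'i \<Rightarrow> real^'n::finite \<Rightarrow> complex"
  shows "(\<And>i. i \<in> I \<Longrightarrow> f i \<in> gauss_sobolev m) \<Longrightarrow> (\<lambda>x. \<Sum>i\<in>I. c i * f i x) \<in> gauss_sobolev m"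
proof (induction I rule: infinite_finite_induct)
  case (insert i I)
  then show ?case
    using gauss_sobolev_linear[of "f i" m "\<lambda>x. \<Sum>i\<in>I. c i * f i x" "c i" 1] by simp
next
  case empty
  have "(\<lambda>x::real^'n. 0) \<in> test_functions" using tame_smooth[OF tame_zero] by (simp add: test_functions_def)
  then show ?case by (simp add: test_functions_gauss_sobolev)
next
  case (infinite I)
  have "(\<lambda>x::real^'n. 0) \<in> test_functions" using tame_smooth[OF tame_zero] by (simp add: test_functions_def)
  with infinite show ?case by (simp add: test_functions_gauss_sobolev)
qed

section \<open>Smooth cutoffs\<close>

text \<open>
  \<open>t\<^sup>-\<^sup>k exp (-1/t)\<close> for positive \<open>t\<close>, extended by \<open>0\<close>. Unlike \<open>exp (-1/t)\<close> alone, the linear span of these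
  functions is closed under differentiation.
\<close>

definition bump :: "nat \<Rightarrow> real \<Rightarrow> real" where
  "bump k t = (if t \<le> 0 then 0 else (1 / t) ^ k * exp (- (1 / t)))"

text \<open>
  A single term of the exponential series is at most its sum.
\<close>

lemma power_le_fact_mult_exp:
  fixes u :: real
  assumes "0 \<le> u"
  shows "u ^ k \<le> fact k * exp u"
proof -
  have "(\<Sum>n\<in>{k}. u ^ n /\<^sub>R fact n) \<le> (\<Sum>n. u ^ n /\<^sub>R fact n)"
    using assms by (intro sum_le_suminf summable_exp_generic) auto
  then have "u ^ k / fact k \<le> exp u" by (simp add: exp_def divide_inverse_commute)
  then show ?thesis by (simp add: divide_le_eq mult.commute)
qed

lemma bump_nonneg: "0 \<le> bump k t"
  by (simp add: bump_def)

lemma bump_le: "bump k t \<le> fact k"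
proof (cases "t \<le> 0")
  case False
  then have "(1 / t) ^ k * exp (- (1 / t)) \<le> (fact k * exp (1 / t)) * exp (- (1 / t))"
    by (intro mult_right_mono power_le_fact_mult_exp) auto
  also have "\<dots> = fact k" by (simp add: exp_minus)
  finally show ?thesis using False by (simp add: bump_def)
qed (simp add: bump_def)

lemma bump_eq_mult: "bump k t = t * bump (Suc k) t"
  by (simp add: bump_def)

text \<open>
  At the origin the difference quotient is \<open>h\<close> times a bounded function of the same kind.
\<close>

lemma bump_has_derivative:
  "(bump k has_real_derivative (bump (Suc (Suc k)) t - real k * bump (Suc k) t)) (at t)"
proof -
  consider "t > 0" | "t < 0" | "t = 0" by linarith
  then show ?thesis
  proof cases
    case 1
    have u: "((\<lambda>t. 1 / t) has_real_derivative - (1 / t)\<^sup>2) (at t)"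
      using 1 DERIV_inverse[of t] by (simp add: inverse_eq_divide power_divide numeral_2_eq_2)
    have "((\<lambda>t. (1 / t) ^ k * exp (- (1 / t))) has_real_derivative
        (real k * (- (1 / t)\<^sup>2 * (1 / t) ^ (k - Suc 0))) * exp (- (1 / t)) + (exp (- (1 / t)) * - (- (1 / t)\<^sup>2)) * (1 / t) ^ k) (at t)"
      by (intro DERIV_mult DERIV_power u DERIV_chain2[OF DERIV_exp] DERIV_minus)
    moreover have "real k * (1 / t)\<^sup>2 * (1 / t) ^ (k - Suc 0) = real k * (1 / t) ^ Suc k"
      by (cases k) (simp_all add: power2_eq_square)
    then have "(real k * (- (1 / t)\<^sup>2 * (1 / t) ^ (k - Suc 0))) * exp (- (1 / t)) + (exp (- (1 / t)) * - (- (1 / t)\<^sup>2)) * (1 / t) ^ k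
      = (1 / t) ^ (Suc (Suc k)) * exp (- (1 / t)) - real k * ((1 / t) ^ Suc k * exp (- (1 / t)))"
      by (simp add: power2_eq_square mult_ac)
    ultimately have "((\<lambda>t. (1 / t) ^ k * exp (- (1 / t))) has_real_derivative
        (1 / t) ^ (Suc (Suc k)) * exp (- (1 / t)) - real k * ((1 / t) ^ Suc k * exp (- (1 / t)))) (at t)"
      by (simp only:)
    then have "(bump k has_real_derivative
        (1 / t) ^ (Suc (Suc k)) * exp (- (1 / t)) - real k * ((1 / t) ^ Suc k * exp (- (1 / t)))) (at t)"
      by (rule has_field_derivative_transform_within_open[where S = "{0<..}"]) (use 1 in \<open>auto simp: bump_def\<close>)
    with 1 show ?thesis by (simp add: bump_def)
  next
    case 2
    have "(bump k has_real_derivative 0) (at t)"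
      by (rule has_field_derivative_transform_within_open[OF DERIV_const, where S = "{..<0}"]) (use 2 in \<open>auto simp: bump_def\<close>)
    with 2 show ?thesis by (simp add: bump_def)
  next
    case 3
    have "((\<lambda>h. bump k h / h) \<longlongrightarrow> 0) (at 0)"
    proof (rule Lim_null_comparison)
      show "\<forall>\<^sub>F h in at 0. norm (bump k h / h) \<le> \<bar>h\<bar> * fact (Suc (Suc k))"
      proof (rule always_eventually, rule allI)
        fix h :: real
        have "bump k h / h = h * bump (Suc (Suc k)) h"
          using bump_eq_mult[of k h] bump_eq_mult[of "Suc k" h] by (cases "h = 0") (auto simp: bump_def)
        then show "norm (bump k h / h) \<le> \<bar>h\<bar> * fact (Suc (Suc k))"
          using mult_left_mono[OF bump_le abs_ge_zero[of h], of "Suc (Suc k)" h]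
          by (simp only: real_norm_def abs_mult abs_of_nonneg[OF bump_nonneg])
      qed
      show "((\<lambda>h. \<bar>h\<bar> * fact (Suc (Suc k)) :: real) \<longlongrightarrow> 0) (at 0)"
        by (intro tendsto_eq_intros | simp)+
    qed
    then show ?thesis using 3 by (simp add: DERIV_def bump_def)
  qed
qed

text \<open>
  A cutoff with scale \<open>1/s\<close> is handled as one function of \<open>s\<close> and \<open>x\<close>, in a class that is closed under
  differentiation in \<open>x\<close>. Each derivative of the cut-off function is thus again a continuous function of
  \<open>s\<close>, and its value at \<open>s = 0\<close> is the derivative of the original function.
\<close>

inductive_set cutoff_family :: "(real \<Rightarrow> real^'n::finite \<Rightarrow> complex) set" where
  const: "(\<lambda>s x. c) \<in> cutoff_family"
| coord: "(\<lambda>s x. of_real (x $ j)) \<in> cutoff_family"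
| param: "(\<lambda>s x. of_real s) \<in> cutoff_family"
| bump: "(\<lambda>s x. of_real (bump k (1 - s\<^sup>2 * (norm x)\<^sup>2))) \<in> cutoff_family"
| add: "F \<in> cutoff_family \<Longrightarrow> G \<in> cutoff_family \<Longrightarrow> (\<lambda>s x. F s x + G s x) \<in> cutoff_family"
| mult: "F \<in> cutoff_family \<Longrightarrow> G \<in> cutoff_family \<Longrightarrow> (\<lambda>s x. F s x * G s x) \<in> cutoff_family"

lemma cutoff_family_differentiable: "F \<in> cutoff_family \<Longrightarrow> F s differentiable (at x)"
proof (induction rule: cutoff_family.induct)
  case (coord j)
  show ?case
    by (intro bounded_linear_imp_differentiable bounded_linear_compose[OF bounded_linear_of_real bounded_linear_vec_nth])
next
  case (bump k)
  have "(\<lambda>x::real^'a. x \<bullet> x) differentiable (at x)"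
    by (rule differentiableI[OF has_derivative_inner[OF has_derivative_ident has_derivative_ident]])
  then have 1: "(\<lambda>x::real^'a. 1 - s\<^sup>2 * (norm x)\<^sup>2) differentiable (at x)"
    unfolding power2_norm_eq_inner by (intro derivative_intros)
  have 2: "bump k differentiable (at t)" for t
    using bump_has_derivative[of k t] by (auto simp: real_differentiable_def)
  have 3: "complex_of_real differentiable (at t)" for t
    by (rule bounded_linear_imp_differentiable[OF bounded_linear_of_real])
  show ?case
    by (rule differentiable_compose[OF 3 differentiable_compose[OF 2 1]])
qed (auto intro: derivative_intros)

lemma cutoff_family_rpartial: "F \<in> cutoff_family \<Longrightarrow> \<exists>F'\<in>cutoff_family. \<forall>s x. rpartial j (F s) x = F' s x"
proof (induction rule: cutoff_family.induct)
  case (const c)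
  show ?case by (rule bexI[OF _ cutoff_family.const[of 0]]) (auto intro!: rpartial_eqI)
next
  case (param)
  show ?case by (rule bexI[OF _ cutoff_family.const[of 0]]) (auto intro!: rpartial_eqI)
next
  case (coord i)
  show ?case
  proof (rule bexI[OF _ cutoff_family.const[of "if i = j then 1 else 0"]], intro allI rpartial_eqI)
    fix x :: "real^'a"
    have "((\<lambda>t. complex_of_real (x $ i) + of_real t * (if i = j then 1 else 0)) has_vector_derivative 0 + of_real 1 * (if i = j then 1 else 0)) (at 0)"
      by (intro has_vector_derivative_add has_vector_derivative_const has_vector_derivative_mult_left
          has_vector_derivative_of_real DERIV_ident)
    moreover have "(\<lambda>t. complex_of_real (x $ i) + of_real t * (if i = j then 1 else 0)) = (\<lambda>t. of_real ((x + axis j t) $ i))"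
      by (auto simp: axis_def)
    ultimately show "((\<lambda>t. complex_of_real ((x + axis j t) $ i)) has_vector_derivative (if i = j then 1 else 0)) (at 0)"
      by simp
  qed
next
  case (bump k)
  let ?t = "\<lambda>s (x::real^'a). 1 - s\<^sup>2 * (norm x)\<^sup>2"
  let ?F = "\<lambda>s x. (of_real (bump (Suc (Suc k)) (?t s x)) + (- of_nat k) * of_real (bump (Suc k) (?t s x)))
      * ((-2) * of_real s * of_real s * of_real (x $ j)) :: complex"
  show ?case
  proof (rule bexI[where x = ?F], intro allI rpartial_eqI)
    show "?F \<in> cutoff_family" by (intro cutoff_family.intros)
    fix s and x :: "real^'a"
    have n: "(norm (x + axis j t))\<^sup>2 = (norm x)\<^sup>2 + 2 * t * x $ j + t\<^sup>2" for t
      by (subst axis_scaleR, unfold power2_norm_eq_inner)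
        (simp add: inner_add inner_axis inner_axis' inner_axis_axis power2_eq_square algebra_simps)
    have "((\<lambda>t. 1 - s\<^sup>2 * ((norm x)\<^sup>2 + 2 * t * x $ j + t\<^sup>2)) has_real_derivative - 2 * s\<^sup>2 * x $ j) (at 0)"
      by (auto intro!: derivative_eq_intros)
    then have d: "((\<lambda>t. ?t s (x + axis j t)) has_real_derivative - 2 * s\<^sup>2 * x $ j) (at 0)"
      unfolding n .
    have "((\<lambda>t. bump k (?t s (x + axis j t))) has_real_derivative
       (bump (Suc (Suc k)) (?t s (x + axis j 0)) - real k * bump (Suc k) (?t s (x + axis j 0))) * (- 2 * s\<^sup>2 * x $ j)) (at 0)"
      by (rule DERIV_chain2[OF bump_has_derivative d])
    then have "((\<lambda>t. complex_of_real (bump k (?t s (x + axis j t)))) has_vector_derivative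
       of_real ((bump (Suc (Suc k)) (?t s (x + axis j 0)) - real k * bump (Suc k) (?t s (x + axis j 0))) * (- 2 * s\<^sup>2 * x $ j))) (at 0)"
      by (rule has_vector_derivative_of_real)
    moreover have "of_real ((bump (Suc (Suc k)) (?t s (x + axis j 0)) - real k * bump (Suc k) (?t s (x + axis j 0))) * (- 2 * s\<^sup>2 * x $ j)) = ?F s x"
      by (simp add: axis_eq_0_iff[THEN iffD2] power2_eq_square algebra_simps)
    ultimately show "((\<lambda>t. complex_of_real (bump k (?t s (x + axis j t)))) has_vector_derivative ?F s x) (at 0)"
      by (simp only:)
  qed
next
  case (add F G)
  then obtain F' G' where F: "F' \<in> cutoff_family" "\<And>s x. rpartial j (F s) x = F' s x" and G: "G' \<in> cutoff_family" "\<And>s x. rpartial j (G s) x = G' s x"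
    by blast
  show ?case
  proof (rule bexI[OF _ cutoff_family.add[OF F(1) G(1)]], intro allI rpartial_eqI)
    fix s x
    show "((\<lambda>t. F s (x + axis j t) + G s (x + axis j t)) has_vector_derivative F' s x + G' s x) (at 0)"
      unfolding F(2)[symmetric] G(2)[symmetric]
      by (intro has_vector_derivative_add has_vector_derivative_rpartial cutoff_family_differentiable add)
  qed
next
  case (mult F G)
  then obtain F' G' where F: "F' \<in> cutoff_family" "\<And>s x. rpartial j (F s) x = F' s x" and G: "G' \<in> cutoff_family" "\<And>s x. rpartial j (G s) x = G' s x"
    by blast
  have "(\<lambda>s x. F s x * G' s x + F' s x * G s x) \<in> cutoff_family" by (intro cutoff_family.intros mult F G)
  then show ?case
  proof (rule bexI[rotated], intro allI rpartial_eqI)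
    fix s x
    have "((\<lambda>t. F s (x + axis j t) * G s (x + axis j t)) has_vector_derivative F s (x + axis j 0) * G' s x + F' s x * G s (x + axis j 0)) (at 0)"
      unfolding F(2)[symmetric] G(2)[symmetric]
      by (intro has_vector_derivative_mult has_vector_derivative_rpartial cutoff_family_differentiable mult)
    then show "((\<lambda>t. F s (x + axis j t) * G s (x + axis j t)) has_vector_derivative F s x * G' s x + F' s x * G s x) (at 0)"
      by (simp add: axis_eq_0_iff[THEN iffD2])
  qed
qed

lemma cutoff_family_foldr_rpartial:
  assumes "F \<in> cutoff_family"
  shows "\<exists>F'\<in>cutoff_family. \<forall>s. foldr rpartial js (F s) = F' s"
proof (induction js)
  case Nil
  show ?case using assms by auto
next
  case (Cons j js)
  then obtain F' where F': "F' \<in> cutoff_family" "\<And>s. foldr rpartial js (F s) = F' s" by blast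
  from cutoff_family_rpartial[OF F'(1), of j] show ?case by (auto simp: F'(2) fun_eq_iff)
qed

lemma cutoff_family_continuous: "F \<in> cutoff_family \<Longrightarrow> continuous_on UNIV (\<lambda>s. F s x)"
proof (induction rule: cutoff_family.induct)
  case (bump k)
  have "continuous_on UNIV (bump k)"
    by (intro continuous_at_imp_continuous_on ballI DERIV_isCont[OF bump_has_derivative])
  then have "continuous_on UNIV (\<lambda>s. bump k (1 - s\<^sup>2 * (norm x)\<^sup>2))"
    by (rule continuous_on_compose2) (auto intro!: continuous_intros)
  then show ?case by (rule continuous_on_of_real)
qed (auto intro: continuous_intros)

text \<open>
  The bound is uniform for \<open>|s| \<le> 1\<close>, as dominated convergence for \<open>s \<rightarrow> 0\<close> requires. It is recorded
  through a function \<open>u\<close> so that the estimates for products combine.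
\<close>

lemma cutoff_family_bounded:
  "F \<in> cutoff_family \<Longrightarrow> \<exists>u. exp_bounded u \<and> u \<in> borel_measurable borel \<and> (\<forall>s x. \<bar>s\<bar> \<le> 1 \<longrightarrow> cmod (F s x) \<le> cmod (u x))"
proof (induction rule: cutoff_family.induct)
  case (const c)
  show ?case by (rule exI[of _ "\<lambda>_. c"]) (auto intro: exp_bounded_const)
next
  case (coord j)
  show ?case by (rule exI[of _ "\<lambda>x. of_real (x $ j)"]) (auto intro: exp_bounded_coord)
next
  case param
  show ?case by (rule exI[of _ "\<lambda>_. 1"]) (auto intro: exp_bounded_const)
next
  case (bump k)
  show ?case
    by (rule exI[of _ "\<lambda>_. of_real (fact k)"]) (auto intro: exp_bounded_const bump_le simp: bump_nonneg simp del: of_real_fact)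
next
  case (add F G)
  then obtain u v where u: "exp_bounded u" "u \<in> borel_measurable borel" "\<And>s x. \<bar>s\<bar> \<le> 1 \<Longrightarrow> cmod (F s x) \<le> cmod (u x)"
    and v: "exp_bounded v" "v \<in> borel_measurable borel" "\<And>s x. \<bar>s\<bar> \<le> 1 \<Longrightarrow> cmod (G s x) \<le> cmod (v x)" by metis
  have "exp_bounded (\<lambda>x. of_real (cmod (u x)))" "exp_bounded (\<lambda>x. of_real (cmod (v x)))"
    using u(1) v(1) by (auto simp: exp_bounded_def)
  then have "exp_bounded (\<lambda>x. of_real (cmod (u x)) + of_real (cmod (v x)))" by (rule exp_bounded_add)
  moreover have "(\<lambda>x. of_real (cmod (u x)) + of_real (cmod (v x)) :: complex) \<in> borel_measurable borel"
    using u(2) v(2) by measurable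
  moreover have "cmod (F s x + G s x) \<le> cmod (of_real (cmod (u x)) + of_real (cmod (v x)))" if "\<bar>s\<bar> \<le> 1" for s x
    using norm_triangle_ineq[of "F s x" "G s x"] u(3)[OF that, of x] v(3)[OF that, of x]
    unfolding of_real_add[symmetric] norm_of_real by simp
  ultimately show ?case by (intro exI conjI allI impI)
next
  case (mult F G)
  then obtain u v where u: "exp_bounded u" "u \<in> borel_measurable borel" "\<And>s x. \<bar>s\<bar> \<le> 1 \<Longrightarrow> cmod (F s x) \<le> cmod (u x)"
    and v: "exp_bounded v" "v \<in> borel_measurable borel" "\<And>s x. \<bar>s\<bar> \<le> 1 \<Longrightarrow> cmod (G s x) \<le> cmod (v x)" by metis
  show ?case
  proof (rule exI[of _ "\<lambda>x. u x * v x"], intro conjI allI impI exp_bounded_mult u v)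
    show "(\<lambda>x. u x * v x) \<in> borel_measurable borel" using u(2) v(2) by measurable
    fix s :: real and x assume s: "\<bar>s\<bar> \<le> 1"
    show "cmod (F s x * G s x) \<le> cmod (u x * v x)"
      unfolding norm_mult using u(3)[OF s] v(3)[OF s] by (intro mult_mono) auto
  qed
qed

lemma cutoff_family_smooth: "F \<in> cutoff_family \<Longrightarrow> smooth (F s)"
  unfolding smooth_def
proof (intro allI)
  fix js x assume "F \<in> cutoff_family"
  then obtain F' where "F' \<in> cutoff_family" "\<And>s. foldr rpartial js (F s) = F' s"
    using cutoff_family_foldr_rpartial by blast
  then show "foldr rpartial js (F s) differentiable (at x)"
    by (simp add: cutoff_family_differentiable)
qed

lemma cutoff_family_tame:
  assumes F: "F \<in> cutoff_family" and s: "\<bar>s\<bar> \<le> 1"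
  shows "tame (F s)"
  unfolding tame_def
proof (intro conjI allI cutoff_family_smooth[OF F])
  fix js
  obtain F' where F': "F' \<in> cutoff_family" "\<And>s. foldr rpartial js (F s) = F' s"
    using cutoff_family_foldr_rpartial[OF F] by blast
  obtain u where u: "exp_bounded u" "\<And>x. cmod (F' s x) \<le> cmod (u x)"
    using cutoff_family_bounded[OF F'(1)] s by blast
  from u(1) obtain C c where "\<And>x. cmod (u x) \<le> C * exp (c * norm x)"
    unfolding exp_bounded_def by blast
  from exp_boundedI[OF order_trans[OF u(2) this]] show "exp_bounded (foldr rpartial js (F s))"
    unfolding F'(2) .
qed

lemma cutoff_family_l2_tendsto:
  assumes F: "F \<in> cutoff_family" and s: "s \<longlonglongrightarrow> 0" "\<And>k. \<bar>s k\<bar> \<le> 1"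
  shows "(\<lambda>k. l2norm \<gamma> (\<lambda>x. F (s k) x - F 0 x)) \<longlonglongrightarrow> 0"
proof -
  obtain u where u: "exp_bounded u" "u \<in> borel_measurable borel" "\<And>s x. \<bar>s\<bar> \<le> 1 \<Longrightarrow> cmod (F s x) \<le> cmod (u x)"
    using cutoff_family_bounded[OF F] by metis
  have m: "F t \<in> borel_measurable borel" for t by (rule smooth_measurable[OF cutoff_family_smooth[OF F]])
  have "(\<lambda>k. \<integral>x. (cmod (F (s k) x - F 0 x))\<^sup>2 \<partial>\<gamma>) \<longlonglongrightarrow> (\<integral>x. 0 \<partial>(\<gamma> :: (real^'a) measure))"
  proof (rule integral_dominated_convergence[where w = "\<lambda>x. 4 * (cmod (u x))\<^sup>2"])
    show "integrable \<gamma> (\<lambda>x. 4 * (cmod (u x))\<^sup>2)"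
      by (intro integrable_mult_right square_integrable_sq exp_bounded_square_integrable u)
    show "(\<lambda>x. (cmod (F (s k) x - F 0 x))\<^sup>2) \<in> borel_measurable \<gamma>" for k
      using m by measurable
    show "AE x in \<gamma>. (\<lambda>k. (cmod (F (s k) x - F 0 x))\<^sup>2) \<longlonglongrightarrow> 0"
    proof (rule AE_I2)
      fix x :: "real^'a"
      have "(\<lambda>k. F (s k) x) \<longlonglongrightarrow> F 0 x"
        using continuous_on_tendsto_compose[OF cutoff_family_continuous[OF F, of x] s(1)] by simp
      then have "(\<lambda>k. (cmod (F (s k) x - F 0 x))\<^sup>2) \<longlonglongrightarrow> (cmod (F 0 x - F 0 x))\<^sup>2"
        by (intro tendsto_intros)
      then show "(\<lambda>k. (cmod (F (s k) x - F 0 x))\<^sup>2) \<longlonglongrightarrow> 0" by simp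
    qed
    show "AE x in \<gamma>. norm ((cmod (F (s k) x - F 0 x))\<^sup>2) \<le> 4 * (cmod (u x))\<^sup>2" for k
    proof (rule AE_I2)
      fix x :: "real^'a"
      have "cmod (F (s k) x - F 0 x) \<le> 2 * cmod (u x)"
        using norm_triangle_ineq4[of "F (s k) x" "F 0 x"] u(3)[OF s(2), of k x] u(3)[of 0 x] by simp
      from power_mono[OF this, of 2] show "norm ((cmod (F (s k) x - F 0 x))\<^sup>2) \<le> 4 * (cmod (u x))\<^sup>2"
        by (simp add: power_mult_distrib)
    qed
  qed auto
  from tendsto_real_sqrt[OF this] show ?thesis by (simp add: l2norm_def)
qed

text \<open>
  Every derivative of \<open>F s\<close> is again in the class, hence converges in \<open>L\<^sup>2(\<gamma>)\<close> to the corresponding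
  derivative of \<open>F 0\<close>; so the functions \<open>F (1/(k+1))\<close> form a Cauchy sequence for the test norm.
\<close>

lemma cutoff_family_gauss_sobolev:
  assumes F: "F \<in> cutoff_family" and t: "\<And>s. 0 < s \<Longrightarrow> F s \<in> test_functions"
  shows "F 0 \<in> gauss_sobolev m"
proof -
  define s where "s = (\<lambda>k::nat. 1 / real (Suc k))"
  have s: "0 < s k" "\<bar>s k\<bar> \<le> 1" for k by (simp_all add: s_def)
  have s0: "s \<longlonglongrightarrow> 0" using LIMSEQ_inverse_real_of_nat by (simp add: s_def inverse_eq_divide)
  define a where "a = (\<lambda>k. \<Sum>\<alpha> | mi_size \<alpha> \<le> m. l2norm \<gamma> (\<lambda>x. mi_deriv rpartial \<alpha> (F (s k)) x - mi_deriv rpartial \<alpha> (F 0) x))"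
  have "a \<longlonglongrightarrow> (\<Sum>\<alpha>::'a \<Rightarrow> nat | mi_size \<alpha> \<le> m. 0)"
    unfolding a_def
  proof (rule tendsto_sum)
    fix \<alpha> :: "'a \<Rightarrow> nat"
    obtain F' where F': "F' \<in> cutoff_family" "\<And>s. mi_deriv rpartial \<alpha> (F s) = F' s"
      unfolding mi_deriv_def using cutoff_family_foldr_rpartial[OF F] by blast
    show "(\<lambda>k. l2norm \<gamma> (\<lambda>x. mi_deriv rpartial \<alpha> (F (s k)) x - mi_deriv rpartial \<alpha> (F 0) x)) \<longlonglongrightarrow> 0"
      unfolding F'(2) by (rule cutoff_family_l2_tendsto[OF F'(1) s0 s(2)])
  qed
  then have a0: "a \<longlonglongrightarrow> 0" by simp
  have tm: "tame (F (s k))" "tame (F 0)" for k using cutoff_family_tame[OF F] s by simp_all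
  have "test_norm m (\<lambda>x. F (s k) x - F (s l) x) \<le> a k + a l" for k l
    unfolding test_norm_def a_def sum.distrib[symmetric]
  proof (rule sum_mono)
    fix \<alpha> :: "'a \<Rightarrow> nat"
    have sq: "square_integrable \<gamma> (mi_deriv rpartial \<alpha> (F (s k)))" "square_integrable \<gamma> (mi_deriv rpartial \<alpha> (F 0))" for k
      unfolding mi_deriv_def by (intro tame_square_integrable tame_foldr tm)+
    show "l2norm \<gamma> (mi_deriv rpartial \<alpha> (\<lambda>x. F (s k) x - F (s l) x))
       \<le> l2norm \<gamma> (\<lambda>x. mi_deriv rpartial \<alpha> (F (s k)) x - mi_deriv rpartial \<alpha> (F 0) x)
       + l2norm \<gamma> (\<lambda>x. mi_deriv rpartial \<alpha> (F (s l)) x - mi_deriv rpartial \<alpha> (F 0) x)"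
      unfolding mi_deriv_diff[OF tame_smooth[OF tm(1)] tame_smooth[OF tm(1)]]
      using l2norm_triangle_diff[OF sq(1)[of k] sq(2) sq(1)[of l]]
      by (simp add: l2norm_minus_commute[of _ _ "mi_deriv rpartial \<alpha> (F (s l))"] l2norm_minus_commute[of _ "mi_deriv rpartial \<alpha> (F 0)" "mi_deriv rpartial \<alpha> (F (s l))"])
  qed
  note ab = this
  have "gs_approx m (\<lambda>k. F (s k)) (F 0)"
    unfolding gs_approx_def
  proof (intro conjI allI impI)
    show "F (s k) \<in> test_functions" for k by (rule t[OF s(1)])
    show "square_integrable \<gamma> (F 0)" by (rule tame_square_integrable[OF tm(2)])
    show "(\<lambda>k. l2norm \<gamma> (\<lambda>x. F (s k) x - F 0 x)) \<longlonglongrightarrow> 0"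
      by (rule cutoff_family_l2_tendsto[OF F s0 s(2)])
    fix e :: real assume "e > 0"
    then have "\<forall>\<^sub>F k in sequentially. a k < e / 2" using order_tendstoD(2)[OF a0, of "e / 2"] by simp
    then obtain N where N: "\<And>k. k \<ge> N \<Longrightarrow> a k < e / 2" unfolding eventually_sequentially by blast
    show "\<exists>N. \<forall>k\<ge>N. \<forall>l\<ge>N. test_norm m (\<lambda>x. F (s k) x - F (s l) x) < e"
    proof (intro exI[of _ N] allI impI)
      fix k l assume "N \<le> k" "N \<le> l"
      then show "test_norm m (\<lambda>x. F (s k) x - F (s l) x) < e"
        using ab[of k l] N[of k] N[of l] by linarith
    qed
  qed
  then show ?thesis unfolding gauss_sobolev_def by (intro CollectI exI)
qed

section \<open>Hermite functions\<close>

text \<open>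
  The Hermite polynomials orthogonal for the density \<open>exp (- t\<^sup>2 / 2)\<close>, by their three-term recursion.
\<close>

fun hermite_poly :: "nat \<Rightarrow> real \<Rightarrow> real" where
  "hermite_poly 0 t = 1"
| "hermite_poly (Suc 0) t = t"
| "hermite_poly (Suc (Suc n)) t = t * hermite_poly (Suc n) t - real (Suc n) * hermite_poly n t"

lemma hermite_poly_Suc: "hermite_poly (Suc n) t = t * hermite_poly n t - real n * hermite_poly (n - 1) t"
  by (cases n) auto

lemma hermite_poly_has_derivative: "(hermite_poly n has_real_derivative real n * hermite_poly (n - 1) t) (at t)"
proof (induction n t rule: hermite_poly.induct)
  case (1 t)
  show ?case by (simp add: hermite_poly.simps(1)[abs_def])
next
  case (2 t)
  show ?case by (simp add: hermite_poly.simps(2)[abs_def])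
next
  case (3 n t)
  let ?d = "1 * hermite_poly (Suc n) t + (real (Suc n) * hermite_poly (Suc n - 1) t) * t - real (Suc n) * (real n * hermite_poly (n - 1) t)"
  have d: "((\<lambda>t. t * hermite_poly (Suc n) t - real (Suc n) * hermite_poly n t) has_real_derivative ?d) (at t)"
    by (intro DERIV_diff DERIV_mult DERIV_ident DERIV_cmult 3)
  have "?d = hermite_poly (Suc n) t + real (Suc n) * (t * hermite_poly n t - real n * hermite_poly (n - 1) t)"
    by (simp add: algebra_simps)
  also have "\<dots> = real (Suc (Suc n)) * hermite_poly (Suc (Suc n) - 1) t"
    unfolding hermite_poly_Suc[of n t, symmetric] by (simp add: algebra_simps)
  finally show ?case
    using d unfolding hermite_poly.simps(3)[abs_def] by (simp only:)
qed

text \<open>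
  The factor \<open>sqrt 2\<close> rescales between the weights \<open>exp (- t\<^sup>2)\<close> and \<open>exp (- t\<^sup>2 / 2)\<close>.
\<close>

lemma hermite_poly_rodrigues:
  "(deriv ^^ n) (\<lambda>t. exp (- t\<^sup>2)) = (\<lambda>t::real. (-1) ^ n * sqrt 2 ^ n * hermite_poly n (sqrt 2 * t) * exp (- t\<^sup>2))"
proof (induction n)
  case (Suc n)
  show ?case
  proof
    fix t :: real
    let ?c = "(-1) ^ n * sqrt 2 ^ n :: real"
    have d: "((\<lambda>t. hermite_poly n (sqrt 2 * t)) has_real_derivative (real n * hermite_poly (n - 1) (sqrt 2 * t)) * (sqrt 2 * 1)) (at t)"
      by (rule DERIV_chain2[OF hermite_poly_has_derivative]) (intro DERIV_cmult DERIV_ident)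
    have e: "((\<lambda>t. exp (- t\<^sup>2)) has_real_derivative - 2 * t * exp (- t\<^sup>2)) (at t)"
      by (auto intro!: derivative_eq_intros)
    have "((\<lambda>t. ?c * (hermite_poly n (sqrt 2 * t) * exp (- t\<^sup>2))) has_real_derivative
       ?c * ((real n * hermite_poly (n - 1) (sqrt 2 * t)) * (sqrt 2 * 1) * exp (- t\<^sup>2) + (- 2 * t * exp (- t\<^sup>2)) * hermite_poly n (sqrt 2 * t))) (at t)"
      by (intro DERIV_cmult DERIV_mult d e)
    moreover have "?c * ((real n * hermite_poly (n - 1) (sqrt 2 * t)) * (sqrt 2 * 1) * exp (- t\<^sup>2) + (- 2 * t * exp (- t\<^sup>2)) * hermite_poly n (sqrt 2 * t))
       = (-1) ^ Suc n * sqrt 2 ^ Suc n * hermite_poly (Suc n) (sqrt 2 * t) * exp (- t\<^sup>2)"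
      by (simp add: hermite_poly_Suc algebra_simps)
    ultimately show "(deriv ^^ Suc n) (\<lambda>t. exp (- t\<^sup>2)) t = (-1) ^ Suc n * sqrt 2 ^ Suc n * hermite_poly (Suc n) (sqrt 2 * t) * exp (- t\<^sup>2)"
      by (simp add: Suc DERIV_imp_deriv mult.assoc)
  qed
qed simp

text \<open>
  The monic multiple of \<open>hermite_h \<beta>\<close>, with squared norm \<open>\<beta>!\<close>. Its recursions are free of square
  roots, which keeps the inductions below simple.
\<close>

definition hermite_prod :: "('n::finite \<Rightarrow> nat) \<Rightarrow> real^'n \<Rightarrow> complex" where
  "hermite_prod \<beta> x = of_real (\<Prod>i\<in>UNIV. hermite_poly (\<beta> i) (x $ i))"

text \<open>
  The scaling \<open>x / sqrt 2\<close> and the factors \<open>2\<^sup>|\<^sup>\<beta>\<^sup>|\<close> in the definition of \<open>hermite_h\<close> cancel.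
\<close>

lemma hermite_h_eq: "hermite_h \<beta> x = hermite_prod \<beta> x / of_real (sqrt (real (mi_fact \<beta>)))"
proof -
  have "(-1) ^ k * exp (t\<^sup>2) * (deriv ^^ k) (\<lambda>t. exp (- t\<^sup>2)) t = sqrt 2 ^ k * hermite_poly k (sqrt 2 * t)" for k and t :: real
  proof -
    have e: "exp (t\<^sup>2) * exp (- t\<^sup>2) = 1" by (simp add: exp_minus)
    have o: "(-1) ^ k * (-1) ^ k = (1 :: real)" by (simp flip: power_mult_distrib)
    have "(-1) ^ k * exp (t\<^sup>2) * ((-1) ^ k * sqrt 2 ^ k * hermite_poly k (sqrt 2 * t) * exp (- t\<^sup>2))
      = ((-1) ^ k * (-1) ^ k) * (exp (t\<^sup>2) * exp (- t\<^sup>2)) * (sqrt 2 ^ k * hermite_poly k (sqrt 2 * t))"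
      by (simp only: mult_ac)
    then show ?thesis unfolding hermite_poly_rodrigues e o by simp
  qed
  then have "hermite_H \<beta> ((1 / sqrt 2) *\<^sub>R x) = (\<Prod>i\<in>UNIV. sqrt 2 ^ \<beta> i * hermite_poly (\<beta> i) (x $ i))"
    unfolding hermite_H_def by (simp only:) simp
  also have "\<dots> = sqrt 2 ^ mi_size \<beta> * (\<Prod>i\<in>UNIV. hermite_poly (\<beta> i) (x $ i))"
    by (simp add: prod.distrib mi_size_def power_sum)
  finally show ?thesis
    unfolding hermite_h_def hermite_prod_def by (simp add: real_sqrt_mult real_sqrt_power)
qed

abbreviation inc :: "('n \<Rightarrow> nat) \<Rightarrow> 'n \<Rightarrow> 'n \<Rightarrow> nat" where
  "inc \<beta> j \<equiv> \<beta>(j := Suc (\<beta> j))"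

text \<open>
  Truncated subtraction makes \<open>dec \<beta> j = \<beta>\<close> if \<open>\<beta> j = 0\<close>; wherever \<open>dec\<close> occurs, a factor \<open>\<beta> j\<close> then
  vanishes.
\<close>

abbreviation dec :: "('n \<Rightarrow> nat) \<Rightarrow> 'n \<Rightarrow> 'n \<Rightarrow> nat" where
  "dec \<beta> j \<equiv> \<beta>(j := \<beta> j - 1)"

lemma prod_fun_upd:
  fixes f :: "'n::finite \<Rightarrow> 'b \<Rightarrow> 'c::comm_monoid_mult"
  shows "(\<Prod>i\<in>UNIV. f i ((\<beta>(j := v)) i)) = f j v * (\<Prod>i\<in>UNIV - {j}. f i (\<beta> i))"
  by (subst prod.remove[of UNIV j]) (auto intro!: prod.cong)

lemma sum_fun_upd:
  fixes f :: "'n::finite \<Rightarrow> 'b \<Rightarrow> 'c::comm_monoid_add"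
  shows "(\<Sum>i\<in>UNIV. f i ((\<beta>(j := v)) i)) = f j v + (\<Sum>i\<in>UNIV - {j}. f i (\<beta> i))"
  by (subst sum.remove[of UNIV j]) (auto intro!: sum.cong)

lemma mi_size_inc: "mi_size (inc \<beta> j) = Suc (mi_size \<beta>)"
  unfolding mi_size_def sum_fun_upd[of "\<lambda>_ k. k"] by (simp add: sum.remove[of UNIV j \<beta>])

lemma mi_fact_inc: "mi_fact (inc \<beta> j) = Suc (\<beta> j) * mi_fact \<beta>"
  unfolding mi_fact_def prod_fun_upd[of "\<lambda>_. fact"] by (simp add: prod.remove[of UNIV j "\<lambda>i. fact (\<beta> i)"] algebra_simps)

lemma mi_fact_pos: "0 < mi_fact \<beta>"
  by (simp add: mi_fact_def prod_pos)

text \<open>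
  Every multi-index arises from \<open>0\<close> by unit steps; one step corresponds to one creation operator.
\<close>

lemma mi_induct [case_names zero inc]:
  assumes "P (\<lambda>_. 0)" "\<And>\<beta> j. P \<beta> \<Longrightarrow> P (inc \<beta> j)"
  shows "P (\<beta> :: 'n::finite \<Rightarrow> nat)"
proof (induction "mi_size \<beta>" arbitrary: \<beta>)
  case 0
  then have "\<beta> = (\<lambda>_. 0)" by (auto simp: mi_size_def)
  then show ?case using assms(1) by simp
next
  case (Suc n)
  then obtain j where j: "\<beta> j \<noteq> 0" unfolding mi_size_def by (metis Zero_neq_Suc sum.neutral)
  have b: "\<beta> = inc (dec \<beta> j) j" using j by auto
  have "mi_size (dec \<beta> j) = n" using Suc(2) mi_size_inc[of "dec \<beta> j" j] unfolding b[symmetric] by simp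
  from assms(2)[OF Suc(1)[OF this[symmetric]], of j] show ?case unfolding b[symmetric] .
qed

lemma hermite_prod_inc:
  "hermite_prod (inc \<beta> j) x = of_real (x $ j) * hermite_prod \<beta> x - of_nat (\<beta> j) * hermite_prod (dec \<beta> j) x"
proof -
  have "(\<Prod>i\<in>UNIV. hermite_poly ((inc \<beta> j) i) (x $ i)) = x $ j * (\<Prod>i\<in>UNIV. hermite_poly (\<beta> i) (x $ i)) - real (\<beta> j) * (\<Prod>i\<in>UNIV. hermite_poly ((dec \<beta> j) i) (x $ i))"
    unfolding prod_fun_upd[of "\<lambda>i n. hermite_poly n (x $ i)"]
    by (simp add: prod.remove[of UNIV j "\<lambda>i. hermite_poly (\<beta> i) (x $ i)"] hermite_poly_Suc algebra_simps)
  then show ?thesis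
    unfolding hermite_prod_def by (simp only: of_real_diff of_real_mult of_real_of_nat_eq)
qed

lemma rpartial_hermite_prod: "rpartial j (hermite_prod \<beta>) x = of_nat (\<beta> j) * hermite_prod (dec \<beta> j) x"
proof (rule rpartial_eqI)
  define q where "q = (\<Prod>i\<in>UNIV - {j}. hermite_poly (\<beta> i) (x $ i))"
  have d: "((\<lambda>t. hermite_poly (\<beta> j) (x $ j + t)) has_real_derivative (real (\<beta> j) * hermite_poly (\<beta> j - 1) (x $ j + 0)) * (0 + 1)) (at 0)"
    by (rule DERIV_chain2[OF hermite_poly_has_derivative]) (intro DERIV_add DERIV_const DERIV_ident)
  have "((\<lambda>t. hermite_poly (\<beta> j) (x $ j + t) * q) has_real_derivative (real (\<beta> j) * hermite_poly (\<beta> j - 1) (x $ j + 0)) * (0 + 1) * q) (at 0)"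
    by (rule DERIV_cmult_right[OF d])
  moreover have "(\<lambda>t. hermite_poly (\<beta> j) (x $ j + t) * q) = (\<lambda>t. \<Prod>i\<in>UNIV. hermite_poly (\<beta> i) ((x + axis j t) $ i))"
  proof
    fix t
    have "(\<Prod>i\<in>UNIV. hermite_poly (\<beta> i) ((x + axis j t) $ i)) = hermite_poly (\<beta> j) ((x + axis j t) $ j) * (\<Prod>i\<in>UNIV - {j}. hermite_poly (\<beta> i) ((x + axis j t) $ i))"
      by (simp add: prod.remove[of UNIV j])
    also have "(\<Prod>i\<in>UNIV - {j}. hermite_poly (\<beta> i) ((x + axis j t) $ i)) = q"
      unfolding q_def by (rule prod.cong) (auto simp: axis_def)
    finally show "hermite_poly (\<beta> j) (x $ j + t) * q = (\<Prod>i\<in>UNIV. hermite_poly (\<beta> i) ((x + axis j t) $ i))"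
      by (simp add: axis_def)
  qed
  moreover have "(real (\<beta> j) * hermite_poly (\<beta> j - 1) (x $ j + 0)) * (0 + 1) * q = real (\<beta> j) * (\<Prod>i\<in>UNIV. hermite_poly ((dec \<beta> j) i) (x $ i))"
    unfolding q_def prod_fun_upd[of "\<lambda>i n. hermite_poly n (x $ i)"] by simp
  ultimately have "((\<lambda>t. \<Prod>i\<in>UNIV. hermite_poly (\<beta> i) ((x + axis j t) $ i)) has_real_derivative real (\<beta> j) * (\<Prod>i\<in>UNIV. hermite_poly ((dec \<beta> j) i) (x $ i))) (at 0)"
    by (simp only:)
  then have "((\<lambda>t. hermite_prod \<beta> (x + axis j t)) has_vector_derivative
      complex_of_real (real (\<beta> j) * (\<Prod>i\<in>UNIV. hermite_poly ((dec \<beta> j) i) (x $ i)))) (at 0)"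
    unfolding hermite_prod_def by (rule has_vector_derivative_of_real)
  then show "((\<lambda>t. hermite_prod \<beta> (x + axis j t)) has_vector_derivative of_nat (\<beta> j) * hermite_prod (dec \<beta> j) x) (at 0)"
    by (simp only: hermite_prod_def[of "dec \<beta> j"] of_real_mult of_real_of_nat_eq)
qed

lemma hermite_poly_cutoff_family: "(\<lambda>s (x :: real^'n::finite). of_real (hermite_poly n (x $ i))) \<in> cutoff_family"
proof (induction n "0::real" rule: hermite_poly.induct)
  case 1
  show ?case using cutoff_family.const[of 1] by simp
next
  case 2
  show ?case using cutoff_family.coord[of i] by simp
next
  case (3 n)
  have "(\<lambda>s x. of_real (x $ i) * of_real (hermite_poly (Suc n) (x $ i)) + of_real (- real (Suc n)) * of_real (hermite_poly n (x $ i))) \<in> cutoff_family"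
    by (intro cutoff_family.mult cutoff_family.add cutoff_family.const cutoff_family.coord 3)
  moreover have "(\<lambda>(s::real) (x :: real^'n). of_real (x $ i) * of_real (hermite_poly (Suc n) (x $ i)) + of_real (- real (Suc n)) * of_real (hermite_poly n (x $ i)))
    = (\<lambda>s (x :: real^'n). complex_of_real (hermite_poly (Suc (Suc n)) (x $ i)))"
    by (simp add: fun_eq_iff algebra_simps)
  ultimately show ?case by (simp only:)
qed

lemma prod_cutoff_family: "(\<And>i. i \<in> I \<Longrightarrow> f i \<in> cutoff_family) \<Longrightarrow> (\<lambda>s x. \<Prod>i\<in>I. f i s x) \<in> cutoff_family"
  by (induction I rule: infinite_finite_induct) (auto intro: cutoff_family.const cutoff_family.mult)

lemma hermite_prod_cutoff_family: "(\<lambda>s. hermite_prod \<beta>) \<in> cutoff_family"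
  unfolding hermite_prod_def[abs_def] of_real_prod by (rule prod_cutoff_family[OF hermite_poly_cutoff_family])

lemma hermite_prod_tame: "tame (hermite_prod \<beta>)"
  using cutoff_family_tame[OF hermite_prod_cutoff_family, of 0] by simp

text \<open>
  The factor \<open>exp 1\<close> normalises the cutoff to \<open>1\<close> at \<open>s = 0\<close>.
\<close>

lemma hermite_prod_gauss_sobolev: "hermite_prod \<beta> \<in> gauss_sobolev m"
proof -
  define F where "F = (\<lambda>s x. (of_real (exp 1) * of_real (bump 0 (1 - s\<^sup>2 * (norm x)\<^sup>2))) * hermite_prod \<beta> x)"
  have F: "F \<in> cutoff_family" unfolding F_def by (intro cutoff_family.mult cutoff_family.const cutoff_family.bump hermite_prod_cutoff_family)
  have "F s \<in> test_functions" if s: "0 < s" for s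
  proof -
    have "{x. F s x \<noteq> 0} \<subseteq> cball 0 (1 / s)"
    proof
      fix x assume "x \<in> {x. F s x \<noteq> 0}"
      then have "bump 0 (1 - s\<^sup>2 * (norm x)\<^sup>2) \<noteq> 0" by (auto simp: F_def)
      then have "(s * norm x)\<^sup>2 < 1\<^sup>2" by (auto simp: bump_def power_mult_distrib split: if_splits)
      then have "s * norm x < 1" by (rule power_less_imp_less_base) simp
      with s show "x \<in> cball 0 (1 / s)" by (simp add: field_simps)
    qed
    then have "bounded {x. F s x \<noteq> 0}" by (rule bounded_subset[OF bounded_cball])
    then show ?thesis using cutoff_family_smooth[OF F] by (simp add: test_functions_def)
  qed
  from cutoff_family_gauss_sobolev[OF F this] have "F 0 \<in> gauss_sobolev m" .
  moreover have "F 0 = hermite_prod \<beta>"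
    by (simp add: F_def bump_def fun_eq_iff exp_minus flip: of_real_mult)
  ultimately show ?thesis by simp
qed

text \<open>
  In \<open>L\<^sup>2(\<gamma>)\<close> the creation operator \<open>x\<^sub>j - \<partial>\<^sub>j\<close> is adjoint to the annihilation operator \<open>\<partial>\<^sub>j\<close>.
\<close>

lemma adjoint_partial:
  assumes u: "tame u" and v: "tame v"
  shows "(\<integral>x. (of_real (x $ j) * u x - rpartial j u x) * v x \<partial>\<gamma>)
    = (\<integral>x. u x * rpartial j v x \<partial>\<gamma>)"
proof -
  note sm = smooth_measurable[OF tame_smooth[OF u], measurable]
    smooth_measurable[OF tame_smooth[OF tame_rpartial[OF u]], measurable]
    smooth_measurable[OF tame_smooth[OF v], measurable]
    smooth_measurable[OF tame_smooth[OF tame_rpartial[OF v]], measurable]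
  have "(\<integral>x. rpartial j u x * v x + u x * rpartial j v x \<partial>\<gamma>) = (\<integral>x. of_real (x $ j) * (u x * v x) \<partial>\<gamma>)"
  proof (rule gauss_ibp)
    show "((\<lambda>t. u (x + axis j t) * v (x + axis j t)) has_vector_derivative rpartial j u x * v x + u x * rpartial j v x) (at 0)" for x
      using has_vector_derivative_mult[OF has_vector_derivative_rpartial[OF smooth_differentiable[OF tame_smooth[OF u]], of x j]
          has_vector_derivative_rpartial[OF smooth_differentiable[OF tame_smooth[OF v]], of x j]]
      by (simp add: axis_eq_0_iff[THEN iffD2] add.commute)
    show "(\<lambda>x. u x * v x) \<in> borel_measurable borel" "(\<lambda>x. rpartial j u x * v x + u x * rpartial j v x) \<in> borel_measurable borel"
      using sm by measurable
    show "exp_bounded (\<lambda>x. u x * v x)" "exp_bounded (\<lambda>x. rpartial j u x * v x + u x * rpartial j v x)"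
      by (intro exp_bounded_mult exp_bounded_add tame_exp_bounded u v tame_rpartial)+
  qed
  moreover have I: "integrable \<gamma> (\<lambda>x. rpartial j u x * v x)" "integrable \<gamma> (\<lambda>x. u x * rpartial j v x)"
    by (intro integrable_product tame_square_integrable tame_rpartial u v)+
  ultimately have e: "(\<integral>x. of_real (x $ j) * (u x * v x) \<partial>\<gamma>)
      = (\<integral>x. rpartial j u x * v x \<partial>\<gamma>) + (\<integral>x. u x * rpartial j v x \<partial>\<gamma>)"
    by simp
  have J: "integrable \<gamma> (\<lambda>x. of_real (x $ j) * (u x * v x))"
    using sm by (intro integrable_product exp_bounded_square_integrable exp_bounded_coord exp_bounded_mult tame_exp_bounded u v) measurable
  have "(\<integral>x. (of_real (x $ j) * u x - rpartial j u x) * v x \<partial>\<gamma>)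
    = (\<integral>x. of_real (x $ j) * (u x * v x) - rpartial j u x * v x \<partial>\<gamma>)"
    by (simp add: left_diff_distrib mult.assoc)
  also have "\<dots> = (\<integral>x. u x * rpartial j v x \<partial>\<gamma>)"
    using J I(1) by (simp add: e)
  finally show ?thesis .
qed

text \<open>
  The pairing is bilinear; as Hermite functions are real it is also the inner product with
  \<open>hermite_prod \<beta>\<close>.
\<close>

definition hermite_coeff :: "('n::finite \<Rightarrow> nat) \<Rightarrow> (real^'n \<Rightarrow> complex) \<Rightarrow> complex" where
  "hermite_coeff \<beta> g = (\<integral>x. hermite_prod \<beta> x * g x \<partial>\<gamma>)"

lemma hermite_prod_inc': "hermite_prod (inc \<beta> j) x = of_real (x $ j) * hermite_prod \<beta> x - rpartial j (hermite_prod \<beta>) x"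
  by (simp add: hermite_prod_inc rpartial_hermite_prod)

lemma hermite_coeff_inc: "tame g \<Longrightarrow> hermite_coeff (inc \<beta> j) g = hermite_coeff \<beta> (rpartial j g)"
  unfolding hermite_coeff_def hermite_prod_inc' by (rule adjoint_partial[OF hermite_prod_tame])

lemma hermite_prod_zero: "hermite_prod (\<lambda>_. 0) x = 1"
  by (simp add: hermite_prod_def)

lemma hermite_coeff_cmult: "hermite_coeff \<beta> (\<lambda>x. c * g x) = c * hermite_coeff \<beta> g"
  unfolding hermite_coeff_def by (simp add: mult.left_commute)

lemma rpartial_hermite_prod_zero: "rpartial j (hermite_prod (\<lambda>_. 0)) = (\<lambda>x. 0)"
  by (simp add: rpartial_hermite_prod fun_eq_iff)

text \<open>
  Each step of the induction moves one creation operator from \<open>\<beta>\<close> to an annihilation operator on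
  \<open>\<alpha>\<close>; the process ends at \<open>\<beta> = 0\<close>, where the roles of the two indices are exchanged.
\<close>

lemma hermite_orthogonal:
  "hermite_coeff \<beta> (hermite_prod \<alpha>) = (if \<alpha> = \<beta> then of_nat (mi_fact \<beta>) else 0)"
proof (induction \<beta> arbitrary: \<alpha> rule: mi_induct)
  case zero
  show ?case
  proof (cases "\<alpha> = (\<lambda>_. 0)")
    case True
    then show ?thesis
      by (simp add: hermite_coeff_def hermite_prod_zero mi_fact_def gauss.prob_space[simplified])
  next
    case False
    then obtain j where j: "\<alpha> j \<noteq> 0" by auto
    then have a: "\<alpha> = inc (dec \<alpha> j) j" by auto
    have "hermite_coeff (\<lambda>_. 0) (hermite_prod \<alpha>) = hermite_coeff \<alpha> (hermite_prod (\<lambda>_. 0))"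
      by (simp add: hermite_coeff_def mult.commute)
    also have "\<dots> = hermite_coeff (dec \<alpha> j) (rpartial j (hermite_prod (\<lambda>_. 0)))"
      by (subst a, rule hermite_coeff_inc[OF hermite_prod_tame])
    also have "\<dots> = 0" by (simp add: rpartial_hermite_prod_zero hermite_coeff_def)
    finally show ?thesis using False by simp
  qed
next
  case (inc \<beta> j)
  have "hermite_coeff (inc \<beta> j) (hermite_prod \<alpha>) = hermite_coeff \<beta> (\<lambda>x. of_nat (\<alpha> j) * hermite_prod (dec \<alpha> j) x)"
    by (simp add: hermite_coeff_inc[OF hermite_prod_tame] rpartial_hermite_prod[abs_def])
  also have "\<dots> = of_nat (\<alpha> j) * (if dec \<alpha> j = \<beta> then of_nat (mi_fact \<beta>) else 0)"
    by (simp only: hermite_coeff_cmult inc)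
  also have "\<dots> = (if \<alpha> = inc \<beta> j then of_nat (mi_fact (inc \<beta> j)) else 0)"
  proof (cases "\<alpha> j = 0")
    case True
    then have "\<alpha> \<noteq> inc \<beta> j" by (auto dest: fun_cong[of _ _ j])
    with True show ?thesis by simp
  next
    case False
    then have "dec \<alpha> j = \<beta> \<longleftrightarrow> \<alpha> = inc \<beta> j"
      by (auto simp: fun_eq_iff)
    moreover have "of_nat (Suc (\<beta> j)) * of_nat (mi_fact \<beta>) = (of_nat (mi_fact (inc \<beta> j)) :: complex)"
      unfolding mi_fact_inc by (rule of_nat_mult[symmetric])
    ultimately show ?thesis by auto
  qed
  finally show ?case .
qed

text \<open>
  Creation operators become multiplication by coordinates.
\<close>

lemma bargmann_coord_minus_partial:
  assumes u: "tame u"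
  shows "bargmann (\<lambda>x. of_real (x $ j) * u x - rpartial j u x) z = z $ j * bargmann u z"
proof -
  have m: "u \<in> borel_measurable borel" by (rule smooth_measurable[OF tame_smooth[OF u]])
  have xu: "square_integrable \<gamma> (\<lambda>x. of_real (x $ j) * u x)"
    using m by (intro exp_bounded_square_integrable exp_bounded_mult exp_bounded_coord tame_exp_bounded u) measurable
  have ub: "square_integrable \<gamma> u" by (rule tame_square_integrable[OF u])
  have "bargmann_partial u j z = (\<integral>x. of_real (x $ j) * u x * bargmann_kernel x z - z $ j * (u x * bargmann_kernel x z) \<partial>\<gamma>)"
    unfolding bargmann_partial_def by (simp add: algebra_simps)
  also have "\<dots> = bargmann (\<lambda>x. of_real (x $ j) * u x) z - z $ j * bargmann u z"
    using integrable_bargmann[OF xu] integrable_bargmann[OF ub] by (simp add: bargmann_def)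
  finally have p: "bargmann (rpartial j u) z = bargmann (\<lambda>x. of_real (x $ j) * u x) z - z $ j * bargmann u z"
    unfolding bargmann_partial_tame[OF u] .
  show ?thesis
    unfolding bargmann_diff[OF xu tame_square_integrable[OF tame_rpartial[OF u]]] p by simp
qed

text \<open>
  The Hermite products arise from the constant \<open>1\<close> by creation operators, the monomials arise by
  multiplication, and \<open>G 1 = 1\<close>.
\<close>

lemma bargmann_hermite_prod: "bargmann (hermite_prod \<beta>) z = (\<Prod>i\<in>UNIV. (z $ i) ^ \<beta> i)"
proof (induction \<beta> rule: mi_induct)
  case zero
  have "bargmann (hermite_prod (\<lambda>_. 0)) z = (\<integral>x. exp (\<Sum>j\<in>UNIV. of_real (x $ j) * z $ j) * exp (- csq z / 2) \<partial>\<gamma>)"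
    unfolding bargmann_def hermite_prod_zero bargmann_kernel_def cdot_def
    by (simp only: mult_1 diff_conv_add_uminus exp_add minus_divide_left)
  also have "\<dots> = exp (csq z / 2) * exp (- csq z / 2)"
    using gauss_exp[of z] by (simp add: has_bochner_integral_iff csq_def)
  also have "\<dots> = 1" by (simp add: exp_minus)
  finally show ?case by simp
next
  case (inc \<beta> j)
  have "bargmann (hermite_prod (inc \<beta> j)) z = z $ j * bargmann (hermite_prod \<beta>) z"
    using bargmann_coord_minus_partial[OF hermite_prod_tame[of \<beta>], of j z] by (simp only: hermite_prod_inc'[symmetric])
  also have "\<dots> = z $ j * (\<Prod>i\<in>UNIV. (z $ i) ^ \<beta> i)" by (simp only: inc)
  also have "\<dots> = (\<Prod>i\<in>UNIV. (z $ i) ^ (inc \<beta> j) i)"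
    unfolding prod_fun_upd[of "\<lambda>i k. (z $ i) ^ k"] by (simp add: prod.remove[of UNIV j "\<lambda>i. (z $ i) ^ \<beta> i"] mult.assoc)
  finally show ?case .
qed

lemma bargmann_hermite_h: "bargmann (hermite_h \<beta>) = fock_e \<beta>"
proof
  fix z
  have "bargmann (hermite_h \<beta>) z = bargmann (\<lambda>x. (1 / of_real (sqrt (real (mi_fact \<beta>)))) * hermite_prod \<beta> x + 0 * hermite_prod \<beta> x) z"
    by (rule arg_cong[of _ _ "\<lambda>f. bargmann f z"]) (auto simp: hermite_h_eq)
  also have "\<dots> = fock_e \<beta> z"
    by (subst bargmann_linear) (simp_all add: tame_square_integrable hermite_prod_tame bargmann_hermite_prod fock_e_def)
  finally show "bargmann (hermite_h \<beta>) z = fock_e \<beta> z" .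
qed

lemma hermite_h_gauss_sobolev: "hermite_h \<beta> \<in> gauss_sobolev m"
proof -
  have "(\<lambda>x. (1 / of_real (sqrt (real (mi_fact \<beta>)))) * hermite_prod \<beta> x + 0 * hermite_prod \<beta> x) \<in> gauss_sobolev m"
    by (intro gauss_sobolev_linear hermite_prod_gauss_sobolev)
  moreover have "(\<lambda>x. (1 / of_real (sqrt (real (mi_fact \<beta>)))) * hermite_prod \<beta> x + 0 * hermite_prod \<beta> x) = hermite_h \<beta>"
    by (auto simp: hermite_h_eq)
  ultimately show ?thesis by simp
qed

section \<open>Hermite expansions\<close>

text \<open>
  The orthogonal projection \<open>S\<^sub>N\<close> onto the Hermite functions of degree at most \<open>N\<close>; the division by
  \<open>\<beta>!\<close> accounts for the normalisation of \<open>hermite_prod\<close>.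
\<close>

definition hermite_sum :: "nat \<Rightarrow> (real^'n::finite \<Rightarrow> complex) \<Rightarrow> real^'n \<Rightarrow> complex" where
  "hermite_sum N g x = (\<Sum>\<beta> | mi_size \<beta> \<le> N. (hermite_coeff \<beta> g / of_nat (mi_fact \<beta>)) * hermite_prod \<beta> x)"

text \<open>
  The squared norm of \<open>hermite_sum N g\<close>.
\<close>

definition hermite_energy :: "nat \<Rightarrow> (real^'n::finite \<Rightarrow> complex) \<Rightarrow> real" where
  "hermite_energy N g = (\<Sum>\<beta> | mi_size \<beta> \<le> N. (cmod (hermite_coeff \<beta> g))\<^sup>2 / real (mi_fact \<beta>))"

lemma hermite_sum_tame: "tame (hermite_sum N g)"
  unfolding hermite_sum_def[abs_def] by (rule tame_sum[OF hermite_prod_tame])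

lemma hermite_sum_gauss_sobolev: "hermite_sum N g \<in> gauss_sobolev m"
  unfolding hermite_sum_def[abs_def] by (rule gauss_sobolev_sum[OF hermite_prod_gauss_sobolev])

lemma hermite_prod_square_integrable: "square_integrable \<gamma> (hermite_prod \<beta>)"
  by (rule tame_square_integrable[OF hermite_prod_tame])

lemma hermite_coeff_sum:
  assumes "finite I" "\<And>i. i \<in> I \<Longrightarrow> square_integrable \<gamma> (f i)"
  shows "hermite_coeff \<beta> (\<lambda>x. \<Sum>i\<in>I. c i * f i x) = (\<Sum>i\<in>I. c i * hermite_coeff \<beta> (f i))"
proof -
  have "hermite_coeff \<beta> (\<lambda>x. \<Sum>i\<in>I. c i * f i x) = (\<integral>x. (\<Sum>i\<in>I. c i * (hermite_prod \<beta> x * f i x)) \<partial>\<gamma>)"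
    unfolding hermite_coeff_def by (simp add: sum_distrib_left mult.left_commute)
  also have "\<dots> = (\<Sum>i\<in>I. c i * hermite_coeff \<beta> (f i))"
    unfolding hermite_coeff_def
    by (subst Bochner_Integration.integral_sum) (auto intro!: integrable_mult_right integrable_product assms hermite_prod_square_integrable)
  finally show ?thesis .
qed

lemma hermite_coeff_hermite_sum:
  assumes "mi_size \<beta> \<le> N"
  shows "hermite_coeff \<beta> (hermite_sum N g) = hermite_coeff \<beta> g"
proof -
  have "hermite_coeff \<beta> (hermite_sum N g) = (\<Sum>\<alpha> | mi_size \<alpha> \<le> N. (hermite_coeff \<alpha> g / of_nat (mi_fact \<alpha>)) * hermite_coeff \<beta> (hermite_prod \<alpha>))"
    unfolding hermite_sum_def[abs_def] by (rule hermite_coeff_sum[OF finite_mi_size hermite_prod_square_integrable])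
  also have "\<dots> = (\<Sum>\<alpha> | mi_size \<alpha> \<le> N. if \<alpha> = \<beta> then hermite_coeff \<beta> g else 0)"
    by (rule sum.cong[OF refl]) (auto simp: hermite_orthogonal mi_fact_pos[THEN less_imp_neq, symmetric])
  also have "\<dots> = hermite_coeff \<beta> g" by (subst sum.delta[OF finite_mi_size]) (use assms in simp)
  finally show ?thesis .
qed

lemma cnj_hermite_prod: "cnj (hermite_prod \<beta> x) = hermite_prod \<beta> x"
  by (simp only: hermite_prod_def complex_cnj_complex_of_real)

lemma cnj_hermite_coeff: "cnj (hermite_coeff \<beta> g) = hermite_coeff \<beta> (\<lambda>x. cnj (g x))"
  unfolding hermite_coeff_def by (subst Bochner_Integration.integral_cnj[symmetric]) (simp add: cnj_hermite_prod)

lemma hermite_sum_pairing: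
  assumes h: "square_integrable \<gamma> h"
  shows "(\<integral>x. h x * hermite_sum N g x \<partial>\<gamma>) = (\<Sum>\<beta> | mi_size \<beta> \<le> N. (hermite_coeff \<beta> g / of_nat (mi_fact \<beta>)) * hermite_coeff \<beta> h)"
proof -
  have "(\<integral>x. h x * hermite_sum N g x \<partial>\<gamma>) = (\<integral>x. (\<Sum>\<beta> | mi_size \<beta> \<le> N. (hermite_coeff \<beta> g / of_nat (mi_fact \<beta>)) * (hermite_prod \<beta> x * h x)) \<partial>\<gamma>)"
    unfolding hermite_sum_def by (simp add: sum_distrib_left mult_ac)
  also have "\<dots> = (\<Sum>\<beta> | mi_size \<beta> \<le> N. (hermite_coeff \<beta> g / of_nat (mi_fact \<beta>)) * hermite_coeff \<beta> h)"
    unfolding hermite_coeff_def[of _ h]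
    by (subst Bochner_Integration.integral_sum) (auto intro!: integrable_mult_right integrable_product h hermite_prod_square_integrable)
  finally show ?thesis .
qed

lemma hermite_sum_square_integrable: "square_integrable \<gamma> (hermite_sum N g)"
  by (rule tame_square_integrable[OF hermite_sum_tame])

text \<open>
  Pythagoras: \<open>g - S\<^sub>N g\<close> is orthogonal to \<open>S\<^sub>N g\<close>.
\<close>

lemma hermite_sum_distance:
  assumes g: "square_integrable \<gamma> g"
  shows "(l2norm \<gamma> (\<lambda>x. g x - hermite_sum N g x))\<^sup>2 = (l2norm \<gamma> g)\<^sup>2 - hermite_energy N g"
proof -
  let ?S = "hermite_sum N g"
  note S = hermite_sum_square_integrable[of N g]
  have d: "square_integrable \<gamma> (\<lambda>x. g x - ?S x)" by (rule square_integrable_diff[OF g S])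
  have of_l2: "complex_of_real ((l2norm \<gamma> f)\<^sup>2) = (\<integral>x. f x * cnj (f x) \<partial>\<gamma>)" for f :: "real^'a \<Rightarrow> complex"
    unfolding l2norm_sq integral_complex_of_real[symmetric] complex_norm_square ..
  have cS: "cnj (?S x) = hermite_sum N (\<lambda>x. cnj (g x)) x" for x
    unfolding hermite_sum_def by (simp add: cnj_hermite_prod cnj_hermite_coeff)
  have hd: "hermite_coeff \<beta> (\<lambda>x. g x - ?S x) = 0" if "mi_size \<beta> \<le> N" for \<beta>
  proof -
    have "hermite_coeff \<beta> (\<lambda>x. g x - ?S x) = hermite_coeff \<beta> g - hermite_coeff \<beta> ?S"
      using integrable_product[OF hermite_prod_square_integrable g] integrable_product[OF hermite_prod_square_integrable S]
      unfolding hermite_coeff_def by (simp add: right_diff_distrib)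
    then show ?thesis by (simp add: hermite_coeff_hermite_sum[OF that])
  qed
  have 1: "(\<integral>x. (g x - ?S x) * cnj (?S x) \<partial>\<gamma>) = 0"
    unfolding cS hermite_sum_pairing[OF d] by (rule sum.neutral) (simp add: hd)
  have 2: "(\<integral>x. ?S x * cnj (g x) \<partial>\<gamma>) = of_real (hermite_energy N g)"
  proof -
    have "(\<integral>x. ?S x * cnj (g x) \<partial>\<gamma>) = (\<Sum>\<beta> | mi_size \<beta> \<le> N. (hermite_coeff \<beta> g / of_nat (mi_fact \<beta>)) * cnj (hermite_coeff \<beta> g))"
      using hermite_sum_pairing[OF square_integrable_cnj[OF g], of N g] by (simp add: cnj_hermite_coeff mult.commute)
    also have "\<dots> = of_real (hermite_energy N g)"
      unfolding hermite_energy_def of_real_sum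
      by (rule sum.cong[OF refl]) (simp only: of_real_divide complex_norm_square of_real_of_nat_eq times_divide_eq_left)
    finally show ?thesis .
  qed
  have "complex_of_real ((l2norm \<gamma> (\<lambda>x. g x - ?S x))\<^sup>2)
     = (\<integral>x. (g x * cnj (g x) - ?S x * cnj (g x)) - (g x - ?S x) * cnj (?S x) \<partial>\<gamma>)"
    unfolding of_l2 by (simp add: algebra_simps)
  also have "\<dots> = complex_of_real ((l2norm \<gamma> g)\<^sup>2) - of_real (hermite_energy N g) - 0"
    unfolding of_l2 2[symmetric] 1[symmetric]
    using integrable_product[OF g square_integrable_cnj[OF g]] integrable_product[OF S square_integrable_cnj[OF g]]
      integrable_product[OF d square_integrable_cnj[OF S]] by simp
  finally show ?thesis by (simp only: of_real_diff[symmetric] of_real_eq_iff diff_zero)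
qed

lemma Bessel: "square_integrable \<gamma> g \<Longrightarrow> hermite_energy N g \<le> (l2norm \<gamma> g)\<^sup>2"
  using hermite_sum_distance[of g N] zero_le_power2[of "l2norm \<gamma> (\<lambda>x. g x - hermite_sum N g x)"] by linarith

lemma hermite_energy_mono: "N \<le> M \<Longrightarrow> hermite_energy N g \<le> hermite_energy M g"
  unfolding hermite_energy_def by (rule sum_mono2) (auto simp: finite_mi_size)

lemma hermite_sum_diff:
  assumes "N \<le> M"
  shows "(l2norm \<gamma> (\<lambda>x. hermite_sum M g x - hermite_sum N g x))\<^sup>2 = hermite_energy M g - hermite_energy N g"
proof -
  have c: "hermite_coeff \<beta> (hermite_sum M g) = hermite_coeff \<beta> g" if "mi_size \<beta> \<le> K" "K \<le> M" for \<beta> K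
    by (rule hermite_coeff_hermite_sum) (use that in simp)
  have s: "hermite_sum K (hermite_sum M g) = hermite_sum K g" if "K \<le> M" for K
    unfolding hermite_sum_def[of K, abs_def] by (intro ext sum.cong refl) (use c that in auto)
  have e: "hermite_energy K (hermite_sum M g) = hermite_energy K g" if "K \<le> M" for K
    unfolding hermite_energy_def by (intro sum.cong refl) (use c that in auto)
  have z: "l2norm \<gamma> (\<lambda>x::real^'a. 0) = 0" by (simp add: l2norm_def)
  have "(l2norm \<gamma> (hermite_sum M g))\<^sup>2 = hermite_energy M g"
    using hermite_sum_distance[OF hermite_sum_square_integrable[of M g], of M] by (simp add: s e z)
  then show ?thesis
    using hermite_sum_distance[OF hermite_sum_square_integrable[of M g], of N] assms by (simp add: s e)
qed

lemma hermite_energy_nonneg: "0 \<le> hermite_energy N g"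
  unfolding hermite_energy_def by (intro sum_nonneg) auto

lemma hermite_energy_convergent:
  assumes "square_integrable \<gamma> g"
  shows "convergent (\<lambda>N. hermite_energy N g)"
proof (rule Bseq_monoseq_convergent)
  show "Bseq (\<lambda>N. hermite_energy N g)"
    by (rule BseqI'[of _ "(l2norm \<gamma> g)\<^sup>2"]) (simp add: hermite_energy_nonneg Bessel assms)
  show "monoseq (\<lambda>N. hermite_energy N g)"
    by (intro monoI1 allI impI hermite_energy_mono)
qed

text \<open>
  Differentiation lowers the index of a Hermite product and, by adjointness, the coefficients of
  \<open>\<partial>\<^sub>j g\<close> are those of \<open>g\<close> at the raised index. So the projections of \<open>g\<close> and of \<open>\<partial>\<^sub>j g\<close> match with a
  shift of the degree by one.
\<close>

lemma rpartial_hermite_sum: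
  assumes g: "tame g"
  shows "rpartial j (hermite_sum (Suc N) g) = hermite_sum N (rpartial j g)"
proof
  fix x
  let ?h = "\<lambda>\<beta>. (hermite_coeff \<beta> g / of_nat (mi_fact \<beta>)) * (of_nat (\<beta> j) * hermite_prod (dec \<beta> j) x)"
  have "rpartial j (hermite_sum (Suc N) g) x = (\<Sum>\<beta> | mi_size \<beta> \<le> Suc N. ?h \<beta>)"
    unfolding hermite_sum_def[abs_def] rpartial_hermite_prod[symmetric]
    by (intro rpartial_eqI has_vector_derivative_sum has_vector_derivative_mult_right
        has_vector_derivative_rpartial smooth_differentiable tame_smooth hermite_prod_tame)
  also have "\<dots> = (\<Sum>\<beta> | mi_size \<beta> \<le> Suc N \<and> \<beta> j \<noteq> 0. ?h \<beta>)"
    by (rule sum.mono_neutral_right) (use finite_mi_size[of "Suc N"] in auto)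
  also have "\<dots> = (\<Sum>\<delta> | mi_size \<delta> \<le> N. (hermite_coeff \<delta> (rpartial j g) / of_nat (mi_fact \<delta>)) * hermite_prod \<delta> x)"
  proof (rule sum.reindex_bij_witness[where i = "\<lambda>\<delta>. inc \<delta> j" and j = "\<lambda>\<beta>. dec \<beta> j"])
    fix \<beta> assume b: "\<beta> \<in> {\<beta>. mi_size \<beta> \<le> Suc N \<and> \<beta> j \<noteq> 0}"
    then show e: "inc (dec \<beta> j) j = \<beta>" by auto
    from b show "dec \<beta> j \<in> {\<delta>. mi_size \<delta> \<le> N}" using mi_size_inc[of "dec \<beta> j" j] unfolding e by simp
    have f: "of_nat (mi_fact \<beta>) = (of_nat (\<beta> j) * of_nat (mi_fact (dec \<beta> j)) :: complex)"
      using b mi_fact_inc[of "dec \<beta> j" j] unfolding e of_nat_mult[symmetric] by simp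
    have c: "hermite_coeff \<beta> g = hermite_coeff (dec \<beta> j) (rpartial j g)"
      using hermite_coeff_inc[OF g, of "dec \<beta> j" j] unfolding e .
    show "(hermite_coeff (dec \<beta> j) (rpartial j g) / of_nat (mi_fact (dec \<beta> j))) * hermite_prod (dec \<beta> j) x = ?h \<beta>"
      unfolding c f using b by simp
  next
    fix \<delta> :: "'a \<Rightarrow> nat" assume "\<delta> \<in> {\<delta>. mi_size \<delta> \<le> N}"
    then show "inc \<delta> j \<in> {\<beta>. mi_size \<beta> \<le> Suc N \<and> \<beta> j \<noteq> 0}" by (simp add: mi_size_inc)
  qed auto
  finally show "rpartial j (hermite_sum (Suc N) g) x = hermite_sum N (rpartial j g) x"
    by (simp only: hermite_sum_def)
qed

lemma foldr_rpartial_hermite_sum: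
  assumes g: "tame g"
  shows "foldr rpartial js (hermite_sum (N + length js) g) = hermite_sum N (foldr rpartial js g)"
proof (induction js arbitrary: N)
  case (Cons j js)
  have "foldr rpartial (j # js) (hermite_sum (N + length (j # js)) g) = rpartial j (foldr rpartial js (hermite_sum (Suc N + length js) g))"
    by simp
  also have "\<dots> = hermite_sum N (foldr rpartial (j # js) g)"
    unfolding Cons rpartial_hermite_sum[OF tame_foldr[OF g]] by simp
  finally show ?case .
qed simp

lemma hermite_coeff_kernel: "hermite_coeff \<beta> (\<lambda>x. bargmann_kernel x z) = (\<Prod>i\<in>UNIV. (z $ i) ^ \<beta> i)"
  unfolding hermite_coeff_def bargmann_hermite_prod[symmetric] bargmann_def ..

lemma l2norm_kernel: "(l2norm \<gamma> (\<lambda>x. bargmann_kernel x z))\<^sup>2 = exp ((norm z)\<^sup>2)"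
proof -
  define w where "w = (\<chi> j. complex_of_real (2 * Re (z $ j)))"
  have s: "cdot x z + cnj (cdot x z) = (\<Sum>j\<in>UNIV. of_real (x $ j) * w $ j)" for x
    unfolding cdot_def cnj_sum sum.distrib[symmetric]
    by (rule sum.cong[OF refl]) (simp add: w_def complex_eq_iff)
  have q: "(\<Sum>j\<in>UNIV. (w $ j)\<^sup>2) / 2 - (csq z / 2 + cnj (csq z / 2)) = of_real ((norm z)\<^sup>2)"
    unfolding csq_def sum_norm_sq[symmetric] sum_divide_distrib cnj_sum sum.distrib[symmetric] sum_subtractf[symmetric] of_real_sum
  proof (rule sum.cong[OF refl])
    fix j
    show "(w $ j)\<^sup>2 / 2 - ((z $ j)\<^sup>2 / 2 + cnj ((z $ j)\<^sup>2 / 2)) = of_real ((cmod (z $ j))\<^sup>2)"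
      by (rule complex_eqI) (simp_all add: w_def cmod_power2, simp_all add: power2_eq_square algebra_simps)
  qed
  have "complex_of_real ((l2norm \<gamma> (\<lambda>x. bargmann_kernel x z))\<^sup>2)
     = (\<integral>x. bargmann_kernel x z * cnj (bargmann_kernel x z) \<partial>\<gamma>)"
    unfolding l2norm_sq integral_complex_of_real[symmetric] complex_norm_square ..
  also have "\<dots> = (\<integral>x. exp (\<Sum>j\<in>UNIV. of_real (x $ j) * w $ j) * exp (- (csq z / 2 + cnj (csq z / 2))) \<partial>\<gamma>)"
  proof (rule Bochner_Integration.integral_cong[OF refl])
    fix x
    show "bargmann_kernel x z * cnj (bargmann_kernel x z) = exp (\<Sum>j\<in>UNIV. of_real (x $ j) * w $ j) * exp (- (csq z / 2 + cnj (csq z / 2)))"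
      unfolding bargmann_kernel_def exp_cnj exp_add[symmetric] s[symmetric] by (simp add: algebra_simps)
  qed
  also have "\<dots> = exp ((\<Sum>j\<in>UNIV. (w $ j)\<^sup>2) / 2) * exp (- (csq z / 2 + cnj (csq z / 2)))"
    using gauss_exp[of w] by (simp only: has_bochner_integral_iff integral_mult_left_zero)
  also have "\<dots> = of_real (exp ((norm z)\<^sup>2))"
    unfolding exp_add[symmetric] exp_of_real[symmetric] q[symmetric] by (simp only: diff_conv_add_uminus)
  finally show ?thesis by (simp only: of_real_eq_iff)
qed

text \<open>
  The coefficients of the kernel are the monomials in \<open>z\<close>, so its energies are partial sums of the
  product of the exponential series of the \<open>|z\<^sub>j|\<^sup>2\<close>. Bessel's inequality bounds them by the full
  product \<open>exp |z|\<^sup>2\<close>; from below they dominate the sum over the cube of side \<open>N div n\<close>.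
\<close>

lemma hermite_energy_kernel_tendsto:
  "(\<lambda>N. hermite_energy N (\<lambda>x. bargmann_kernel x z)) \<longlonglongrightarrow> exp ((norm (z::complex^'n::finite))\<^sup>2)"
proof -
  define f where "f = (\<lambda>(i::'n) k. ((cmod (z $ i))\<^sup>2) ^ k / fact k)"
  have f0: "0 \<le> f i k" for i k by (simp add: f_def)
  have t: "(cmod (hermite_coeff \<beta> (\<lambda>x. bargmann_kernel x z)))\<^sup>2 / real (mi_fact \<beta>) = (\<Prod>i\<in>UNIV. f i (\<beta> i))" for \<beta>
    unfolding hermite_coeff_kernel f_def prod_dividef mi_fact_def
    by (simp add: prod_norm[symmetric] prod_power_distrib norm_power power_mult[symmetric] mult.commute)
  define B where "B = (\<lambda>K. \<Prod>i\<in>UNIV. \<Sum>k\<in>{..K}. f i k)"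
  have "B \<longlonglongrightarrow> (\<Prod>i\<in>UNIV. exp ((cmod (z $ i))\<^sup>2))"
    unfolding B_def
  proof (rule tendsto_prod)
    fix i
    have "(\<lambda>k. ((cmod (z $ i))\<^sup>2) ^ k /\<^sub>R fact k) sums exp ((cmod (z $ i))\<^sup>2)" by (rule exp_converges)
    then show "(\<lambda>K. \<Sum>k\<le>K. f i k) \<longlonglongrightarrow> exp ((cmod (z $ i))\<^sup>2)"
      unfolding sums_def_le f_def by (simp add: divide_inverse_commute)
  qed
  also have "(\<Prod>i\<in>UNIV. exp ((cmod (z $ i))\<^sup>2)) = exp ((norm z)\<^sup>2)"
    by (simp add: exp_sum[symmetric] sum_norm_sq)
  finally have lim: "(\<lambda>N. B (N div CARD('n))) \<longlonglongrightarrow> exp ((norm z)\<^sup>2)"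
    by (rule filterlim_compose) (rule filterlim_at_top_div_const_nat, simp)
  have lower: "B (N div CARD('n)) \<le> hermite_energy N (\<lambda>x. bargmann_kernel x z)" for N
  proof -
    let ?K = "N div CARD('n)"
    have "B ?K = (\<Sum>\<beta>\<in>PiE UNIV (\<lambda>_. {..?K}). \<Prod>i\<in>UNIV. f i (\<beta> i))"
      unfolding B_def by (rule prod_sum_PiE) auto
    also have "\<dots> \<le> (\<Sum>\<beta> | mi_size \<beta> \<le> N. \<Prod>i\<in>UNIV. f i (\<beta> i))"
    proof (rule sum_mono2[OF finite_mi_size])
      \<comment> \<open>The cube of side \<open>N div n\<close> lies in the simplex of size \<open>N\<close>.\<close>
      show "PiE UNIV (\<lambda>_. {..?K}) \<subseteq> {\<beta> :: 'n \<Rightarrow> nat. mi_size \<beta> \<le> N}"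
      proof
        fix \<beta> :: "'n \<Rightarrow> nat" assume "\<beta> \<in> PiE UNIV (\<lambda>_. {..?K})"
        then have "mi_size \<beta> \<le> CARD('n) * ?K"
          unfolding mi_size_def using sum_bounded_above[of UNIV \<beta> ?K] by (auto simp: PiE_iff)
        also have "\<dots> \<le> N" by simp
        finally show "\<beta> \<in> {\<beta>. mi_size \<beta> \<le> N}" by simp
      qed
    qed (auto intro!: prod_nonneg f0)
    also have "\<dots> = hermite_energy N (\<lambda>x. bargmann_kernel x z)"
      unfolding hermite_energy_def t ..
    finally show ?thesis .
  qed
  have upper: "hermite_energy N (\<lambda>x. bargmann_kernel x z) \<le> exp ((norm z)\<^sup>2)" for N
    using Bessel[OF square_integrable_kernel, of N z] unfolding l2norm_kernel .
  show ?thesis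
    by (rule tendsto_sandwich[OF always_eventually[OF allI] always_eventually[OF allI] lim tendsto_const])
      (rule lower upper)+
qed

lemma hermite_sum_kernel_tendsto:
  "(\<lambda>N. l2norm \<gamma> (\<lambda>x. bargmann_kernel x z - hermite_sum N (\<lambda>x. bargmann_kernel x z) x)) \<longlonglongrightarrow> 0"
proof -
  let ?e = "\<lambda>N. hermite_energy N (\<lambda>x. bargmann_kernel x z)"
  have "(\<lambda>N. sqrt (exp ((norm z)\<^sup>2) - ?e N)) \<longlonglongrightarrow> sqrt (exp ((norm z)\<^sup>2) - exp ((norm z)\<^sup>2))"
    by (intro tendsto_intros hermite_energy_kernel_tendsto)
  then have lim: "(\<lambda>N. sqrt (exp ((norm z)\<^sup>2) - ?e N)) \<longlonglongrightarrow> 0"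
    by (simp only: diff_self real_sqrt_zero)
  have eq: "sqrt (exp ((norm z)\<^sup>2) - hermite_energy N (\<lambda>x. bargmann_kernel x z))
      = l2norm \<gamma> (\<lambda>x. bargmann_kernel x z - hermite_sum N (\<lambda>x. bargmann_kernel x z) x)" for N
  proof -
    have "(l2norm \<gamma> (\<lambda>x. bargmann_kernel x z - hermite_sum N (\<lambda>x. bargmann_kernel x z) x))\<^sup>2
        = exp ((norm z)\<^sup>2) - hermite_energy N (\<lambda>x. bargmann_kernel x z)"
      using hermite_sum_distance[OF square_integrable_kernel[of z], of N] by (simp only: l2norm_kernel)
    from real_sqrt_unique[OF this l2norm_nonneg] show ?thesis .
  qed
  show ?thesis using lim unfolding eq .
qed

text \<open>
  The projection is symmetric for the bilinear pairing, so it can be moved from \<open>g\<close> to the kernel.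
\<close>

lemma bargmann_hermite_sum_tendsto:
  assumes g: "square_integrable \<gamma> g"
  shows "(\<lambda>N. bargmann (hermite_sum N g) z) \<longlonglongrightarrow> bargmann g z"
proof -
  let ?E = "\<lambda>x. bargmann_kernel x z"
  let ?d = "\<lambda>N. l2norm \<gamma> (\<lambda>x. ?E x - hermite_sum N ?E x)"
  have le: "cmod (bargmann (hermite_sum N g) z - bargmann g z) \<le> l2norm \<gamma> g * ?d N" for N
  proof -
    have "bargmann (hermite_sum N g) z = (\<integral>x. ?E x * hermite_sum N g x \<partial>\<gamma>)"
      unfolding bargmann_def by (simp only: mult.commute)
    also have "\<dots> = (\<integral>x. g x * hermite_sum N ?E x \<partial>\<gamma>)"
      unfolding hermite_sum_pairing[OF g] hermite_sum_pairing[OF square_integrable_kernel]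
      by (simp add: mult.commute)
    finally have "bargmann g z - bargmann (hermite_sum N g) z = (\<integral>x. g x * (?E x - hermite_sum N ?E x) \<partial>\<gamma>)"
      using integrable_bargmann[OF g] integrable_product[OF g hermite_sum_square_integrable, of N ?E]
      by (simp add: bargmann_def right_diff_distrib)
    then show ?thesis
      using Cauchy_Schwarz_integral[OF g square_integrable_diff[OF square_integrable_kernel hermite_sum_square_integrable, of z N ?E]]
      by (simp add: norm_minus_commute)
  qed
  have lim: "(\<lambda>N. l2norm \<gamma> g * ?d N) \<longlonglongrightarrow> l2norm \<gamma> g * 0"
    by (intro tendsto_mult tendsto_const hermite_sum_kernel_tendsto)
  have "(\<lambda>N. bargmann (hermite_sum N g) z - bargmann g z) \<longlonglongrightarrow> 0"
  proof (rule Lim_null_comparison)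
    show "\<forall>\<^sub>F N in sequentially. norm (bargmann (hermite_sum N g) z - bargmann g z) \<le> l2norm \<gamma> g * ?d N"
      by (intro always_eventually allI le)
    show "(\<lambda>N. l2norm \<gamma> g * ?d N) \<longlonglongrightarrow> 0" using lim by (simp only: mult_zero_right)
  qed
  then show ?thesis by (rule LIM_zero_cancel)
qed

text \<open>
  Differences of partial sums lie in the Gauss-Sobolev space, where \<open>G\<close> is isometric; so their images
  are small by the convergence of the energies, and Fatou's lemma replaces one of them by its
  pointwise limit.
\<close>

lemma bargmann_hermite_sum_l2_tendsto:
  assumes g: "square_integrable \<gamma> g"
  shows "(\<lambda>N. l2norm fock_measure (\<lambda>z. bargmann (hermite_sum N g) z - bargmann g z)) \<longlonglongrightarrow> 0"
proof (rule LIMSEQ_I)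
  fix r :: real assume r: "r > 0"
  have "Cauchy (\<lambda>N. hermite_energy N g)"
    using hermite_energy_convergent[OF g] by (rule convergent_Cauchy)
  then obtain N0 where N0: "\<And>M N. M \<ge> N0 \<Longrightarrow> N \<ge> N0 \<Longrightarrow> \<bar>hermite_energy M g - hermite_energy N g\<bar> < (r / 2)\<^sup>2"
    unfolding Cauchy_def dist_real_def using r by (metis half_gt_zero zero_less_power)
  show "\<exists>no. \<forall>N\<ge>no. norm (l2norm fock_measure (\<lambda>z. bargmann (hermite_sum N g) z - bargmann g z) - 0) < r"
  proof (intro exI[of _ N0] allI impI)
    fix N assume N: "N \<ge> N0"
    let ?f = "\<lambda>M x. hermite_sum N g x - hermite_sum M g x"
    have gs: "?f M \<in> gauss_sobolev 0" for M
      by (intro gauss_sobolev_diff hermite_sum_gauss_sobolev)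
    have ge: "bargmann (?f M) = (\<lambda>z. bargmann (hermite_sum N g) z - bargmann (hermite_sum M g) z)" for M
      by (intro ext bargmann_diff hermite_sum_square_integrable)
    have "l2norm fock_measure (\<lambda>z. bargmann (hermite_sum N g) z - bargmann g z) \<le> r / 2"
    proof (rule l2norm_Fatou(2)[where f = "\<lambda>M z. bargmann (hermite_sum N g) z - bargmann (hermite_sum M g) z"])
      show "square_integrable fock_measure (\<lambda>z. bargmann (hermite_sum N g) z - bargmann (hermite_sum M g) z)" for M
        using bargmann_isometry(1)[OF gs] unfolding ge .
      show "(\<lambda>z. bargmann (hermite_sum N g) z - bargmann g z) \<in> borel_measurable fock_measure"
        using bargmann_measurable[OF g] bargmann_measurable[OF hermite_sum_square_integrable[of N g]] by simp
      show "(\<lambda>M. bargmann (hermite_sum N g) z - bargmann (hermite_sum M g) z) \<longlonglongrightarrow> bargmann (hermite_sum N g) z - bargmann g z" for z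
        by (intro tendsto_intros bargmann_hermite_sum_tendsto g)
      show "\<forall>\<^sub>F M in sequentially. l2norm fock_measure (\<lambda>z. bargmann (hermite_sum N g) z - bargmann (hermite_sum M g) z) \<le> r / 2"
        unfolding eventually_sequentially
      proof (intro exI[of _ N] allI impI)
        fix M assume M: "M \<ge> N"
        have "(l2norm \<gamma> (?f M))\<^sup>2 = hermite_energy M g - hermite_energy N g"
          unfolding l2norm_minus_commute[of _ "hermite_sum N g"] by (rule hermite_sum_diff[OF M])
        also have "\<dots> \<le> (r / 2)\<^sup>2" using N0[of M N] N M by simp
        finally have "l2norm \<gamma> (?f M) \<le> r / 2" by (rule power2_le_imp_le) (use r in simp)
        then show "l2norm fock_measure (\<lambda>z. bargmann (hermite_sum N g) z - bargmann (hermite_sum M g) z) \<le> r / 2"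
          using bargmann_isometry(2)[OF gs, of M] unfolding ge by simp
      qed
    qed
    then show "norm (l2norm fock_measure (\<lambda>z. bargmann (hermite_sum N g) z - bargmann g z) - 0) < r"
      using r by (simp add: l2norm_nonneg)
  qed
qed

section \<open>Density of the Hermite functions and uniqueness\<close>

lemma separately_holomorphic_bargmann: "square_integrable \<gamma> f \<Longrightarrow> separately_holomorphic (bargmann f)"
  by (intro entire_separately_holomorphic entire_bargmann)

lemma hermite_sum_dense:
  assumes g: "tame g"
  shows "(\<lambda>N. fock_sobolev_norm m (\<lambda>z. bargmann (hermite_sum N g) z - bargmann g z)) \<longlonglongrightarrow> 0"
proof -
  have "(\<lambda>N. fock_sobolev_norm m (\<lambda>z. bargmann (hermite_sum N g) z - bargmann g z)) \<longlonglongrightarrow> (\<Sum>\<alpha>::'a \<Rightarrow> nat | mi_size \<alpha> \<le> m. 0)"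
    unfolding fock_sobolev_norm_def
  proof (rule tendsto_sum)
    fix \<alpha> :: "'a \<Rightarrow> nat"
    define js where "js = (SOME js. \<forall>j. count_list js j = \<alpha> j)"
    \<comment> \<open>Differentiating along \<open>js\<close> lowers the degree of the projection by the length of \<open>js\<close>.\<close>
    have "(\<lambda>N. l2norm fock_measure (foldr cpartial js (\<lambda>z. bargmann (hermite_sum (N + length js) g) z - bargmann g z))) \<longlonglongrightarrow> 0"
      unfolding foldr_cpartial_diff[OF separately_holomorphic_bargmann[OF hermite_sum_square_integrable] separately_holomorphic_bargmann[OF tame_square_integrable[OF g]]]
        foldr_cpartial_bargmann[OF hermite_sum_tame] foldr_cpartial_bargmann[OF g] foldr_rpartial_hermite_sum[OF g]
      by (rule bargmann_hermite_sum_l2_tendsto[OF tame_square_integrable[OF tame_foldr[OF g]]])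
    then have "(\<lambda>N. l2norm fock_measure (foldr cpartial js (\<lambda>z. bargmann (hermite_sum N g) z - bargmann g z))) \<longlonglongrightarrow> 0"
      by (rule LIMSEQ_offset)
    then show "(\<lambda>N. l2norm fock_measure (mi_deriv cpartial \<alpha> (\<lambda>z. bargmann (hermite_sum N g) z - bargmann g z))) \<longlonglongrightarrow> 0"
      by (simp add: mi_deriv_def js_def)
  qed
  then show ?thesis by simp
qed

lemma fock_sobolev_norm_triangle:
  assumes "F \<in> fock_sobolev m" "G \<in> fock_sobolev m" "H \<in> fock_sobolev m"
  shows "fock_sobolev_norm m (\<lambda>z. F z - H z) \<le> fock_sobolev_norm m (\<lambda>z. F z - G z) + fock_sobolev_norm m (\<lambda>z. G z - H z)"
  unfolding fock_sobolev_norm_def sum.distrib[symmetric]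
proof (rule sum_mono)
  fix \<alpha> :: "'a \<Rightarrow> nat" assume \<alpha>: "\<alpha> \<in> {\<alpha>. mi_size \<alpha> \<le> m}"
  have d: "mi_deriv cpartial \<alpha> (\<lambda>z. A z - B z) = (\<lambda>z. mi_deriv cpartial \<alpha> A z - mi_deriv cpartial \<alpha> B z)"
    if "A \<in> fock_sobolev m" "B \<in> fock_sobolev m" for A B
    unfolding mi_deriv_def using that
    by (intro foldr_cpartial_diff) (auto simp: fock_sobolev_def intro: entire_separately_holomorphic)
  show "l2norm fock_measure (mi_deriv cpartial \<alpha> (\<lambda>z. F z - H z))
     \<le> l2norm fock_measure (mi_deriv cpartial \<alpha> (\<lambda>z. F z - G z)) + l2norm fock_measure (mi_deriv cpartial \<alpha> (\<lambda>z. G z - H z))"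
    unfolding d[OF assms(1,2)] d[OF assms(2,3)] d[OF assms(1,3)]
    by (rule l2norm_triangle_diff) (use assms \<alpha> in \<open>auto simp: fock_sobolev_def\<close>)
qed

text \<open>
  The term with \<open>\<alpha> = 0\<close> forces equality almost everywhere, and both functions are continuous.
\<close>

lemma fock_sobolev_norm_eq_0:
  assumes F: "F \<in> fock_sobolev m" and G: "G \<in> fock_sobolev m"
    and z: "fock_sobolev_norm m (\<lambda>z. F z - G z) \<le> 0"
  shows "F = G"
proof (rule ccontr)
  assume "F \<noteq> G"
  define h where "h = (\<lambda>z. F z - G z)"
  have s0: "mi_size (\<lambda>_::'a. 0) \<le> m" by (simp add: mi_size_def)
  have "l2norm fock_measure (mi_deriv cpartial (\<lambda>_. 0) h) \<le> fock_sobolev_norm m h"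
    unfolding fock_sobolev_norm_def by (rule member_le_sum) (use s0 finite_mi_size in \<open>auto simp: l2norm_nonneg\<close>)
  then have "l2norm fock_measure h \<le> 0" using z by (simp add: mi_deriv_zero h_def)
  then have l0: "l2norm fock_measure h = 0" using l2norm_nonneg[of fock_measure h] by simp
  have "square_integrable fock_measure (mi_deriv cpartial (\<lambda>_. 0) F)" "square_integrable fock_measure (mi_deriv cpartial (\<lambda>_. 0) G)"
    using F G s0 unfolding fock_sobolev_def by blast+
  then have sq: "square_integrable fock_measure h"
    unfolding h_def mi_deriv_zero by (rule square_integrable_diff)
  have "(\<integral>z. (cmod (h z))\<^sup>2 \<partial>fock_measure) = 0" using l0 l2norm_sq[of fock_measure h] by simp
  then have "AE z in fock_measure. (cmod (h z))\<^sup>2 = 0"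
    using integral_nonneg_eq_0_iff_AE[OF square_integrable_sq[OF sq]] by simp
  then have ae: "AE z in lborel. h z = 0"
    unfolding fock_measure_def by (subst (asm) AE_density) (auto elim!: eventually_mono)
  define U where "U = h -` (- {0})"
  have "continuous_on UNIV h"
    unfolding h_def using F G by (intro continuous_on_diff entire_continuous) (auto simp: fock_sobolev_def)
  then have oU: "open U"
    unfolding U_def by (intro open_vimage) auto
  have "U \<noteq> {}" using \<open>F \<noteq> G\<close> by (auto simp: U_def h_def fun_eq_iff)
  moreover have "U \<in> null_sets lborel"
    using ae oU AE_iff_null_sets[of U lborel] by (simp add: U_def)
  ultimately show False
    using open_not_negligible[OF oU] by (auto simp: negligible_iff_null_sets dest: null_sets_completionI)
qed

lemma gauss_sobolev_norm_diff:
  assumes "f \<in> gauss_sobolev m" "g \<in> gauss_sobolev m"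
  shows "gauss_sobolev_norm m (\<lambda>x. f x - g x) = fock_sobolev_norm m (\<lambda>z. bargmann f z - bargmann g z)"
proof -
  have "bargmann (\<lambda>x. f x - g x) = (\<lambda>z. bargmann f z - bargmann g z)"
    by (intro ext bargmann_diff gauss_sobolev_square_integrable[OF assms(1)] gauss_sobolev_square_integrable[OF assms(2)])
  then show ?thesis using gauss_sobolev_norm_eq[OF gauss_sobolev_diff[OF assms]] by simp
qed

lemma gauss_bargmann_bargmann: "gauss_bargmann m bargmann"
  unfolding gauss_bargmann_def
proof (intro conjI ballI allI impI)
  show "bargmann f \<in> fock_sobolev m" if "f \<in> gauss_sobolev m" for f :: "real^'a \<Rightarrow> complex"
    using that by (rule bargmann_fock_sobolev)
  show "bargmann (\<lambda>x. a * f x + b * g x) = (\<lambda>z. a * bargmann f z + b * bargmann g z)"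
    if "f \<in> gauss_sobolev m" "g \<in> gauss_sobolev m" for f g :: "real^'a \<Rightarrow> complex" and a b
    by (intro ext bargmann_linear gauss_sobolev_square_integrable[OF that(1)] gauss_sobolev_square_integrable[OF that(2)])
  show "(\<lambda>k. fock_sobolev_norm m (\<lambda>z. bargmann (u k) z - bargmann f z)) \<longlonglongrightarrow> 0"
    if f: "f \<in> gauss_sobolev m" and u: "\<forall>k. u k \<in> gauss_sobolev m"
      and l: "(\<lambda>k. gauss_sobolev_norm m (\<lambda>x. u k x - f x)) \<longlonglongrightarrow> 0" for f :: "real^'a \<Rightarrow> complex" and u
    using l by (simp only: gauss_sobolev_norm_diff[OF u[rule_format] f])
  show "bargmann (hermite_h \<beta>) = fock_e \<beta>" for \<beta> :: "'a \<Rightarrow> nat" by (rule bargmann_hermite_h)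
qed

lemma gauss_bargmann_sum:
  assumes G: "gauss_bargmann m G" and I: "finite I"
  shows "G (\<lambda>x. \<Sum>\<beta>\<in>I. c \<beta> * hermite_h \<beta> x) = (\<lambda>z. \<Sum>\<beta>\<in>I. c \<beta> * fock_e \<beta> z)"
  using I
proof induction
  have lin: "G (\<lambda>x. a * f x + b * g x) = (\<lambda>z. a * G f z + b * G g z)"
    if "f \<in> gauss_sobolev m" "g \<in> gauss_sobolev m" for f g a b
    using G that unfolding gauss_bargmann_def by blast
  case empty
  show ?case using lin[OF hermite_h_gauss_sobolev hermite_h_gauss_sobolev, of 0 _ 0] by simp
next
  have lin: "G (\<lambda>x. a * f x + b * g x) = (\<lambda>z. a * G f z + b * G g z)"
    if "f \<in> gauss_sobolev m" "g \<in> gauss_sobolev m" for f g a b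
    using G that unfolding gauss_bargmann_def by blast
  case (insert \<beta> I)
  have "G (\<lambda>x. c \<beta> * hermite_h \<beta> x + 1 * (\<Sum>\<beta>\<in>I. c \<beta> * hermite_h \<beta> x)) = (\<lambda>z. c \<beta> * G (hermite_h \<beta>) z + 1 * G (\<lambda>x. \<Sum>\<beta>\<in>I. c \<beta> * hermite_h \<beta> x) z)"
    by (rule lin[OF hermite_h_gauss_sobolev gauss_sobolev_sum[OF hermite_h_gauss_sobolev]])
  moreover have "G (hermite_h \<beta>) = fock_e \<beta>" using G unfolding gauss_bargmann_def by blast
  ultimately show ?case using insert by simp
qed

lemma hermite_sum_eq_hermite_h:
  "hermite_sum N g = (\<lambda>x. \<Sum>\<beta> | mi_size \<beta> \<le> N. (hermite_coeff \<beta> g / of_nat (mi_fact \<beta>) * of_real (sqrt (real (mi_fact \<beta>)))) * hermite_h \<beta> x)"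
  unfolding hermite_sum_def[abs_def] hermite_h_eq
  by (intro ext sum.cong refl) (simp add: mi_fact_pos[THEN less_imp_neq, symmetric])

text \<open>
  A general \<open>f\<close> is approximated by test functions and each of those by its Hermite sums. Choosing the
  degree along the sequence gives Hermite sums converging to \<open>f\<close>, on which any two transforms agree.
\<close>

lemma gauss_bargmann_unique:
  assumes G: "gauss_bargmann m G" and f: "f \<in> gauss_sobolev m"
  shows "G f = bargmann f"
proof -
  obtain \<phi> where a: "gs_approx m \<phi> f" using f by (auto simp: gauss_sobolev_def)
  note t = gs_approx_test[OF a]
  have \<phi>gs: "\<phi> k \<in> gauss_sobolev m" for k by (rule test_functions_gauss_sobolev[OF t])
  have GF: "G h \<in> fock_sobolev m" if "h \<in> gauss_sobolev m" for h
    using G that unfolding gauss_bargmann_def by blast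
  note gF = bargmann_fock_sobolev
  have "(\<lambda>k. fock_sobolev_norm m (\<lambda>z. bargmann (\<phi> k) z - bargmann f z)) \<longlonglongrightarrow> (\<Sum>\<alpha>::'a \<Rightarrow> nat | mi_size \<alpha> \<le> m. 0)"
    unfolding fock_sobolev_norm_def
  proof (rule tendsto_sum)
    fix \<alpha> :: "'a \<Rightarrow> nat" assume "\<alpha> \<in> {\<alpha>. mi_size \<alpha> \<le> m}"
    then have "mi_size \<alpha> \<le> m" by simp
    from gs_approx_derivative(3)[OF a this]
    show "(\<lambda>k. l2norm fock_measure (mi_deriv cpartial \<alpha> (\<lambda>z. bargmann (\<phi> k) z - bargmann f z))) \<longlonglongrightarrow> 0"
      unfolding mi_deriv_def
        foldr_cpartial_diff[OF separately_holomorphic_bargmann[OF test_square_integrable[OF t]] separately_holomorphic_bargmann[OF gauss_sobolev_square_integrable[OF f]]] .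
  qed
  then have l1: "(\<lambda>k. fock_sobolev_norm m (\<lambda>z. bargmann (\<phi> k) z - bargmann f z)) \<longlonglongrightarrow> 0" by simp
  have "\<exists>N. fock_sobolev_norm m (\<lambda>z. bargmann (hermite_sum N (\<phi> k)) z - bargmann (\<phi> k) z) < 1 / real (Suc k)" for k
    using order_tendstoD(2)[OF hermite_sum_dense[OF test_function_tame[OF t[of k]], of m], of "1 / real (Suc k)"]
    by (auto simp: eventually_sequentially)
  then obtain N where N: "\<And>k. fock_sobolev_norm m (\<lambda>z. bargmann (hermite_sum (N k) (\<phi> k)) z - bargmann (\<phi> k) z) < 1 / real (Suc k)"
    by metis
  define u where "u = (\<lambda>k. hermite_sum (N k) (\<phi> k))"
  have ugs: "u k \<in> gauss_sobolev m" for k unfolding u_def by (rule hermite_sum_gauss_sobolev)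
  have nn: "0 \<le> fock_sobolev_norm m F" for F :: "complex^'a \<Rightarrow> complex"
    unfolding fock_sobolev_norm_def by (intro sum_nonneg l2norm_nonneg)
  have u0: "(\<lambda>k. fock_sobolev_norm m (\<lambda>z. bargmann (u k) z - bargmann f z)) \<longlonglongrightarrow> 0"
  proof (rule tendsto_sandwich[OF _ _ tendsto_const])
    show "(\<lambda>k. 1 / real (Suc k) + fock_sobolev_norm m (\<lambda>z. bargmann (\<phi> k) z - bargmann f z)) \<longlonglongrightarrow> 0"
      using tendsto_add[OF LIMSEQ_inverse_real_of_nat l1] by (simp add: inverse_eq_divide)
    show "\<forall>\<^sub>F k in sequentially. fock_sobolev_norm m (\<lambda>z. bargmann (u k) z - bargmann f z) \<le> 1 / real (Suc k) + fock_sobolev_norm m (\<lambda>z. bargmann (\<phi> k) z - bargmann f z)"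
    proof (intro always_eventually allI)
      fix k
      show "fock_sobolev_norm m (\<lambda>z. bargmann (u k) z - bargmann f z) \<le> 1 / real (Suc k) + fock_sobolev_norm m (\<lambda>z. bargmann (\<phi> k) z - bargmann f z)"
        using fock_sobolev_norm_triangle[OF gF[OF ugs[of k]] gF[OF \<phi>gs[of k]] gF[OF f]] N[of k]
        unfolding u_def by linarith
    qed
  qed (simp add: nn)
  have Gu: "G (u k) = bargmann (u k)" for k
    unfolding u_def hermite_sum_eq_hermite_h gauss_bargmann_sum[OF G finite_mi_size] gauss_bargmann_sum[OF gauss_bargmann_bargmann finite_mi_size] ..
  have "(\<lambda>k. gauss_sobolev_norm m (\<lambda>x. u k x - f x)) \<longlonglongrightarrow> 0"
    using u0 by (simp only: gauss_sobolev_norm_diff[OF ugs f])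
  then have G0: "(\<lambda>k. fock_sobolev_norm m (\<lambda>z. G (u k) z - G f z)) \<longlonglongrightarrow> 0"
    using G f ugs unfolding gauss_bargmann_def by blast
  have sym: "fock_sobolev_norm m (\<lambda>z. bargmann f z - bargmann (u k) z) = fock_sobolev_norm m (\<lambda>z. bargmann (u k) z - bargmann f z)" for k
    unfolding fock_sobolev_norm_def
    by (intro sum.cong refl) (simp add: mi_deriv_def foldr_cpartial_diff separately_holomorphic_bargmann gauss_sobolev_square_integrable[OF f] gauss_sobolev_square_integrable[OF ugs] l2norm_minus_commute)
  have "fock_sobolev_norm m (\<lambda>z. bargmann f z - G f z) \<le> 0"
  proof (rule LIMSEQ_le_const)
    show "(\<lambda>k. fock_sobolev_norm m (\<lambda>z. bargmann (u k) z - bargmann f z) + fock_sobolev_norm m (\<lambda>z. G (u k) z - G f z)) \<longlonglongrightarrow> 0"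
      using tendsto_add[OF u0 G0] by simp
    have "fock_sobolev_norm m (\<lambda>z. bargmann f z - G f z) \<le> fock_sobolev_norm m (\<lambda>z. bargmann (u k) z - bargmann f z) + fock_sobolev_norm m (\<lambda>z. G (u k) z - G f z)" for k
      using fock_sobolev_norm_triangle[OF gF[OF f] gF[OF ugs[of k]] GF[OF f]] unfolding sym Gu .
    then show "\<exists>N. \<forall>k\<ge>N. fock_sobolev_norm m (\<lambda>z. bargmann f z - G f z) \<le> fock_sobolev_norm m (\<lambda>z. bargmann (u k) z - bargmann f z) + fock_sobolev_norm m (\<lambda>z. G (u k) z - G f z)"
      by blast
  qed
  from fock_sobolev_norm_eq_0[OF gF[OF f] GF[OF f] this] show ?thesis by simp
qed

theorem theorem2p1:
  fixes m :: nat
  assumes "0 < m"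
  shows "(\<forall>\<beta> :: 'n::finite \<Rightarrow> nat. hermite_h \<beta> \<in> gauss_sobolev m) \<and>
    (\<exists>G :: (real^'n \<Rightarrow> complex) \<Rightarrow> (complex^'n \<Rightarrow> complex).
      gauss_bargmann m G \<and>
      (\<forall>G'. gauss_bargmann m G' \<longrightarrow> (\<forall>f\<in>gauss_sobolev m. G' f = G f)) \<and>
      (\<forall>f\<in>gauss_sobolev m. fock_sobolev_norm m (G f) = gauss_sobolev_norm m f))"
proof (intro conjI allI exI[of _ bargmann] impI ballI)
  show "hermite_h \<beta> \<in> gauss_sobolev m" for \<beta> :: "'n \<Rightarrow> nat" by (rule hermite_h_gauss_sobolev)
  show "gauss_bargmann m (bargmann :: (real^'n \<Rightarrow> complex) \<Rightarrow> complex^'n \<Rightarrow> complex)" by (rule gauss_bargmann_bargmann)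
  show "G' f = bargmann f" if "gauss_bargmann m G'" "f \<in> gauss_sobolev m" for G' and f :: "real^'n \<Rightarrow> complex"
    using that by (rule gauss_bargmann_unique)
  show "fock_sobolev_norm m (bargmann f) = gauss_sobolev_norm m f" if "f \<in> gauss_sobolev m" for f :: "real^'n \<Rightarrow> complex"
    using gauss_sobolev_norm_eq[OF that] by simp
qed

end
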